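(* Let $\Sigma\subset H_r$ be a finite nonempty antichain (under diagram containment) of Young diagrams and let $I_\Sigma=\sum_{\sigma\in\Sigma}I_\sigma\subseteq R$. Then for any positive integer $p\leq r$ the skew Waldschmidt constants for the family of generalized symbolic powers $I_\Sigma^{(\bullet)_p}$ are given by $$\widehat{\gamma_j}^p(I_\Sigma):=\lim_{m\to\infty}\frac{\gamma_j\left(I_\Sigma^{(m)_p}\right)}{m}=\begin{cases}\dfrac{(r-j+1)\,\gamma_p(\Sigma)}{r-p+1} & \text{for } 1\leq j\leq p,\\[2mm] \gamma_j(\Sigma) & \text{for } p<j\leq r.\end{cases}$$ In particular, the Waldschmidt constant is $$\widehat{\alpha}^p(I_\Sigma):=\lim_{m\to\infty}\frac{\alpha\left(I_\Sigma^{(m)_p}\right)}{m}=\frac{r\,\gamma_p(\Sigma)}{r-p+1}.$$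
   Context: $\Bbbk$ is a field of characteristic zero, $X=(x_{ij})$ is a generic $r\times n$ matrix of indeterminates with $r\leq n$, and $R=\Bbbk[X]$ with the standard grading. The group $G=\mathrm{GL}_r(\Bbbk)\times\mathrm{GL}_n(\Bbbk)$ acts on $R$: $(A,B)$ sends $x_{ij}$ to the $(i,j)$ entry of $A^{-1}XB$. A Young diagram is a finite weakly decreasing sequence $\sigma=(\sigma_1,\ldots,\sigma_s)$ of positive integers (row lengths). $H_r$ is the set of Young diagrams with at most $r$ columns. Containment $\mu\subseteq\lambda$ means $\mu_i\leq\lambda_i$ for all $i$ after padding with zeros. $K_\sigma=\prod_{i}[1\,2\ldots\sigma_i\mid 1\,2\ldots\sigma_i]$ is the product of the leading principal minors of $X$ of sizes $\sigma_i$; $I_\sigma$ is the smallest $G$-invariant ideal of $R$ containing $K_\sigma$. $D_j$ ($1\leq j\leq r$) is the (prime) ideal generated by the $j\times j$ minors of $X$. For a $G$-invariant ideal $I$ and $m\geq1$, $I^{(m)_p}:=I^mR_{D_p}\cap R$, and $I^{(\bullet)_p}=\{I^{(m)_p}\}_{m\geq1}$. $\alpha(J)$ is the smallest degree of a nonzero homogeneous element of a homogeneous ideal $J$. The valuation $\gamma_j$ on $\mathrm{Frac}(R)$ is determined by $\gamma_j(f)=\max\{i\geq0: f\in D_j^{(i)}\}$ for $0\neq f\in R$, where $D_j^{(i)}=D_j^iR_{D_j}\cap R$; for a nonzero ideal $J$, $\gamma_j(J)=\min\{\gamma_j(f):0\neq f\in J\}$. For $\sigma\in H_r$, $\gamma_j(\sigma)=\sum_i\max\{0,\sigma_i-j+1\}$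 (the number of boxes weakly to the right of column $j$), and $\gamma_j(\Sigma)=\min\{\gamma_j(\sigma):\sigma\in\Sigma\}$. *)

theory Defs
  imports
    Complex_Main
    "HOL-Library.Poly_Mapping"
    "HOL-Library.Product_Lexorder"
    "HOL-Library.More_List"
    "HOL-Algebra.Ideal_Product"
    "HOL-Computational_Algebra.Polynomial_Factorial"
    "Jordan_Normal_Form.Determinant"
    "Jordan_Normal_Form.DL_Submatrix"
begin

section \<open>The polynomial ring of a generic matrix\<close>

text \<open>
  Polynomials over \<open>'k\<close> in countably many indeterminates \<open>x\<^sub>i\<^sub>j\<close>; a monomial is a finitely
  supported exponent function.  Rows and columns are numbered from 0, as in the matrix library.
  The lexicographic order on index pairs is needed only for the \<^class>\<open>idom\<close> instance.
\<close>

type_synonym 'k mpoly = "((nat \<times> nat) \<Rightarrow>\<^sub>0 nat) \<Rightarrow>\<^sub>0 'k"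

definition Const :: "'k::field_char_0 \<Rightarrow> 'k mpoly" where
  "Const c = Poly_Mapping.single 0 c"

definition Var :: "nat \<Rightarrow> nat \<Rightarrow> 'k::field_char_0 mpoly" where
  "Var i j = Poly_Mapping.single (Poly_Mapping.single (i, j) 1) 1"

definition coord_ring :: "nat \<Rightarrow> nat \<Rightarrow> 'k::field_char_0 mpoly ring" where
  "coord_ring r n =
     \<lparr>carrier = {f. \<forall>u\<in>Poly_Mapping.keys f. Poly_Mapping.keys u \<subseteq> {..<r} \<times> {..<n}},
      monoid.mult = (*), one = 1, zero = 0, add = (+)\<rparr>"

definition generic_mat :: "nat \<Rightarrow> nat \<Rightarrow> 'k::field_char_0 mpoly mat" where
  "generic_mat r n = mat r n (\<lambda>(i, j). Var i j)"

definition homogeneous_of_degree :: "nat \<Rightarrow> 'k::field_char_0 mpoly \<Rightarrow> bool" where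
  "homogeneous_of_degree d f \<longleftrightarrow>
     (\<forall>u\<in>Poly_Mapping.keys f. (\<Sum>v\<in>Poly_Mapping.keys u. Poly_Mapping.lookup u v) = d)"

section \<open>The group action\<close>

text \<open>The \<open>'k\<close>-algebra homomorphism sending the indeterminate with index \<open>v\<close> to \<open>g v\<close>.\<close>

definition poly_subst ::
    "(nat \<times> nat \<Rightarrow> 'k::field_char_0 mpoly) \<Rightarrow> 'k mpoly \<Rightarrow> 'k mpoly" where
  "poly_subst g f =
     (\<Sum>u\<in>Poly_Mapping.keys f. Const (Poly_Mapping.lookup f u) *
        (\<Prod>v\<in>Poly_Mapping.keys u. g v ^ Poly_Mapping.lookup u v))"

abbreviation GL :: "nat \<Rightarrow> 'k::field_char_0 mat set" where
  "GL d \<equiv> Units (ring_mat TYPE('k) d ())"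

definition act ::
    "nat \<Rightarrow> nat \<Rightarrow> 'k::field_char_0 mat \<Rightarrow> 'k mat \<Rightarrow> 'k mpoly \<Rightarrow> 'k mpoly" where
  "act r n A B =
     poly_subst (\<lambda>v. (map_mat Const (inv\<^bsub>ring_mat TYPE('k) r ()\<^esub> A) * generic_mat r n
                        * map_mat Const B) $$ v)"

definition invariant_ideal :: "nat \<Rightarrow> nat \<Rightarrow> 'k::field_char_0 mpoly set \<Rightarrow> bool" where
  "invariant_ideal r n I \<longleftrightarrow>
     ideal I (coord_ring r n) \<and> (\<forall>A\<in>GL r. \<forall>B\<in>GL n. act r n A B ` I \<subseteq> I)"

section \<open>Young diagrams\<close>

definition young_diagram :: "nat list \<Rightarrow> bool" where
  "young_diagram \<sigma> \<longleftrightarrow> sorted_wrt (\<ge>) \<sigma> \<and> (\<forall>s\<in>set \<sigma>. 0 < s)"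

definition H :: "nat \<Rightarrow> nat list set" where
  "H r = {\<sigma>. young_diagram \<sigma> \<and> (\<forall>s\<in>set \<sigma>. s \<le> r)}"

definition diagram_contained :: "nat list \<Rightarrow> nat list \<Rightarrow> bool" where
  "diagram_contained \<mu> \<nu> \<longleftrightarrow> (\<forall>i. nth_default 0 \<mu> i \<le> nth_default 0 \<nu> i)"

definition diagram_antichain :: "nat list set \<Rightarrow> bool" where
  "diagram_antichain \<Sigma> \<longleftrightarrow> (\<forall>\<sigma>\<in>\<Sigma>. \<forall>\<tau>\<in>\<Sigma>. \<sigma> \<noteq> \<tau> \<longrightarrow> \<not> diagram_contained \<sigma> \<tau>)"

text \<open>Truncated subtraction on \<^typ>\<open>nat\<close> makes \<open>s + 1 - j\<close> equal to \<open>max {0, s - j + 1}\<close>.\<close>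

definition gamma_diagram :: "nat \<Rightarrow> nat list \<Rightarrow> nat" where
  "gamma_diagram j \<sigma> = (\<Sum>s\<leftarrow>\<sigma>. s + 1 - j)"

definition gamma_diagrams :: "nat \<Rightarrow> nat list set \<Rightarrow> nat" where
  "gamma_diagrams j \<Sigma> = Min (gamma_diagram j ` \<Sigma>)"

section \<open>The ideals of a set of diagrams\<close>

definition K_poly :: "nat \<Rightarrow> nat \<Rightarrow> nat list \<Rightarrow> 'k::field_char_0 mpoly" where
  "K_poly r n \<sigma> = (\<Prod>s\<leftarrow>\<sigma>. det (submatrix (generic_mat r n) {..<s} {..<s}))"

definition I_diagram :: "nat \<Rightarrow> nat \<Rightarrow> nat list \<Rightarrow> 'k::field_char_0 mpoly set" where
  "I_diagram r n \<sigma> = \<Inter>{I. invariant_ideal r n I \<and> K_poly r n \<sigma> \<in> I}"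

definition I_diagrams :: "nat \<Rightarrow> nat \<Rightarrow> nat list set \<Rightarrow> 'k::field_char_0 mpoly set" where
  "I_diagrams r n \<Sigma> = {(\<Sum>\<sigma>\<in>\<Sigma>. h \<sigma>) | h. \<forall>\<sigma>\<in>\<Sigma>. h \<sigma> \<in> I_diagram r n \<sigma>}"

section \<open>Symbolic powers\<close>

definition D_ideal :: "nat \<Rightarrow> nat \<Rightarrow> nat \<Rightarrow> 'k::field_char_0 mpoly set" where
  "D_ideal r n j = Idl\<^bsub>coord_ring r n\<^esub>
     {det (submatrix (generic_mat r n) S T) | S T.
        S \<subseteq> {..<r} \<and> T \<subseteq> {..<n} \<and> card S = j \<and> card T = j}"

text \<open>The localization of the coordinate ring at a prime ideal \<open>P\<close>, inside a fraction field.\<close>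

definition localization ::
    "nat \<Rightarrow> nat \<Rightarrow> 'k::field_char_0 mpoly set \<Rightarrow> 'k mpoly fract ring" where
  "localization r n P =
     \<lparr>carrier = {Fract a s | a s. a \<in> carrier (coord_ring r n) \<and> s \<in> carrier (coord_ring r n) - P},
      monoid.mult = (*), one = 1, zero = 0, add = (+)\<rparr>"

text \<open>Ordinary powers of ideals are powers in the semiring of ideals \<^const>\<open>ideals_set\<close>.\<close>

definition gen_symbolic_power ::
    "nat \<Rightarrow> nat \<Rightarrow> nat \<Rightarrow> 'k::field_char_0 mpoly set \<Rightarrow> nat \<Rightarrow> 'k mpoly set" where
  "gen_symbolic_power r n p I m =
     {f \<in> carrier (coord_ring r n).
        to_fract f \<in> Idl\<^bsub>localization r n (D_ideal r n p)\<^esub>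
          (to_fract ` (I [^]\<^bsub>ideals_set (coord_ring r n)\<^esub> m))}"

section \<open>Valuations and initial degree\<close>

definition gamma_poly :: "nat \<Rightarrow> nat \<Rightarrow> nat \<Rightarrow> 'k::field_char_0 mpoly \<Rightarrow> nat" where
  "gamma_poly r n j f = Max {i. f \<in> gen_symbolic_power r n j (D_ideal r n j) i}"

text \<open>For a nonempty set of natural numbers, \<^const>\<open>Inf\<close> is the minimum.\<close>

definition gamma_ideal :: "nat \<Rightarrow> nat \<Rightarrow> nat \<Rightarrow> 'k::field_char_0 mpoly set \<Rightarrow> nat" where
  "gamma_ideal r n j J = Inf (gamma_poly r n j ` (J - {0}))"

definition initial_degree :: "'k::field_char_0 mpoly set \<Rightarrow> nat" where
  "initial_degree J = Inf {d. \<exists>f\<in>J. f \<noteq> 0 \<and> homogeneous_of_degree d f}"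

end

theory Submission
  imports Defs "Jordan_Normal_Form.Char_Poly"
begin

text \<open>
  Fix \<open>0 \<le> q < r\<close> and let \<open>U\<close>, \<open>d\<close>, \<open>W\<close> have independent indeterminates as entries.  The matrix
  \<open>U diag(d\<^sub>0, \<dots>, t d\<^sub>q, \<dots>, t d\<^bsub>r-1\<^esub>) W\<close>, with \<open>t\<close> in the last \<open>r - q\<close> diagonal places, is a
  generic arc that reaches the matrices of rank at most \<open>q\<close> at \<open>t = 0\<close>.  The order in \<open>t\<close> of the
  pullback of \<open>f\<close> to this arc, \<^emph>\<open>the order of f at rank q\<close>, is additive on products because the
  coefficients of the pullback lie in a domain.  All the ideals involved are described by these orders.

  \<^item> Positive order at rank \<open>q\<close> means vanishing on all matrices of rank at most \<open>q\<close>.  Such polynomials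
  lie in \<open>D\<^bsub>q+1\<^esub>\<close> (\<open>low_rank_vanishing_imp_minors\<close>, \<open>D_ideal_eq_vanishing\<close>): the least monomial of such
  a polynomial is divisible by the least monomial of some \<open>(q+1)\<close>-minor.  Hence \<open>D\<^bsub>q+1\<^esub>\<close> is prime, and
  \<open>f\<close> lies in \<open>I\<^bsup>(m)\<^esup>\<close> with respect to \<open>p = q + 1\<close> iff \<open>s f\<close> lies in \<open>I\<^sup>m\<close> for some \<open>s\<close> of order zero.

  \<^item> Order at least \<open>N\<close> at rank \<open>q\<close> means membership in the \<open>N\<close>-th symbolic power of \<open>D\<^bsub>q+1\<^esub>\<close>
  (\<open>vanishes_imp_symbolic\<close>), because Gaussian elimination on the generic matrix over the ring with the
  leading \<open>q\<close>-minor inverted is a point of such an arc whose \<open>t\<close>-part is a Schur complement with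
  entries in \<open>D\<^bsub>q+1\<^esub>\<close>.  Hence \<open>\<gamma>\<^sub>j\<close> is the order at rank \<open>j - 1\<close> (\<open>gamma_poly_eq_locus_order\<close>).

  Lower bounds.  The polynomials of order at least \<open>N\<close> at rank \<open>q\<close> form an invariant ideal, so all of
  \<open>I\<^sub>\<sigma>\<close> has at least the order of \<open>K\<^sub>\<sigma>\<close> at rank \<open>j - 1\<close>, which is \<open>\<gamma>\<^sub>j(\<sigma>)\<close>.  A polynomial of order
  zero at rank \<open>p - 1\<close> has order zero at every larger rank, so the elements of the \<open>m\<close>-th generalized
  symbolic power have order at least \<open>m \<gamma>\<^sub>j(\<Sigma>)\<close> for \<open>j \<ge> p\<close>.  For \<open>j < p\<close> the orders at different
  ranks are compared (\<open>locus_order_lower_bound\<close>): the order at rank \<open>p - 1\<close> bounds the sum of any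
  \<open>r - p + 1\<close> of the exponents of the \<open>d\<^sub>i\<close> in a monomial of \<open>f(U diag(d) W)\<close>, and averaging over the
  \<open>r - j + 1\<close> exponents counted at rank \<open>j - 1\<close> yields the factor \<open>(r - j + 1) / (r - p + 1)\<close>.  The order
  at rank 0 of a homogeneous polynomial is its degree, so that \<open>j = 1\<close> also bounds the initial degree.

  Upper bounds.  For \<open>j \<ge> p\<close> the powers of \<open>K\<^sub>\<sigma>\<close> suffice.  For \<open>j \<le> p\<close> the power \<open>K\<^sub>\<sigma>\<^bsup>r-p+1\<^esup>\<close> is
  transformed into a product of leading minors whose sizes are \<open>r\<close>, \<open>p - 1\<close>, or smaller
  than \<open>p - 1\<close>.  One step replaces sizes \<open>a + 1 \<le> y < r\<close> by \<open>a\<close> and \<open>y + 1\<close> (\<open>exchange_step\<close>); the numbers of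
  factors and boxes are preserved, so exactly \<open>\<gamma>\<^sub>p(\<sigma>)\<close> factors of size \<open>r\<close> appear.  The steps may leave
  the power \<open>I\<^sup>k\<close>, but they preserve a weaker property of \<open>f\<close>: some nonzero homogeneous \<open>a\<close>
  satisfies \<open>a f\<^sup>l \<in> I\<^bsup>k l\<^esup>\<close> for all \<open>l\<close> (\<open>almost_integral\<close>).  The factors of size less than \<open>p\<close> have order zero at rank
  \<open>p - 1\<close> and are units in the localization, so \<open>a\<close> times the power of the \<open>r\<close>-minor with exponent
  \<open>\<gamma>\<^sub>p(\<sigma>) l\<close> lies in the generalized symbolic power with exponent \<open>(r - p + 1) l\<close> (\<open>witness_exists\<close>).
  The factor \<open>a\<close> contributes a bounded amount, which disappears in the limit.
\<close>

section \<open>Evaluation homomorphisms\<close>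

type_synonym monomial = "(nat \<times> nat) \<Rightarrow>\<^sub>0 nat"

definition monom_eval :: "(nat \<times> nat \<Rightarrow> 'a::comm_ring_1) \<Rightarrow> monomial \<Rightarrow> 'a" where
  "monom_eval g u = (\<Prod>v\<in>Poly_Mapping.keys u. g v ^ Poly_Mapping.lookup u v)"

text \<open>The coefficients pass through \<open>\<kappa>\<close>, so that values may lie in polynomial rings and fraction
  fields over \<open>'k mpoly\<close>.\<close>

definition poly_eval ::
    "('k::field_char_0 \<Rightarrow> 'a::comm_ring_1) \<Rightarrow> (nat \<times> nat \<Rightarrow> 'a) \<Rightarrow> 'k mpoly \<Rightarrow> 'a" where
  "poly_eval \<kappa> g f =
     (\<Sum>u\<in>Poly_Mapping.keys f. \<kappa> (Poly_Mapping.lookup f u) * monom_eval g u)"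

lemma poly_subst_eq_poly_eval: "poly_subst g = poly_eval Const g"
  by (simp add: fun_eq_iff poly_subst_def poly_eval_def monom_eval_def)

lemma monom_eval_superset:
  assumes "finite A" "Poly_Mapping.keys u \<subseteq> A"
  shows "monom_eval g u = (\<Prod>v\<in>A. g v ^ Poly_Mapping.lookup u v)"
  unfolding monom_eval_def
  by (rule prod.mono_neutral_left) (use assms in \<open>auto simp: in_keys_iff\<close>)

lemma monom_eval_add: "monom_eval g (u + w) = monom_eval g u * monom_eval g w"
proof -
  let ?A = "Poly_Mapping.keys u \<union> Poly_Mapping.keys w"
  have "monom_eval g (u + w) = (\<Prod>v\<in>?A. g v ^ Poly_Mapping.lookup (u + w) v)"
    using Poly_Mapping.keys_add[of u w] by (intro monom_eval_superset) auto
  also have "\<dots> = (\<Prod>v\<in>?A. g v ^ Poly_Mapping.lookup u v) * (\<Prod>v\<in>?A. g v ^ Poly_Mapping.lookup w v)"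
    by (simp add: lookup_add power_add prod.distrib)
  also have "\<dots> = monom_eval g u * monom_eval g w"
    by (simp add: monom_eval_superset[of ?A u] monom_eval_superset[of ?A w])
  finally show ?thesis .
qed

lemma monom_eval_0 [simp]: "monom_eval g 0 = 1"
  by (simp add: monom_eval_def)

lemma monom_eval_single: "monom_eval g (Poly_Mapping.single v k) = g v ^ k"
  by (simp add: monom_eval_def)

lemma sum_of_terms:
  fixes f :: "'a \<Rightarrow>\<^sub>0 'b::comm_monoid_add"
  shows "(\<Sum>u\<in>Poly_Mapping.keys f. Poly_Mapping.single u (Poly_Mapping.lookup f u)) = f"
proof (rule poly_mapping_eqI)
  fix k
  have "(\<Sum>u\<in>Poly_Mapping.keys f. Poly_Mapping.lookup (Poly_Mapping.single u (Poly_Mapping.lookup f u)) k)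
     = (\<Sum>u\<in>Poly_Mapping.keys f. if k = u then Poly_Mapping.lookup f k else 0)"
    by (rule sum.cong) (auto simp: lookup_single when_def)
  also have "\<dots> = Poly_Mapping.lookup f k" by (simp add: in_keys_iff)
  finally show "Poly_Mapping.lookup (\<Sum>u\<in>Poly_Mapping.keys f.
      Poly_Mapping.single u (Poly_Mapping.lookup f u)) k = Poly_Mapping.lookup f k"
    by (simp add: lookup_sum)
qed

context
  fixes \<kappa> :: "'k::field_char_0 \<Rightarrow> 'a::comm_ring_1" and g :: "nat \<times> nat \<Rightarrow> 'a"
  assumes \<kappa>: "comm_ring_hom \<kappa>"
begin

interpretation \<kappa>: comm_ring_hom \<kappa> by (rule \<kappa>)

lemma poly_eval_add: "poly_eval \<kappa> g (f + h) = poly_eval \<kappa> g f + poly_eval \<kappa> g h"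
  unfolding poly_eval_def
  by (rule setsum_keys_plus_distrib) (auto simp: \<kappa>.hom_add distrib_right)

lemma poly_eval_single: "poly_eval \<kappa> g (Poly_Mapping.single u c) = \<kappa> c * monom_eval g u"
  by (simp add: poly_eval_def)

lemma poly_eval_sum: "poly_eval \<kappa> g (sum F A) = (\<Sum>x\<in>A. poly_eval \<kappa> g (F x))"
  by (induction A rule: infinite_finite_induct)
     (simp_all add: poly_eval_add, simp_all add: poly_eval_def)

lemma poly_eval_mult: "poly_eval \<kappa> g (f * h) = poly_eval \<kappa> g f * poly_eval \<kappa> g h"
proof -
  have "f * h = (\<Sum>u\<in>Poly_Mapping.keys f. \<Sum>w\<in>Poly_Mapping.keys h.
      Poly_Mapping.single (u + w) (Poly_Mapping.lookup f u * Poly_Mapping.lookup h w))"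
    by (subst sum_of_terms[of f, symmetric], subst sum_of_terms[of h, symmetric])
       (simp add: sum_product mult_single)
  then show ?thesis
    by (simp add: poly_eval_sum poly_eval_single monom_eval_add \<kappa>.hom_mult)
       (simp add: poly_eval_def sum_product mult_ac)
qed

lemma poly_eval_hom: "comm_ring_hom (poly_eval \<kappa> g)"
proof
  show "poly_eval \<kappa> g 0 = 0" by (simp add: poly_eval_def)
  show "poly_eval \<kappa> g 1 = 1" by (simp add: poly_eval_def)
qed (rule poly_eval_add poly_eval_mult)+

lemma poly_eval_Const: "poly_eval \<kappa> g (Const c) = \<kappa> c"
  by (simp add: Const_def poly_eval_single)

lemma poly_eval_Var: "poly_eval \<kappa> g (Var a b) = g (a, b)"
  by (simp add: Var_def poly_eval_single monom_eval_single)

lemma hom_poly_eval: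
  assumes "comm_ring_hom \<phi>"
  shows "\<phi> (poly_eval \<kappa> g f) = poly_eval (\<lambda>c. \<phi> (\<kappa> c)) (\<lambda>v. \<phi> (g v)) f"
proof -
  interpret \<phi>: comm_ring_hom \<phi> by fact
  show ?thesis
    by (simp add: poly_eval_def monom_eval_def \<phi>.hom_sum \<phi>.hom_mult \<phi>.hom_prod \<phi>.hom_power)
qed

end

lemma comm_ring_hom_comp:
  "comm_ring_hom \<phi> \<Longrightarrow> comm_ring_hom \<psi> \<Longrightarrow> comm_ring_hom (\<lambda>x. \<phi> (\<psi> x))"
  unfolding comm_ring_hom_def ring_hom_def semiring_hom_def comm_monoid_add_hom_def
    monoid_add_hom_def monoid_mult_hom_def zero_hom_def one_hom_def semigroup_add_hom_def
    semigroup_mult_hom_def plus_hom_def times_hom_def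
  by (auto simp: comm_ring_hom_def comm_semiring_hom_def) 

lemma Const_hom: "comm_ring_hom Const"
  by unfold_locales (auto simp: Const_def single_add mult_single)

lemma comm_ring_hom_const_poly: "comm_ring_hom (\<lambda>x. [:x:])"
  by unfold_locales (auto simp: one_pCons)

lemma comm_ring_hom_to_fract: "comm_ring_hom to_fract"
  by unfold_locales auto

lemma comm_ring_hom_map_poly: "comm_ring_hom \<phi> \<Longrightarrow> comm_ring_hom (map_poly \<phi>)"
proof -
  assume "comm_ring_hom \<phi>"
  then interpret \<phi>: comm_ring_hom \<phi> .
  interpret map_poly_comm_ring_hom \<phi> ..
  show ?thesis by (rule comm_ring_hom_axioms)
qed

lemma comm_ring_hom_poly: "comm_ring_hom (\<lambda>F. poly F t)"
  by unfold_locales auto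

lemma monom_eval_Var: "monom_eval (\<lambda>v. Poly_Mapping.single (Poly_Mapping.single v 1) 1) u
    = (Poly_Mapping.single u 1 :: 'k::field_char_0 mpoly)"
proof (induction u rule: update_induct)
  case const
  then show ?case by simp
next
  case (update u v k)
  have "Poly_Mapping.update v k u = u + Poly_Mapping.single v k"
    by (rule poly_mapping_eqI)
       (use update in \<open>auto simp: lookup_update lookup_add lookup_single when_def in_keys_iff\<close>)
  moreover have "(Poly_Mapping.single (Poly_Mapping.single v 1) 1 :: 'k mpoly) ^ k
      = Poly_Mapping.single (Poly_Mapping.single v k) 1"
    by (induction k) (simp_all add: mult_single single_add[symmetric])
  ultimately show ?case
    using update by (simp add: monom_eval_add monom_eval_single mult_single)
qed

lemma poly_eval_identity: "poly_eval Const (\<lambda>(a, b). Var a b) f = f"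
proof -
  have "(\<lambda>(a, b). Var a b) = (\<lambda>v. Poly_Mapping.single (Poly_Mapping.single v 1) (1::'a))"
    by (auto simp: Var_def)
  then have "poly_eval Const (\<lambda>(a, b). Var a b) f
    = (\<Sum>u\<in>Poly_Mapping.keys f. Poly_Mapping.single u (Poly_Mapping.lookup f u))"
    unfolding poly_eval_def
    by (intro sum.cong) (simp_all add: monom_eval_Var Const_def mult_single del: One_nat_def)
  then show ?thesis by (simp add: sum_of_terms)
qed

section \<open>The coordinate ring as a subring\<close>

abbreviation RR :: "nat \<Rightarrow> nat \<Rightarrow> 'k::field_char_0 mpoly set" where
  "RR r n \<equiv> carrier (coord_ring r n)"

lemma RR_iff: "f \<in> RR r n \<longleftrightarrow>
    (\<forall>u\<in>Poly_Mapping.keys f. Poly_Mapping.keys u \<subseteq> {..<r} \<times> {..<n})"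
  by (simp add: coord_ring_def)

lemma coord_ring_simps [simp]:
  "monoid.mult (coord_ring r n) = (*)" "one (coord_ring r n) = 1"
  "zero (coord_ring r n) = 0" "add (coord_ring r n) = (+)"
  by (simp_all add: coord_ring_def)

lemma RR_single: "Poly_Mapping.keys u \<subseteq> {..<r} \<times> {..<n} \<Longrightarrow> Poly_Mapping.single u c \<in> RR r n"
  by (auto simp: RR_iff split: if_splits)

lemma RR_Const [simp]: "Const c \<in> RR r n"
  by (simp add: Const_def RR_single)

lemma RR_0 [simp]: "0 \<in> RR r n" and RR_1 [simp]: "1 \<in> RR r n"
  by (simp_all add: RR_iff)

lemma RR_Var [simp]: "a < r \<Longrightarrow> b < n \<Longrightarrow> Var a b \<in> RR r n"
  by (auto simp: Var_def intro!: RR_single)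

lemma RR_add: "f \<in> RR r n \<Longrightarrow> h \<in> RR r n \<Longrightarrow> f + h \<in> RR r n"
  using Poly_Mapping.keys_add[of f h] by (fastforce simp: RR_iff)

lemma RR_mult: "f \<in> RR r n \<Longrightarrow> h \<in> RR r n \<Longrightarrow> f * h \<in> RR r n"
  unfolding RR_iff
proof
  fix u assume *: "\<forall>u\<in>Poly_Mapping.keys f. Poly_Mapping.keys u \<subseteq> {..<r} \<times> {..<n}"
    "\<forall>u\<in>Poly_Mapping.keys h. Poly_Mapping.keys u \<subseteq> {..<r} \<times> {..<n}" "u \<in> Poly_Mapping.keys (f * h)"
  then obtain a b where "u = a + b" "a \<in> Poly_Mapping.keys f" "b \<in> Poly_Mapping.keys h"
    using keys_mult[of f h] by auto
  then show "Poly_Mapping.keys u \<subseteq> {..<r} \<times> {..<n}"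
    using * Poly_Mapping.keys_add[of a b] by blast
qed

lemma RR_uminus: "f \<in> RR r n \<Longrightarrow> - f \<in> RR r n"
  by (auto simp: RR_iff)

lemma RR_sum: "(\<And>x. x \<in> A \<Longrightarrow> F x \<in> RR r n) \<Longrightarrow> sum F A \<in> RR r n"
  by (induction A rule: infinite_finite_induct) (auto intro: RR_add)

lemma RR_prod: "(\<And>x. x \<in> A \<Longrightarrow> F x \<in> RR r n) \<Longrightarrow> prod F A \<in> RR r n"
  by (induction A rule: infinite_finite_induct) (auto intro: RR_mult)

lemma RR_power: "f \<in> RR r n \<Longrightarrow> f ^ k \<in> RR r n"
  by (induction k) (auto intro: RR_mult)

lemma RR_prod_list: "(\<And>x. x \<in> set xs \<Longrightarrow> x \<in> RR r n) \<Longrightarrow> prod_list xs \<in> RR r n"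
  by (induction xs) (auto intro: RR_mult)

lemma RR_signof: "signof p * f \<in> RR r n \<longleftrightarrow> f \<in> RR r n"
  using RR_uminus[of f r n] RR_uminus[of "- f" r n] by (cases p rule: sign_cases) auto

lemma RR_det: "(\<And>i j. i < s \<Longrightarrow> j < s \<Longrightarrow> E i j \<in> RR r n) \<Longrightarrow> det (mat s s (\<lambda>(i, j). E i j)) \<in> RR r n"
  by (subst det_def'[of _ s]) (auto intro!: RR_sum RR_prod simp: RR_signof)

lemma cring_coord_ring: "cring (coord_ring r n)"
proof (rule cringI)
  show "abelian_group (coord_ring r n)"
    by (rule abelian_groupI) (auto intro: RR_add RR_uminus exI[of _ "- x" for x] bexI[of _ "- x" for x] simp: algebra_simps)
  show "comm_monoid (coord_ring r n)"
    by (rule comm_monoidI) (auto intro: RR_mult simp: algebra_simps)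
qed (simp add: algebra_simps)

lemma poly_eval_cong:
  assumes "f \<in> RR r n" "\<And>a b. a < r \<Longrightarrow> b < n \<Longrightarrow> g (a, b) = h (a, b)"
  shows "poly_eval \<kappa> g f = poly_eval \<kappa> h f"
  unfolding poly_eval_def monom_eval_def
proof (intro sum.cong refl arg_cong2[of _ _ _ _ "(*)"] prod.cong)
  fix u v assume "u \<in> Poly_Mapping.keys f" "v \<in> Poly_Mapping.keys u"
  then have "v \<in> {..<r} \<times> {..<n}" using assms(1) by (auto simp: RR_iff)
  then show "g v ^ Poly_Mapping.lookup u v = h v ^ Poly_Mapping.lookup u v"
    using assms(2) by (cases v) auto
qed

lemma poly_eval_RR:
  assumes "f \<in> RR r n" "\<And>a b. a < r \<Longrightarrow> b < n \<Longrightarrow> g (a, b) \<in> RR r' n'"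
  shows "poly_eval Const g f \<in> RR r' n'"
  unfolding poly_eval_def monom_eval_def
proof (intro RR_sum RR_mult RR_prod RR_power RR_Const)
  fix u v assume "u \<in> Poly_Mapping.keys f" "v \<in> Poly_Mapping.keys u"
  then have "v \<in> {..<r} \<times> {..<n}" using assms(1) by (auto simp: RR_iff)
  then show "g v \<in> RR r' n'" using assms(2) by (cases v) auto
qed

section \<open>Orders along the loci of bounded rank\<close>

text \<open>The entries of \<open>U diag(d) W\<close>.\<close>

definition factored ::
    "nat \<Rightarrow> (nat \<Rightarrow> nat \<Rightarrow> 'a::comm_ring_1) \<Rightarrow> (nat \<Rightarrow> 'a) \<Rightarrow> (nat \<Rightarrow> nat \<Rightarrow> 'a) \<Rightarrow> nat \<times> nat \<Rightarrow> 'a"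
  where "factored r U d W = (\<lambda>(a, b). \<Sum>i<r. U a i * d i * W i b)"

definition tail_scale :: "nat \<Rightarrow> 'a::comm_ring_1 \<Rightarrow> (nat \<Rightarrow> 'a) \<Rightarrow> nat \<Rightarrow> 'a" where
  "tail_scale q t d i = (if i < q then d i else t * d i)"

text \<open>The residue of the first index modulo 3 separates the entries of \<open>U\<close>, \<open>d\<close> and \<open>W\<close>, so that one
  polynomial ring contains all of them.\<close>

definition genU :: "nat \<Rightarrow> nat \<Rightarrow> 'k::field_char_0 mpoly" where "genU a i = Var (3 * a) i"
definition gend :: "nat \<Rightarrow> 'k::field_char_0 mpoly" where "gend i = Var (3 * i + 1) 0"
definition genW :: "nat \<Rightarrow> nat \<Rightarrow> 'k::field_char_0 mpoly" where "genW i b = Var (3 * i + 2) b"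

text \<open>The pullback to the generic arc; the inner polynomials are in the entries of \<open>U\<close>, \<open>d\<close>, \<open>W\<close> and the
  outer variable is the parameter \<open>t\<close> of the arc.\<close>

definition degenerate :: "nat \<Rightarrow> nat \<Rightarrow> 'k::field_char_0 mpoly \<Rightarrow> 'k mpoly poly" where
  "degenerate r q = poly_eval (\<lambda>c. [:Const c:])
     (factored r (\<lambda>a i. [:genU a i:]) (tail_scale q [:0, 1:] (\<lambda>i. [:gend i:])) (\<lambda>i b. [:genW i b:]))"

definition vanishes :: "nat \<Rightarrow> nat \<Rightarrow> nat \<Rightarrow> 'k::field_char_0 mpoly \<Rightarrow> bool" where
  "vanishes r q N f \<longleftrightarrow> [:0, 1:] ^ N dvd degenerate r q f"

text \<open>Chooses values for the indeterminates \<open>genU\<close>, \<open>gend\<close>, \<open>genW\<close>.\<close>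

definition gen_assign ::
    "(nat \<Rightarrow> nat \<Rightarrow> 'a) \<Rightarrow> (nat \<Rightarrow> 'a) \<Rightarrow> (nat \<Rightarrow> nat \<Rightarrow> 'a) \<Rightarrow> nat \<times> nat \<Rightarrow> 'a" where
  "gen_assign U d W = (\<lambda>(x, y). if x mod 3 = 0 then U (x div 3) y
     else if x mod 3 = 1 then d (x div 3) else W (x div 3) y)"

lemma gen_assign_simps:
  "gen_assign U d W (3 * a, i) = U a i" "gen_assign U d W (3 * a + 1, i) = d a"
  "gen_assign U d W (3 * a + 2, i) = W a i"
  "gen_assign U d W (Suc (3 * a), i) = d a"
  "gen_assign U d W (Suc (Suc (3 * a)), i) = W a i"
proof -
  have "Suc (3 * a) mod 3 = 1" "Suc (Suc (3 * a)) mod 3 = 2"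
    "Suc (3 * a) div 3 = a" "Suc (Suc (3 * a)) div 3 = a" by presburger+
  then show "gen_assign U d W (3 * a, i) = U a i" "gen_assign U d W (3 * a + 1, i) = d a"
    "gen_assign U d W (3 * a + 2, i) = W a i" "gen_assign U d W (Suc (3 * a), i) = d a"
    "gen_assign U d W (Suc (Suc (3 * a)), i) = W a i"
    by (simp_all add: gen_assign_def)
qed

lemma comm_ring_hom_const_const: "comm_ring_hom (\<lambda>c. [:Const c:])"
  by (rule comm_ring_hom_comp[OF comm_ring_hom_const_poly Const_hom])

lemma degenerate_hom: "comm_ring_hom (degenerate r q)"
  unfolding degenerate_def by (rule poly_eval_hom[OF comm_ring_hom_const_const])

text \<open>The entries of \<open>U\<close>, \<open>d\<close>, \<open>W\<close> and the parameter \<open>t\<close> are independent indeterminates, so any values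
  for them, in any commutative ring, are attained by a homomorphism on the target of the pullback.\<close>

lemma degenerate_specialize:
  fixes \<kappa> :: "'k::field_char_0 \<Rightarrow> 'a::comm_ring_1"
  assumes \<kappa>: "comm_ring_hom \<kappa>"
  obtains \<Psi> where "comm_ring_hom \<Psi>" "\<Psi> [:0, 1:] = t"
    "\<And>f. \<Psi> (degenerate r q f) = poly_eval \<kappa> (factored r U (tail_scale q t d) W) f"
proof
  define \<phi> where "\<phi> = poly_eval \<kappa> (gen_assign U d W)"
  have \<phi>: "comm_ring_hom \<phi>" unfolding \<phi>_def by (rule poly_eval_hom[OF \<kappa>])
  interpret \<phi>: comm_ring_hom \<phi> by (rule \<phi>)
  define \<Psi> where "\<Psi> F = poly (map_poly \<phi> F) t" for F
  show \<Psi>: "comm_ring_hom \<Psi>"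
    unfolding \<Psi>_def by (rule comm_ring_hom_comp[OF comm_ring_hom_poly comm_ring_hom_map_poly[OF \<phi>]])
  interpret \<Psi>: comm_ring_hom \<Psi> by (rule \<Psi>)
  show t: "\<Psi> [:0, 1:] = t" by (simp add: \<Psi>_def)
  have c: "\<Psi> [:x:] = \<phi> x" for x
    by (simp add: \<Psi>_def monom_0[symmetric] map_poly_monom poly_monom)
  have v: "\<phi> (Var x y) = gen_assign U d W (x, y)" for x y
    by (simp add: \<phi>_def poly_eval_Var[OF \<kappa>])
  fix f
  have "\<Psi> (degenerate r q f) = poly_eval (\<lambda>c. \<Psi> [:Const c:]) (\<lambda>v. \<Psi> (factored r (\<lambda>a i. [:genU a i:])
      (tail_scale q [:0, 1:] (\<lambda>i. [:gend i:])) (\<lambda>i b. [:genW i b:]) v)) f"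
    unfolding degenerate_def by (rule hom_poly_eval[OF comm_ring_hom_const_const \<Psi>])
  also have "(\<lambda>c. \<Psi> [:Const c:]) = \<kappa>"
    by (simp add: c \<phi>_def poly_eval_Const[OF \<kappa>])
  also have "(\<lambda>v. \<Psi> (factored r (\<lambda>a i. [:genU a i:])
      (tail_scale q [:0, 1:] (\<lambda>i. [:gend i:])) (\<lambda>i b. [:genW i b:]) v))
      = factored r U (tail_scale q t d) W"
  proof (rule ext, clarify)
    fix a b
    have "\<Psi> (tail_scale q [:0, 1:] (\<lambda>i. [:gend i:]) i) = tail_scale q t d i" for i
      by (simp only: tail_scale_def if_distrib[of \<Psi>] \<Psi>.hom_mult t c gend_def v gen_assign_simps)
    then show "\<Psi> (factored r (\<lambda>a i. [:genU a i:])
      (tail_scale q [:0, 1:] (\<lambda>i. [:gend i:])) (\<lambda>i b. [:genW i b:]) (a, b))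
      = factored r U (tail_scale q t d) W (a, b)"
      by (simp only: factored_def prod.case \<Psi>.hom_sum \<Psi>.hom_mult c genU_def genW_def v gen_assign_simps)
  qed
  finally show "\<Psi> (degenerate r q f) = poly_eval \<kappa> (factored r U (tail_scale q t d) W) f" .
qed

text \<open>Divisibility by a power of \<open>t\<close> survives specialization, so one generic condition controls all
  arcs at once.\<close>

lemma vanishes_specialize:
  fixes \<kappa> :: "'k::field_char_0 \<Rightarrow> 'a::comm_ring_1"
  assumes "comm_ring_hom \<kappa>" "vanishes r q N f"
  shows "t ^ N dvd poly_eval \<kappa> (factored r U (tail_scale q t d) W) f"
proof -
  obtain \<Psi> where \<Psi>: "comm_ring_hom \<Psi>" "\<Psi> [:0, 1:] = t"
    "\<And>f. \<Psi> (degenerate r q f) = poly_eval \<kappa> (factored r U (tail_scale q t d) W) f"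
    by (rule degenerate_specialize[OF assms(1)]) blast
  interpret \<Psi>: comm_ring_hom \<Psi> by (rule \<Psi>)
  obtain F where "degenerate r q f = [:0, 1:] ^ N * F"
    using assms(2) unfolding vanishes_def by (auto elim: dvdE)
  then have "\<Psi> (degenerate r q f) = t ^ N * \<Psi> F"
    by (simp only: \<Psi>.hom_mult \<Psi>.hom_power \<Psi>(2))
  then show ?thesis by (simp add: \<Psi>(3))
qed

lemma vanishes_0 [simp]: "vanishes r q 0 f"
  by (simp add: vanishes_def)

lemma vanishes_add: "vanishes r q N f \<Longrightarrow> vanishes r q N h \<Longrightarrow> vanishes r q N (f + h)"
proof -
  interpret comm_ring_hom "degenerate r q" by (rule degenerate_hom)
  show "vanishes r q N f \<Longrightarrow> vanishes r q N h \<Longrightarrow> vanishes r q N (f + h)"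
    by (simp add: vanishes_def hom_add)
qed

lemma vanishes_mult: "vanishes r q N f \<Longrightarrow> vanishes r q M h \<Longrightarrow> vanishes r q (N + M) (f * h)"
proof -
  interpret comm_ring_hom "degenerate r q" by (rule degenerate_hom)
  show "vanishes r q N f \<Longrightarrow> vanishes r q M h \<Longrightarrow> vanishes r q (N + M) (f * h)"
    by (simp add: vanishes_def hom_mult power_add mult_dvd_mono)
qed

lemma vanishes_mult_right: "vanishes r q N f \<Longrightarrow> vanishes r q N (h * f)"
  using vanishes_mult[of r q 0 h N f] by simp

lemma vanishes_zero [simp]: "vanishes r q N 0"
proof -
  interpret comm_ring_hom "degenerate r q" by (rule degenerate_hom)
  show ?thesis by (simp add: vanishes_def)
qed

lemma vanishes_mono: "vanishes r q N f \<Longrightarrow> M \<le> N \<Longrightarrow> vanishes r q M f"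
  unfolding vanishes_def by (meson dvd_trans le_imp_power_dvd)

lemma factored_id:
  assumes "a < r"
  shows "factored r (\<lambda>a i. if a = i then 1 else 0) (\<lambda>_. 1) W (a, b) = W a b"
proof -
  have "factored r (\<lambda>a i. if a = i then 1 else 0) (\<lambda>_. 1) W (a, b) = (\<Sum>i<r. if a = i then W a b else 0)"
    unfolding factored_def prod.case by (rule sum.cong) auto
  then show ?thesis using assms by simp
qed

lemma tail_scale_1: "tail_scale q 1 d = d"
  by (auto simp: tail_scale_def)

text \<open>With \<open>U\<close> the identity, all \<open>d\<^sub>i\<close> and \<open>t\<close> equal to 1, and \<open>W\<close> generic, the arc returns the generic
  matrix, so the pullback is injective.\<close>

lemma degenerate_eq_0_iff:
  fixes f :: "'k::field_char_0 mpoly"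
  assumes "f \<in> RR r n"
  shows "degenerate r q f = 0 \<longleftrightarrow> f = 0"
proof
  assume 0: "degenerate r q f = 0"
  obtain \<Psi> :: "'k mpoly poly \<Rightarrow> 'k mpoly" where \<Psi>: "comm_ring_hom \<Psi>" "\<Psi> [:0, 1:] = 1"
    "\<And>f. \<Psi> (degenerate r q f) = poly_eval Const (factored r (\<lambda>a i. if a = i then 1 else 0)
       (tail_scale q 1 (\<lambda>_. 1)) Var) f"
    by (rule degenerate_specialize[OF Const_hom]) blast
  interpret \<Psi>: comm_ring_hom \<Psi> by (rule \<Psi>)
  have "poly_eval Const (factored r (\<lambda>a i. if a = i then 1 else 0) (\<lambda>_. 1) Var) f
      = poly_eval Const (\<lambda>(a, b). Var a b) f"
    by (rule poly_eval_cong[OF assms]) (simp add: factored_id)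
  then have "f = \<Psi> (degenerate r q f)"
    by (simp add: \<Psi>(3) tail_scale_1 poly_eval_identity)
  then show "f = 0" by (simp add: 0)
next
  interpret comm_ring_hom "degenerate r q" by (rule degenerate_hom)
  show "f = 0 \<Longrightarrow> degenerate r q f = 0" by simp
qed

definition locus_order :: "nat \<Rightarrow> nat \<Rightarrow> 'k::field_char_0 mpoly \<Rightarrow> nat" where
  "locus_order r q f = order 0 (degenerate r q f)"

lemma vanishes_iff_le_order:
  assumes "f \<in> RR r n" "f \<noteq> 0"
  shows "vanishes r q N f \<longleftrightarrow> N \<le> locus_order r q f"
  using order_divides[of 0 N "degenerate r q f"] degenerate_eq_0_iff[OF assms(1), of q] assms(2)
  by (simp add: vanishes_def locus_order_def)

lemma locus_order_mult:
  assumes "f \<in> RR r n" "h \<in> RR r n" "f \<noteq> 0" "h \<noteq> 0"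
  shows "locus_order r q (f * h) = locus_order r q f + locus_order r q h"
proof -
  interpret comm_ring_hom "degenerate r q" by (rule degenerate_hom)
  show ?thesis using assms degenerate_eq_0_iff[of f r n q] degenerate_eq_0_iff[of h r n q]
    by (simp add: locus_order_def hom_mult order_mult)
qed

lemma locus_order_power:
  assumes "f \<in> RR r n" "f \<noteq> 0"
  shows "locus_order r q (f ^ k) = k * locus_order r q f"
proof (induction k)
  case 0
  interpret comm_ring_hom "degenerate r q" by (rule degenerate_hom)
  show ?case by (simp add: locus_order_def)
next
  case (Suc k)
  then show ?case using assms by (simp add: locus_order_mult[of _ r n] RR_power)
qed

section \<open>Linear substitutions\<close>

definition lin_subst :: "nat \<Rightarrow> nat \<Rightarrow> 'k::field_char_0 mat \<Rightarrow> 'k mat \<Rightarrow> 'k mpoly \<Rightarrow> 'k mpoly" where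
  "lin_subst r n A B = poly_eval Const
     (\<lambda>(a, b). \<Sum>i<r. \<Sum>j<n. Const (A $$ (a, i)) * Var i j * Const (B $$ (j, b)))"

lemma lin_subst_hom: "comm_ring_hom (lin_subst r n A B)"
  unfolding lin_subst_def by (rule poly_eval_hom[OF Const_hom])

lemma act_eq_lin_subst:
  fixes f :: "'k::field_char_0 mpoly"
  assumes "f \<in> RR r n" "A \<in> GL r" "B \<in> GL n"
  shows "act r n A B f = lin_subst r n (inv\<^bsub>ring_mat TYPE('k) r ()\<^esub> A) B f"
    (is "_ = lin_subst r n ?A B f")
  unfolding act_def poly_subst_eq_poly_eval lin_subst_def
proof (rule poly_eval_cong[OF assms(1)])
  fix a b assume ab: "a < r" "b < n"
  interpret Rm: semiring "ring_mat TYPE('k) r ()" by (rule semiring_mat)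
  have A: "?A \<in> carrier_mat r r"
    using Rm.Units_inv_closed[OF assms(2)] by (simp add: ring_mat_def)
  have B: "B \<in> carrier_mat n n" using assms(3) by (simp add: Units_def ring_mat_def)
  show "(map_mat Const ?A * generic_mat r n * map_mat Const B) $$ (a, b) =
      (case (a, b) of (a, b) \<Rightarrow> \<Sum>i<r. \<Sum>j<n. Const (?A $$ (a, i)) * Var i j * Const (B $$ (j, b)))"
    using A B ab
    by (simp add: generic_mat_def scalar_prod_def sum_distrib_right atLeast0LessThan)
       (subst sum.swap, simp)
qed

lemma lin_subst_RR:
  assumes "f \<in> RR r n" shows "lin_subst r n A B f \<in> RR r n"
  unfolding lin_subst_def using assms
  by (intro poly_eval_RR[of f r n]) (auto intro!: RR_sum RR_mult)

text \<open>The substitution \<open>X \<mapsto> A X B\<close> carries the arc with factors \<open>U\<close>, \<open>W\<close> to the arc with factors \<open>A U\<close>,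
  \<open>W B\<close>, with the same diagonal part.\<close>

lemma vanishes_lin_subst:
  fixes f :: "'k::field_char_0 mpoly"
  assumes f: "f \<in> RR r n" and v: "vanishes r q N f"
  shows "vanishes r q N (lin_subst r n A B f)"
proof -
  interpret dg: comm_ring_hom "degenerate r q" by (rule degenerate_hom)
  let ?c = "\<lambda>x::'k. [:Const x:]"
  let ?T = "tail_scale q [:0, 1:] (\<lambda>i. [:gend i:]) :: nat \<Rightarrow> 'k mpoly poly"
  \<comment> \<open>The factors \<open>A U\<close> and \<open>W B\<close> of the transformed arc.\<close>
  define X :: "nat \<times> nat \<Rightarrow> 'k mpoly poly" where "X = factored r (\<lambda>a i. [:genU a i:]) ?T (\<lambda>i b. [:genW i b:])"
  define U :: "nat \<Rightarrow> nat \<Rightarrow> 'k mpoly poly" where "U a i = (\<Sum>i'<r. ?c (A $$ (a, i')) * [:genU i' i:])" for a i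
  define W :: "nat \<Rightarrow> nat \<Rightarrow> 'k mpoly poly" where "W i b = (\<Sum>j<n. [:genW i j:] * ?c (B $$ (j, b)))" for i b
  have dC: "degenerate r q (Const c) = [:Const c:]" for c
    by (simp add: degenerate_def poly_eval_Const[OF comm_ring_hom_const_const])
  have dV: "degenerate r q (Var a b) = X (a, b)" for a b
    by (simp add: degenerate_def X_def poly_eval_Var[OF comm_ring_hom_const_const])
  have "degenerate r q (lin_subst r n A B f) = poly_eval (\<lambda>c. degenerate r q (Const c))
     (\<lambda>v. degenerate r q (case v of (a, b) \<Rightarrow> \<Sum>i<r. \<Sum>j<n. Const (A $$ (a, i)) * Var i j * Const (B $$ (j, b)))) f"
    unfolding lin_subst_def by (rule hom_poly_eval[OF Const_hom degenerate_hom])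
  also have "\<dots> = poly_eval ?c (factored r U ?T W) f"
    unfolding dC
  proof (rule poly_eval_cong[OF f])
    fix a b assume "a < r" "b < n"
    have "degenerate r q (case (a, b) of (a, b) \<Rightarrow> \<Sum>i<r. \<Sum>j<n. Const (A $$ (a, i)) * Var i j * Const (B $$ (j, b)))
      = (\<Sum>i<r. \<Sum>j<n. ?c (A $$ (a, i)) * X (i, j) * ?c (B $$ (j, b)))"
      by (simp only: prod.case dg.hom_sum dg.hom_mult dC dV)
    also have "\<dots> = (\<Sum>i<r. \<Sum>j<n. \<Sum>l<r. ?c (A $$ (a, i)) * [:genU i l:] * ?T l * ([:genW l j:] * ?c (B $$ (j, b))))"
      by (simp only: X_def factored_def prod.case sum_distrib_left sum_distrib_right mult.assoc)
    also have "\<dots> = (\<Sum>l<r. \<Sum>i<r. \<Sum>j<n. ?c (A $$ (a, i)) * [:genU i l:] * ?T l * ([:genW l j:] * ?c (B $$ (j, b))))"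
      by (subst (2) sum.swap, subst sum.swap) (rule refl)
    also have "\<dots> = factored r U ?T W (a, b)"
      by (simp only: factored_def prod.case U_def W_def sum_distrib_left sum_distrib_right)
         (subst (2) sum.swap, rule refl)
    finally show "degenerate r q (case (a, b) of (a, b) \<Rightarrow> \<Sum>i<r. \<Sum>j<n. Const (A $$ (a, i)) * Var i j * Const (B $$ (j, b)))
       = factored r U ?T W (a, b)" .
  qed
  finally show ?thesis
    using vanishes_specialize[OF comm_ring_hom_const_const v, of "[:0, 1:]" U "\<lambda>i. [:gend i:]" W]
    by (simp add: vanishes_def)
qed

section \<open>Minors and their orders\<close>

text \<open>The lists of rows and columns are functions, so that they may repeat or permute indices.\<close>

definition minor :: "(nat \<times> nat \<Rightarrow> 'a::comm_ring_1) \<Rightarrow> nat \<Rightarrow> (nat \<Rightarrow> nat) \<Rightarrow> (nat \<Rightarrow> nat) \<Rightarrow> 'a" where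
  "minor E s \<rho> \<kappa> = det (mat s s (\<lambda>(x, y). E (\<rho> x, \<kappa> y)))"

abbreviation gen_minor :: "nat \<Rightarrow> (nat \<Rightarrow> nat) \<Rightarrow> (nat \<Rightarrow> nat) \<Rightarrow> 'k::field_char_0 mpoly" where
  "gen_minor \<equiv> minor (\<lambda>(a, b). Var a b)"

lemma hom_minor:
  assumes "comm_ring_hom \<phi>"
  shows "\<phi> (minor E s \<rho> \<kappa>) = minor (\<lambda>v. \<phi> (E v)) s \<rho> \<kappa>"
proof -
  interpret \<phi>: comm_ring_hom \<phi> by fact
  have "map_mat \<phi> (mat s s (\<lambda>(x, y). E (\<rho> x, \<kappa> y))) = mat s s (\<lambda>(x, y). \<phi> (E (\<rho> x, \<kappa> y)))"
    by (rule eq_matI) auto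
  then show ?thesis
    using \<phi>.hom_det[of "mat s s (\<lambda>(x, y). E (\<rho> x, \<kappa> y))"] by (simp add: minor_def)
qed

lemma minor_cong:
  assumes "\<And>x y. x < s \<Longrightarrow> y < s \<Longrightarrow> E (\<rho> x, \<kappa> y) = E' (\<rho>' x, \<kappa>' y)"
  shows "minor E s \<rho> \<kappa> = minor E' s \<rho>' \<kappa>'"
  unfolding minor_def by (rule arg_cong[where f = det], rule eq_matI) (use assms in auto)

lemma poly_eval_minor:
  assumes "comm_ring_hom c"
  shows "poly_eval c g (gen_minor s \<rho> \<kappa>) = minor g s \<rho> \<kappa>"
  by (subst hom_minor[OF poly_eval_hom[OF assms]]) (simp add: poly_eval_Var[OF assms] split_def)

lemma gen_minor_RR:
  assumes "\<And>x. x < s \<Longrightarrow> \<rho> x < r" "\<And>x. x < s \<Longrightarrow> \<kappa> x < n"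
  shows "gen_minor s \<rho> \<kappa> \<in> RR r n"
  unfolding minor_def prod.case by (rule RR_det) (use assms in auto)

text \<open>Separating the first \<open>q\<close> diagonal places from the others writes the matrix of the minor as
  \<open>M = P Q + t Z\<close>, where \<open>P\<close> has \<open>q\<close> columns.  In block form,
  \<open>[1, 0; P, t] [t, Q; - P, Z] = [t, Q; 0, M]\<close>, and comparing determinants gives
  \<open>t\<^sup>s det K = t\<^sup>q det M\<close> with \<open>K\<close> the second factor.\<close>

lemma power_dvd_minor_factored:
  fixes t :: "'a::idom"
  assumes q: "q \<le> r" and t: "t \<noteq> 0"
  shows "t ^ (s - q) dvd minor (factored r U (tail_scale q t d) W) s \<rho> \<kappa>"
proof (cases "q \<le> s")
  case True
  \<comment> \<open>The part of rank at most \<open>q\<close>, and the remainder that carries the factor \<open>t\<close>.\<close>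
  define P where "P = mat s q (\<lambda>(x, i). U (\<rho> x) i * d i)"
  define Q where "Q = mat q s (\<lambda>(i, y). W i (\<kappa> y))"
  define Z where "Z = mat s s (\<lambda>(x, y). \<Sum>i\<in>{q..<r}. U (\<rho> x) i * d i * W i (\<kappa> y))"
  define M where "M = mat s s (\<lambda>(x, y). factored r U (tail_scale q t d) W (\<rho> x, \<kappa> y))"
  have carr [simp]: "P \<in> carrier_mat s q" "Q \<in> carrier_mat q s" "Z \<in> carrier_mat s s" "M \<in> carrier_mat s s"
    by (simp_all add: P_def Q_def Z_def M_def)
  have M: "M = P * Q + t \<cdot>\<^sub>m Z"
  proof (rule eq_matI)
    fix x y assume "x < dim_row (P * Q + t \<cdot>\<^sub>m Z)" "y < dim_col (P * Q + t \<cdot>\<^sub>m Z)"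
    then have xy: "x < s" "y < s" by (simp_all add: Z_def)
    have split: "sum F {..<r} = sum F {..<q} + sum F {q..<r}" for F :: "nat \<Rightarrow> 'a"
      using sum.atLeastLessThan_concat[of 0 q r F] q by (simp add: atLeast0LessThan)
    have "M $$ (x, y) = (\<Sum>i<q. U (\<rho> x) i * tail_scale q t d i * W i (\<kappa> y))
        + (\<Sum>i\<in>{q..<r}. U (\<rho> x) i * tail_scale q t d i * W i (\<kappa> y))"
      using xy by (simp add: M_def factored_def split)
    also have "\<dots> = (\<Sum>i<q. U (\<rho> x) i * d i * W i (\<kappa> y))
        + (\<Sum>i\<in>{q..<r}. t * (U (\<rho> x) i * d i * W i (\<kappa> y)))"
      by (auto simp: tail_scale_def mult_ac)
    finally show "M $$ (x, y) = (P * Q + t \<cdot>\<^sub>m Z) $$ (x, y)"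
      using xy by (simp add: P_def Q_def Z_def scalar_prod_def atLeast0LessThan sum_distrib_left)
  qed (simp_all add: M_def Z_def)
  let ?L = "four_block_mat (1\<^sub>m q) (0\<^sub>m q s) P (t \<cdot>\<^sub>m 1\<^sub>m s)"
  let ?K = "four_block_mat (t \<cdot>\<^sub>m 1\<^sub>m q) Q (- P) Z"
  have "?L * ?K = four_block_mat (1\<^sub>m q * (t \<cdot>\<^sub>m 1\<^sub>m q) + 0\<^sub>m q s * (- P)) (1\<^sub>m q * Q + 0\<^sub>m q s * Z)
      (P * (t \<cdot>\<^sub>m 1\<^sub>m q) + (t \<cdot>\<^sub>m 1\<^sub>m s) * (- P)) (P * Q + (t \<cdot>\<^sub>m 1\<^sub>m s) * Z)"
    by (rule mult_four_block_mat[where ?nr1.0 = q and ?n1.0 = q and ?n2.0 = s and ?nr2.0 = s and ?nc1.0 = q and ?nc2.0 = s]) auto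
  also have "P * (t \<cdot>\<^sub>m 1\<^sub>m q) + (t \<cdot>\<^sub>m 1\<^sub>m s) * (- P) = 0\<^sub>m s q"
    using carr(1) by (simp add: mult_smult_distrib[OF carr(1) one_carrier_mat]
        mult_smult_assoc_mat[OF one_carrier_mat uminus_carrier_mat[OF carr(1)]]
        right_mult_one_mat[OF carr(1)] left_mult_one_mat[OF uminus_carrier_mat[OF carr(1)]])
      (rule eq_matI, auto simp: P_def)
  also have "P * Q + (t \<cdot>\<^sub>m 1\<^sub>m s) * Z = M"
    by (simp add: M mult_smult_assoc_mat[OF one_carrier_mat carr(3)] left_mult_one_mat[OF carr(3)])
  also have "1\<^sub>m q * (t \<cdot>\<^sub>m 1\<^sub>m q) + 0\<^sub>m q s * (- P) = t \<cdot>\<^sub>m 1\<^sub>m q"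
    by (simp add: left_mult_zero_mat[OF uminus_carrier_mat[OF carr(1)]]
        right_add_zero_mat[OF smult_carrier_mat[OF one_carrier_mat]])
  also have "1\<^sub>m q * Q + 0\<^sub>m q s * Z = Q"
    by (simp add: left_mult_one_mat[OF carr(2)] left_mult_zero_mat[OF carr(3)] right_add_zero_mat[OF carr(2)])
  finally have "det (?L * ?K) = det (four_block_mat (t \<cdot>\<^sub>m 1\<^sub>m q) Q (0\<^sub>m s q) M)" by simp
  also have "\<dots> = det (t \<cdot>\<^sub>m 1\<^sub>m q) * det M"
    by (rule det_four_block_mat_lower_left_zero) auto
  also have "\<dots> = t ^ q * det M" by simp
  also have "det (?L * ?K) = det ?L * det ?K"
    by (rule det_mult[of _ "q + s"]) auto
  also have "det ?L = det (1\<^sub>m q) * det (t \<cdot>\<^sub>m 1\<^sub>m s)"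
    by (rule det_four_block_mat_upper_right_zero) auto
  also have "\<dots> = t ^ q * t ^ (s - q)"
    using True by (simp add: power_add[symmetric])
  finally have "det M = t ^ (s - q) * det ?K" using t by simp
  then show ?thesis by (simp add: minor_def M_def)
qed simp

lemma vanishes_gen_minor:
  assumes "q \<le> r"
  shows "vanishes r q (s - q) (gen_minor s \<rho> \<kappa>)"
  unfolding vanishes_def degenerate_def poly_eval_minor[OF comm_ring_hom_const_const]
  by (rule power_dvd_minor_factored[OF assms]) simp

lemma minor_diagonal:
  "minor (\<lambda>(a, b). if a = b then d a else 0) s id id = (\<Prod>i<s. d i :: 'a::comm_ring_1)"
proof -
  have "minor (\<lambda>(a, b). if a = b then d a else 0) s id id =
     prod_list (diag_mat (mat s s (\<lambda>(x, y). if x = y then d x else 0)))"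
    unfolding minor_def by (subst det_upper_triangular[of _ s]) auto
  then show ?thesis
    by (simp add: prod_list_diag_prod atLeast0LessThan)
qed

text \<open>On the diagonal arc the bound of \<open>power_dvd_minor_factored\<close> is attained.\<close>

lemma leading_minor_specialize:
  fixes t :: "'a::comm_ring_1"
  assumes "s \<le> r" "q \<le> r" "comm_ring_hom \<kappa>"
  shows "poly_eval \<kappa> (factored r (\<lambda>a i. if a = i then 1 else 0) (tail_scale q t (\<lambda>_. 1))
           (\<lambda>a i. if a = i then 1 else 0)) (gen_minor s id id) = t ^ (s - q)"
proof -
  have "poly_eval \<kappa> (factored r (\<lambda>a i. if a = i then 1 else 0) (tail_scale q t (\<lambda>_. 1))
           (\<lambda>a i. if a = i then 1 else 0)) (gen_minor s id id)
    = minor (\<lambda>(a, b). if a = b then tail_scale q t (\<lambda>_. 1) a else 0) s id id"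
    unfolding poly_eval_minor[OF assms(3)]
  proof (rule minor_cong)
    fix x y assume xy: "x < s" "y < s"
    have "factored r (\<lambda>a i. if a = i then 1 else 0) (tail_scale q t (\<lambda>_. 1)) (\<lambda>a i. if a = i then 1 else 0) (x, y)
      = (\<Sum>i<r. if x = i then (if x = y then tail_scale q t (\<lambda>_. 1) x else 0) else 0)"
      unfolding factored_def prod.case by (rule sum.cong) auto
    also have "\<dots> = (if x = y then tail_scale q t (\<lambda>_. 1) x else 0)"
      using xy assms(1) by simp
    finally show "factored r (\<lambda>a i. if a = i then 1 else 0) (tail_scale q t (\<lambda>_. 1))
           (\<lambda>a i. if a = i then 1 else 0) (id x, id y)
      = (case (id x, id y) of (a, b) \<Rightarrow> if a = b then tail_scale q t (\<lambda>_. 1) a else 0)" by simp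
  qed
  also have "\<dots> = (\<Prod>i<s. tail_scale q t (\<lambda>_. 1) i)" by (rule minor_diagonal)
  also have "\<dots> = (\<Prod>i\<in>{q..<s}. t)"
    by (rule prod.mono_neutral_cong_right) (auto simp: tail_scale_def)
  finally show ?thesis by simp
qed

section \<open>Polynomials vanishing on matrices of low rank\<close>

lemma monomial_induct [case_names zero step]:
  fixes u :: monomial
  assumes "P 0" and step: "\<And>u v. P u \<Longrightarrow> P (u + Poly_Mapping.single v 1)"
  shows "P u"
proof (induction u rule: update_induct)
  case (update u v k)
  have "P (u + Poly_Mapping.single v j)" for j
  proof (induction j)
    case (Suc j)
    have "Poly_Mapping.single v (Suc j) = Poly_Mapping.single v j + Poly_Mapping.single v (1::nat)"
      by (simp add: single_add[symmetric])
    then show ?case using step[OF Suc, of v] by (simp add: add.assoc)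
  qed (simp add: update)
  moreover have "Poly_Mapping.update v k u = u + Poly_Mapping.single v k"
    by (rule poly_mapping_eqI)
       (use update in \<open>auto simp: lookup_update lookup_add lookup_single when_def in_keys_iff\<close>)
  ultimately show ?case by simp
qed fact

lemma keys_add_monomial:
  fixes u :: "'a \<Rightarrow>\<^sub>0 nat"
  shows "Poly_Mapping.keys (u + w) = Poly_Mapping.keys u \<union> Poly_Mapping.keys w"
  by (auto simp: in_keys_iff lookup_add)

text \<open>The entries of \<open>Y Z\<close> with generic \<open>Y\<close> of width \<open>q\<close> and \<open>Z\<close> of height \<open>q\<close>; even first indices
  belong to \<open>Y\<close>, odd ones to \<open>Z\<close>.\<close>

definition low_rank :: "nat \<Rightarrow> nat \<times> nat \<Rightarrow> 'k::field_char_0 mpoly" where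
  "low_rank q = factored q (\<lambda>a i. Var (2 * a) i) (\<lambda>_. 1) (\<lambda>i b. Var (2 * i + 1) b)"

text \<open>The \<open>i\<close>-th monomial of the \<open>v\<close>-th entry of \<open>Y Z\<close>; the index \<open>i\<close> is called its colour.\<close>

definition cell :: "nat \<Rightarrow> nat \<times> nat \<Rightarrow> monomial" where
  "cell i v = Poly_Mapping.single (2 * fst v, i) 1 + Poly_Mapping.single (2 * i + 1, snd v) 1"

lemma low_rank_eq: "low_rank q v = (\<Sum>i<q. Poly_Mapping.single (cell i v) 1)"
  by (cases v) (simp add: low_rank_def factored_def Var_def mult_single cell_def)

text \<open>Expanding the product of entries of \<open>Y Z\<close> with exponents \<open>u\<close> means to choose a colour for every
  factor.  If \<open>w v i\<close> counts the factors \<open>v\<close> of colour \<open>i\<close>, the exponents of the resulting monomial \<open>K\<close>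
  are the row and column sums of \<open>w\<close> within each colour.\<close>

definition margins ::
    "nat \<Rightarrow> nat \<Rightarrow> nat \<Rightarrow> (nat \<times> nat \<Rightarrow> nat \<Rightarrow> nat) \<Rightarrow> monomial \<Rightarrow> monomial \<Rightarrow> bool" where
  "margins r n q w u K \<longleftrightarrow> (\<forall>v. (\<Sum>i<q. w v i) = Poly_Mapping.lookup u v)
     \<and> (\<forall>a<r. \<forall>i<q. (\<Sum>b<n. w (a, b) i) = Poly_Mapping.lookup K (2 * a, i))
     \<and> (\<forall>b<n. \<forall>i<q. (\<Sum>a<r. w (a, b) i) = Poly_Mapping.lookup K (2 * i + 1, b))"

lemma lookup_cell:
  "Poly_Mapping.lookup (cell i (a, b)) (2 * a', j) = (if a' = a \<and> j = i then 1 else 0)"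
  "Poly_Mapping.lookup (cell i (a, b)) (Suc (2 * j), b') = (if b' = b \<and> j = i then 1 else 0)"
proof -
  have "2 * a' \<noteq> Suc (2 * i)" "Suc (2 * j) \<noteq> 2 * a" by presburger+
  then show "Poly_Mapping.lookup (cell i (a, b)) (2 * a', j) = (if a' = a \<and> j = i then 1 else 0)"
    "Poly_Mapping.lookup (cell i (a, b)) (Suc (2 * j), b') = (if b' = b \<and> j = i then 1 else 0)"
    by (auto simp: cell_def lookup_add lookup_single when_def)
qed

lemma margins_add:
  assumes "margins r n q w u K" "v \<in> {..<r} \<times> {..<n}" "i < q"
  shows "margins r n q (\<lambda>v' j. w v' j + (if v' = v \<and> j = i then 1 else 0))
           (u + Poly_Mapping.single v 1) (K + cell i v)"
proof -
  obtain a b where v: "v = (a, b)" "a < r" "b < n" using assms(2) by auto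
  have "(\<Sum>j<q. w v' j + (if v' = v \<and> j = i then 1 else 0)) = (\<Sum>j<q. w v' j) + (if v' = v then 1 else 0)" for v'
    using assms(3) by (cases "v' = v") (simp_all add: sum.distrib)
  moreover have "(\<Sum>b'<n. w (a', b') j + (if (a', b') = v \<and> j = i then 1 else 0))
     = (\<Sum>b'<n. w (a', b') j) + (if a' = a \<and> j = i then 1 else 0)" for a' j
    using v by (cases "a' = a \<and> j = i") (auto simp: sum.distrib)
  moreover have "(\<Sum>a'<r. w (a', b') j + (if (a', b') = v \<and> j = i then 1 else 0))
     = (\<Sum>a'<r. w (a', b') j) + (if b' = b \<and> j = i then 1 else 0)" for b' j
    using v by (cases "b' = b \<and> j = i") (auto simp: sum.distrib)
  ultimately show ?thesis
    using assms(1) unfolding margins_def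
    by (auto simp: lookup_add v(1) lookup_cell lookup_single when_def)
qed

lemma keys_monom_eval_low_rank:
  fixes K :: monomial
  assumes "Poly_Mapping.keys u \<subseteq> {..<r} \<times> {..<n}"
    "K \<in> Poly_Mapping.keys (monom_eval (low_rank q) u :: 'k::field_char_0 mpoly)"
  shows "\<exists>w. margins r n q w u K"
  using assms
proof (induction u arbitrary: K rule: monomial_induct)
  case zero
  then have "K = 0" by (simp split: if_splits)
  then show ?case by (intro exI[of _ "\<lambda>_ _. 0"]) (simp add: margins_def)
next
  case (step u v)
  have v: "v \<in> {..<r} \<times> {..<n}" and u: "Poly_Mapping.keys u \<subseteq> {..<r} \<times> {..<n}"
    using step.prems(1) by (auto simp: keys_add_monomial)
  have "monom_eval (low_rank q) (u + Poly_Mapping.single v 1) =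
      monom_eval (low_rank q) u * (low_rank q v :: 'k mpoly)"
    by (simp add: monom_eval_add monom_eval_single)
  then obtain K1 K2 where K: "K = K1 + K2" "K1 \<in> Poly_Mapping.keys (monom_eval (low_rank q) u :: 'k mpoly)"
    "K2 \<in> Poly_Mapping.keys (low_rank q v :: 'k mpoly)"
    using step.prems(2) keys_mult[of "monom_eval (low_rank q) u :: 'k mpoly" "low_rank q v"] by auto
  obtain i where i: "i < q" "K2 = cell i v"
    using K(3) Poly_Mapping.keys_sum[of "\<lambda>i. Poly_Mapping.single (cell i v) (1::'k)" "{..<q}"]
    by (auto simp: low_rank_eq split: if_splits)
  obtain w where "margins r n q w u K1" using step.IH[OF u K(2)] by auto
  from margins_add[OF this v i(1)] show ?case unfolding K(1) i(2) by blast
qed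

text \<open>The monomial that results when all factors at the same position \<open>v\<close> receive the colour \<open>c v\<close>.\<close>

definition color_monom :: "(nat \<times> nat \<Rightarrow> nat) \<Rightarrow> monomial \<Rightarrow> monomial" where
  "color_monom c u = (\<Sum>v\<in>Poly_Mapping.keys u. \<Sum>j<Poly_Mapping.lookup u v. cell (c v) v)"

lemma color_monom_add: "color_monom c (u + w) = color_monom c u + color_monom c w"
  unfolding color_monom_def
proof (rule setsum_keys_plus_distrib)
  fix v
  have "(\<Sum>j<x + y. cell (c v) v) = (\<Sum>j<x. cell (c v) v) + (\<Sum>j<y. cell (c v) v)" for x y :: nat
    by (induction y) (auto simp: ac_simps)
  then show "(\<Sum>j<Poly_Mapping.lookup u v + Poly_Mapping.lookup w v. cell (c v) v) =
    (\<Sum>j<Poly_Mapping.lookup u v. cell (c v) v) + (\<Sum>j<Poly_Mapping.lookup w v. cell (c v) v)" .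
qed simp

lemma color_monom_single: "color_monom c (Poly_Mapping.single v 1) = cell (c v) v"
  by (simp add: color_monom_def)

lemma margins_color_monom:
  assumes "Poly_Mapping.keys u \<subseteq> {..<r} \<times> {..<n}" "\<forall>v\<in>Poly_Mapping.keys u. c v < q"
  shows "margins r n q (\<lambda>v i. if c v = i then Poly_Mapping.lookup u v else 0) u (color_monom c u)"
  using assms
proof (induction u rule: monomial_induct)
  case zero
  show ?case by (simp add: margins_def color_monom_def)
next
  case (step u v)
  have *: "margins r n q (\<lambda>v i. if c v = i then Poly_Mapping.lookup u v else 0) u (color_monom c u)"
    "v \<in> {..<r} \<times> {..<n}" "c v < q"
    using step by (auto simp: keys_add_monomial)
  have "(\<lambda>v' i. if c v' = i then Poly_Mapping.lookup (u + Poly_Mapping.single v 1) v' else 0)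
    = (\<lambda>v' j. (if c v' = j then Poly_Mapping.lookup u v' else 0) + (if v' = v \<and> j = c v then 1 else 0))"
    by (auto simp: fun_eq_iff lookup_add lookup_single when_def)
  then show ?case
    using margins_add[OF *] by (simp add: color_monom_add color_monom_single[unfolded One_nat_def] )
qed

lemma sum_Nats_eq_0:
  fixes F :: "'a \<Rightarrow> 'k::field_char_0"
  assumes "finite A" "\<And>x. x \<in> A \<Longrightarrow> F x \<in> \<nat>" "sum F A = 0" "x \<in> A"
  shows "F x = 0"
proof -
  have "\<forall>x\<in>A. \<exists>m. F x = of_nat m" using assms(2) by (auto elim: Nats_cases)
  then obtain G where G: "\<forall>x\<in>A. F x = of_nat (G x)" by metis
  then have "of_nat (sum G A) = (0 :: 'k)" using assms(3) by simp
  then have "sum G A = 0" by (simp only: of_nat_eq_0_iff)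
  then show ?thesis using assms(1,4) G by simp
qed

lemma sum_in_Nats: "(\<And>x. x \<in> A \<Longrightarrow> F x \<in> \<nat>) \<Longrightarrow> sum F A \<in> \<nat>"
  by (induction A rule: infinite_finite_induct) auto

lemma lookup_mult_double_sum:
  fixes f h :: "'k::field_char_0 mpoly"
  shows "Poly_Mapping.lookup (f * h) K = (\<Sum>x\<in>Poly_Mapping.keys f \<times> Poly_Mapping.keys h.
     if fst x + snd x = K then Poly_Mapping.lookup f (fst x) * Poly_Mapping.lookup h (snd x) else 0)"
proof -
  have "f * h = (\<Sum>u\<in>Poly_Mapping.keys f. \<Sum>w\<in>Poly_Mapping.keys h.
      Poly_Mapping.single (u + w) (Poly_Mapping.lookup f u * Poly_Mapping.lookup h w))"
    by (subst sum_of_terms[of f, symmetric], subst sum_of_terms[of h, symmetric])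
       (simp add: sum_product mult_single)
  then show ?thesis
    by (simp add: lookup_sum lookup_single when_def sum.cartesian_product split_def)
qed

text \<open>Natural coefficients in characteristic zero cannot cancel.\<close>

lemma lookup_mult_Nats:
  fixes f h :: "'k::field_char_0 mpoly"
  assumes f: "\<And>K. Poly_Mapping.lookup f K \<in> \<nat>" and h: "\<And>K. Poly_Mapping.lookup h K \<in> \<nat>"
  shows "Poly_Mapping.lookup (f * h) K \<in> \<nat>"
    and "Poly_Mapping.lookup f L \<noteq> 0 \<Longrightarrow> Poly_Mapping.lookup h M \<noteq> 0 \<Longrightarrow>
           Poly_Mapping.lookup (f * h) (L + M) \<noteq> 0"
proof -
  let ?F = "\<lambda>K x. if fst x + snd x = K then Poly_Mapping.lookup f (fst x) * Poly_Mapping.lookup h (snd x) else 0"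
  have F: "?F K x \<in> \<nat>" for K x using f h by simp
  show "Poly_Mapping.lookup (f * h) K \<in> \<nat>"
    unfolding lookup_mult_double_sum by (rule sum_in_Nats) (use F in auto)
  assume nz: "Poly_Mapping.lookup f L \<noteq> 0" "Poly_Mapping.lookup h M \<noteq> 0"
  show "Poly_Mapping.lookup (f * h) (L + M) \<noteq> 0"
  proof
    assume "Poly_Mapping.lookup (f * h) (L + M) = 0"
    then have "?F (L + M) (L, M) = 0"
      unfolding lookup_mult_double_sum
      by (intro sum_Nats_eq_0[of "Poly_Mapping.keys f \<times> Poly_Mapping.keys h" "?F (L + M)"])
         (use F nz in \<open>auto simp: in_keys_iff\<close>)
    then show False using nz by simp
  qed
qed

text \<open>The entries of \<open>Y Z\<close> have natural coefficients, so no other choice of colours cancels the monomial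
  \<open>color_monom c u\<close>.\<close>

lemma lookup_color_monom:
  fixes c :: "nat \<times> nat \<Rightarrow> nat"
  assumes "\<forall>v\<in>Poly_Mapping.keys u. c v < q"
  shows "Poly_Mapping.lookup (monom_eval (low_rank q) u :: 'k::field_char_0 mpoly) (color_monom c u) \<noteq> 0
    \<and> (\<forall>K. Poly_Mapping.lookup (monom_eval (low_rank q) u :: 'k mpoly) K \<in> \<nat>)"
  using assms
proof (induction u rule: monomial_induct)
  case zero
  show ?case by (auto simp: color_monom_def lookup_one when_def)
next
  case (step u v)
  have IH: "Poly_Mapping.lookup (monom_eval (low_rank q) u :: 'k mpoly) (color_monom c u) \<noteq> 0"
    "\<And>K. Poly_Mapping.lookup (monom_eval (low_rank q) u :: 'k mpoly) K \<in> \<nat>" and v: "c v < q"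
    using step by (auto simp: keys_add_monomial)
  have l: "Poly_Mapping.lookup (low_rank q v :: 'k mpoly) K = of_nat (card {i\<in>{..<q}. cell i v = K})" for K
    by (simp add: low_rank_eq lookup_sum lookup_single when_def sum.If_cases Int_def)
  have "{i\<in>{..<q}. cell i v = cell (c v) v} \<noteq> {}" using v by auto
  then have nz: "Poly_Mapping.lookup (low_rank q v :: 'k mpoly) (cell (c v) v) \<noteq> 0"
    unfolding l by (simp add: card_eq_0_iff)
  have eq: "monom_eval (low_rank q) (u + Poly_Mapping.single v 1) =
      monom_eval (low_rank q) u * (low_rank q v :: 'k mpoly)"
    by (simp add: monom_eval_add monom_eval_single)
  show ?case
    unfolding eq color_monom_add color_monom_single
    using lookup_mult_Nats[of "monom_eval (low_rank q) u :: 'k mpoly" "low_rank q v"] IH nz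
    by (simp add: l)
qed

lemma less_monomial_iff:
  fixes u w :: monomial
  shows "u < w \<longleftrightarrow> (\<exists>k. Poly_Mapping.lookup u k < Poly_Mapping.lookup w k \<and>
    (\<forall>k'<k. Poly_Mapping.lookup u k' = Poly_Mapping.lookup w k'))"
  unfolding less_poly_mapping.rep_eq less_fun_def ..

text \<open>Let \<open>U\<close> be the colour counts of \<open>u\<close> under \<open>c\<close> and let \<open>(a, b)\<close> be the first position where \<open>w\<close>
  differs from \<open>U\<close>.  If some colour had more factors there in \<open>w\<close> than in \<open>U\<close>, then equality of row and
  column sums would force \<open>U\<close> to have factors of this colour further right in row \<open>a\<close> and further down
  in column \<open>b\<close>; these two positions contradict the hypothesis on \<open>c\<close>.  So \<open>w\<close> loses at
  \<open>(a, b)\<close>, and \<open>u\<close> is the greater monomial.\<close>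

lemma margins_le:
  assumes u: "Poly_Mapping.keys u \<subseteq> {..<r} \<times> {..<n}" and u': "Poly_Mapping.keys u' \<subseteq> {..<r} \<times> {..<n}"
    and c: "\<forall>v\<in>Poly_Mapping.keys u. c v < q"
    and chain: "\<forall>a b a' b'. (a, b) \<in> Poly_Mapping.keys u \<longrightarrow> (a', b') \<in> Poly_Mapping.keys u \<longrightarrow>
       c (a, b) = c (a', b') \<longrightarrow> a < a' \<longrightarrow> b \<le> b'"
    and w: "margins r n q w u' (color_monom c u)"
  shows "u' \<le> u"
proof (cases "u' = u")
  case False
  define U where "U v i = (if c v = i then Poly_Mapping.lookup u v else 0)" for v i
  have U: "margins r n q U u (color_monom c u)"
    unfolding U_def by (rule margins_color_monom[OF u c])
  \<comment> \<open>The positions where the two colour counts differ, in row-major order.\<close>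
  define D where "D = {v \<in> {..<r} \<times> {..<n}. \<exists>i<q. w v i \<noteq> U v i}"
  have outside: "Poly_Mapping.lookup u v = 0" "Poly_Mapping.lookup u' v = 0" if "v \<notin> {..<r} \<times> {..<n}" for v
    using that u u' by (meson in_keys_iff subsetD)+
  have agree: "Poly_Mapping.lookup u' v = Poly_Mapping.lookup u v" if "v \<notin> D" for v
  proof (cases "v \<in> {..<r} \<times> {..<n}")
    case True
    then have "(\<Sum>i<q. w v i) = (\<Sum>i<q. U v i)" using that by (auto simp: D_def)
    moreover have "(\<Sum>i<q. w v i) = Poly_Mapping.lookup u' v" "(\<Sum>i<q. U v i) = Poly_Mapping.lookup u v"
      using U w unfolding margins_def by blast+
    ultimately show ?thesis by simp
  qed (simp add: outside)
  have "D \<noteq> {}" using False agree by (metis empty_iff poly_mapping_eqI)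
  moreover have finD: "finite D" by (simp add: D_def)
  ultimately have "Min D \<in> D" by simp
  obtain a b where ab: "Min D = (a, b)" by (cases "Min D")
  have abD: "(a, b) \<in> D" using \<open>Min D \<in> D\<close> ab by simp
  have lt: "v \<notin> D" if "v < (a, b)" for v
    using that finD ab by (metis Min_le not_le)
  have box: "a < r" "b < n" using abD by (auto simp: D_def)
  have le: "w (a, b) i \<le> U (a, b) i" if i: "i < q" for i
  proof (rule ccontr)
    assume gt: "\<not> w (a, b) i \<le> U (a, b) i"
    have "\<exists>b'>b. U (a, b') i \<noteq> 0"
    proof (rule ccontr)
      assume no: "\<not> (\<exists>b'>b. U (a, b') i \<noteq> 0)"
      have "U (a, b') i \<le> w (a, b') i" if "b' < n" for b'
      proof (cases b' b rule: linorder_cases)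
        case less
        then have "(a, b') \<notin> D" by (intro lt) (simp add: less_prod_def)
        then show ?thesis using i box that by (auto simp: D_def)
      next
        case equal
        then show ?thesis using gt by simp
      next
        case greater
        then show ?thesis using no by simp
      qed
      then have "(\<Sum>b'<n. U (a, b') i) < (\<Sum>b'<n. w (a, b') i)"
        using gt box by (intro sum_strict_mono_ex1) (auto intro!: bexI[of _ b])
      then show False using U w box i by (simp add: margins_def)
    qed
    then obtain b' where b': "b < b'" "U (a, b') i \<noteq> 0" by auto
    have "\<exists>a'>a. U (a', b) i \<noteq> 0"
    proof (rule ccontr)
      assume no: "\<not> (\<exists>a'>a. U (a', b) i \<noteq> 0)"
      have "U (a', b) i \<le> w (a', b) i" if "a' < r" for a'
      proof (cases a' a rule: linorder_cases)
        case less
        then have "(a', b) \<notin> D" by (intro lt) (simp add: less_prod_def)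
        then show ?thesis using i box that by (auto simp: D_def)
      next
        case equal
        then show ?thesis using gt by simp
      next
        case greater
        then show ?thesis using no by simp
      qed
      then have "(\<Sum>a'<r. U (a', b) i) < (\<Sum>a'<r. w (a', b) i)"
        using gt box by (intro sum_strict_mono_ex1) (auto intro!: bexI[of _ a])
      then show False using U w box i by (simp add: margins_def)
    qed
    then obtain a' where a': "a < a'" "U (a', b) i \<noteq> 0" by auto
    have "b' \<le> b"
      using a' b' by (intro chain[rule_format, of a b' a' b]) (auto simp: U_def in_keys_iff split: if_splits)
    then show False using b'(1) by simp
  qed
  have "\<exists>i<q. w (a, b) i < U (a, b) i"
    using abD le by (fastforce simp: D_def nat_less_le)
  then have "(\<Sum>i<q. w (a, b) i) < (\<Sum>i<q. U (a, b) i)"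
    using le by (intro sum_strict_mono_ex1) auto
  then have "Poly_Mapping.lookup u' (a, b) < Poly_Mapping.lookup u (a, b)"
    using U w by (simp add: margins_def)
  then have "u' < u" unfolding less_monomial_iff using agree lt by blast
  then show ?thesis by simp
qed simp

text \<open>A sequence of \<open>l + 1\<close> positions whose rows increase while the columns decrease.\<close>

definition chain_at :: "(nat \<times> nat) set \<Rightarrow> nat \<Rightarrow> (nat \<Rightarrow> nat) \<Rightarrow> (nat \<Rightarrow> nat) \<Rightarrow> bool" where
  "chain_at S l \<rho> \<kappa> \<longleftrightarrow> (\<forall>x\<le>l. (\<rho> x, \<kappa> x) \<in> S) \<and> (\<forall>x<l. \<rho> x < \<rho> (Suc x) \<and> \<kappa> (Suc x) < \<kappa> x)"

text \<open>Colour each position with the length of the longest chain that ends in it; then two positions of one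
  colour are never consecutive in a chain.\<close>

lemma coloring_exists:
  assumes no: "\<not> (\<exists>\<rho> \<kappa>. chain_at S q \<rho> \<kappa>)"
  obtains c where "\<forall>v\<in>S. c v < q"
    "\<forall>a b a' b'. (a, b) \<in> S \<longrightarrow> (a', b') \<in> S \<longrightarrow> c (a, b) = c (a', b') \<longrightarrow> a < a' \<longrightarrow> b \<le> b'"
proof
  define L where "L v = {l. \<exists>\<rho> \<kappa>. chain_at S l \<rho> \<kappa> \<and> (\<rho> l, \<kappa> l) = v}" for v
  define c where "c v = Max (L v)" for v
  have bound: "l < q" if "l \<in> L v" for l v
  proof (rule ccontr)
    assume "\<not> l < q"
    moreover obtain \<rho> \<kappa> where "chain_at S l \<rho> \<kappa>" using \<open>l \<in> L v\<close> by (auto simp: L_def)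
    ultimately have "chain_at S q \<rho> \<kappa>" by (auto simp: chain_at_def)
    then show False using no by blast
  qed
  then have fin: "finite (L v)" for v by (meson finite_nat_iff_bounded lessThan_iff subsetI)
  have zero: "0 \<in> L v" if "v \<in> S" for v
    unfolding L_def using that
    by (intro CollectI exI[of _ "\<lambda>_. fst v"] exI[of _ "\<lambda>_. snd v"]) (simp add: chain_at_def)
  have cL: "c v \<in> L v" if "v \<in> S" for v
    unfolding c_def using fin zero[OF that] by (intro Max_in) auto
  then show "\<forall>v\<in>S. c v < q" using bound by blast
  have "b \<le> b'" if *: "(a, b) \<in> S" "(a', b') \<in> S" "c (a, b) = c (a', b')" "a < a'" for a b a' b'
  proof (rule ccontr)
    assume "\<not> b \<le> b'"
    obtain \<rho> \<kappa> where ch: "chain_at S (c (a, b)) \<rho> \<kappa>" "(\<rho> (c (a, b)), \<kappa> (c (a, b))) = (a, b)"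
      using cL[OF *(1)] by (auto simp: L_def)
    let ?l = "c (a, b)"
    have "chain_at S (Suc ?l) (\<rho>(Suc ?l := a')) (\<kappa>(Suc ?l := b'))"
      using ch * \<open>\<not> b \<le> b'\<close> by (auto simp: chain_at_def less_Suc_eq le_Suc_eq)
    then have "Suc ?l \<in> L (a', b')" unfolding L_def
      by (intro CollectI exI[of _ "\<rho>(Suc ?l := a')"] exI[of _ "\<kappa>(Suc ?l := b')"]) simp
    then have "Suc ?l \<le> c (a', b')" unfolding c_def using fin by (intro Max_ge) auto
    then show False using *(3) by simp
  qed
  then show "\<forall>a b a' b'. (a, b) \<in> S \<longrightarrow> (a', b') \<in> S \<longrightarrow> c (a, b) = c (a', b') \<longrightarrow> a < a' \<longrightarrow> b \<le> b'"
    by blast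
qed

lemma lookup_Const_mult: "Poly_Mapping.lookup (Const c * f) K = c * Poly_Mapping.lookup f K"
  by (simp add: Const_def mult_map_scale_conv_mult[symmetric] map.rep_eq when_def)

text \<open>Otherwise the support of the least monomial \<open>u\<close> has a colouring with \<open>q\<close> colours.  The monomial
  \<open>color_monom c u\<close> occurs in the expansion of \<open>u\<close>, and by \<open>margins_le\<close> in the expansion of no
  greater monomial of \<open>f\<close>, so it survives in the value of \<open>f\<close> at \<open>Y Z\<close>.\<close>

lemma least_monomial_has_chain:
  fixes f :: "'k::field_char_0 mpoly"
  assumes f: "f \<in> RR r n" "f \<noteq> 0" and v: "poly_eval Const (low_rank q) f = 0"
  shows "\<exists>\<rho> \<kappa>. chain_at (Poly_Mapping.keys (Min (Poly_Mapping.keys f))) q \<rho> \<kappa>"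
proof (rule ccontr)
  define u where "u = Min (Poly_Mapping.keys f)"
  assume "\<not> ?thesis"
  then obtain c where c: "\<forall>v\<in>Poly_Mapping.keys u. c v < q"
    "\<forall>a b a' b'. (a, b) \<in> Poly_Mapping.keys u \<longrightarrow> (a', b') \<in> Poly_Mapping.keys u \<longrightarrow>
       c (a, b) = c (a', b') \<longrightarrow> a < a' \<longrightarrow> b \<le> b'"
    unfolding u_def by (rule coloring_exists) blast
  have uf: "u \<in> Poly_Mapping.keys f" unfolding u_def using f(2) by (intro Min_in) auto
  have box: "Poly_Mapping.keys u' \<subseteq> {..<r} \<times> {..<n}" if "u' \<in> Poly_Mapping.keys f" for u'
    using f(1) that by (simp add: RR_iff)
  let ?M = "color_monom c u"
  have "Poly_Mapping.lookup (poly_eval Const (low_rank q) f) ?M =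
     (\<Sum>u'\<in>Poly_Mapping.keys f. Poly_Mapping.lookup f u' *
        Poly_Mapping.lookup (monom_eval (low_rank q) u') ?M)"
    by (simp add: poly_eval_def lookup_sum lookup_Const_mult)
  also have "\<dots> = (\<Sum>u'\<in>{u}. Poly_Mapping.lookup f u' *
        Poly_Mapping.lookup (monom_eval (low_rank q) u') ?M)"
  proof (rule sum.mono_neutral_right; safe?)
    fix u' assume u': "u' \<in> Poly_Mapping.keys f" "u' \<notin> {}"
      "Poly_Mapping.lookup f u' * Poly_Mapping.lookup (monom_eval (low_rank q) u') ?M \<noteq> 0"
    then have "?M \<in> Poly_Mapping.keys (monom_eval (low_rank q) u' :: 'k mpoly)"
      by (simp add: in_keys_iff)
    from keys_monom_eval_low_rank[OF box[OF u'(1)] this]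
    obtain w where "margins r n q w u' ?M" by auto
    then have "u' \<le> u" using margins_le[OF box[OF uf] box[OF u'(1)] c] by blast
    moreover have "u \<le> u'" unfolding u_def using u'(1) by simp
    ultimately show "u' = u" by simp
  qed (use uf in auto)
  finally have "Poly_Mapping.lookup f u * Poly_Mapping.lookup (monom_eval (low_rank q) u) ?M = 0"
    using v by simp
  then show False using lookup_color_monom[OF c(1), where 'k = 'k] uf by (simp add: in_keys_iff)
qed

text \<open>The monomial of the permutation \<open>\<pi>\<close> in the Leibniz formula.\<close>

definition perm_monom :: "nat \<Rightarrow> (nat \<Rightarrow> nat) \<Rightarrow> (nat \<Rightarrow> nat) \<Rightarrow> (nat \<Rightarrow> nat) \<Rightarrow> monomial" where
  "perm_monom s \<rho> \<kappa> \<pi> = (\<Sum>x<s. Poly_Mapping.single (\<rho> x, \<kappa> (\<pi> x)) 1)"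

lemma lookup_perm_monom:
  "Poly_Mapping.lookup (perm_monom s \<rho> \<kappa> \<pi>) v = (\<Sum>x<s. if (\<rho> x, \<kappa> (\<pi> x)) = v then 1 else 0)"
  by (simp add: perm_monom_def lookup_sum lookup_single when_def del: One_nat_def)

lemma prod_Var: "(\<Prod>x\<in>A. Var (\<rho> x) (\<kappa> x)) = 
    (Poly_Mapping.single (\<Sum>x\<in>A. Poly_Mapping.single (\<rho> x, \<kappa> x) 1) 1 :: 'k::field_char_0 mpoly)"
  by (induction A rule: infinite_finite_induct) (simp_all add: Var_def mult_single)

lemma gen_minor_expand:
  "(gen_minor s \<rho> \<kappa> :: 'a::field_char_0 mpoly) = (\<Sum>\<pi> | \<pi> permutes {..<s}.
     Poly_Mapping.single (perm_monom s \<rho> \<kappa> \<pi>) (of_int (sign \<pi>)))"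
proof -
  interpret C: comm_ring_hom "Const :: 'a \<Rightarrow> _" by (rule Const_hom)
  have "(gen_minor s \<rho> \<kappa> :: 'a mpoly) = (\<Sum>\<pi> | \<pi> permutes {..<s}. of_int (sign \<pi>) * (\<Prod>x<s. Var (\<rho> x) (\<kappa> (\<pi> x))))"
    unfolding minor_def by (subst det_def'[of _ s]) (auto simp: atLeast0LessThan intro!: sum.cong prod.cong
        dest: permutes_in_image)
  also have "\<dots> = (\<Sum>\<pi> | \<pi> permutes {..<s}.
     Poly_Mapping.single (perm_monom s \<rho> \<kappa> \<pi>) (of_int (sign \<pi>)))"
  proof (intro sum.cong refl)
    fix \<pi> :: "nat \<Rightarrow> nat"
    have "(of_int (sign \<pi>) :: 'a mpoly) = Const (of_int (sign \<pi>))"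
      by (rule C.hom_of_int[symmetric])
    then show "of_int (sign \<pi>) * (\<Prod>x<s. Var (\<rho> x) (\<kappa> (\<pi> x))) =
        (Poly_Mapping.single (perm_monom s \<rho> \<kappa> \<pi>) (of_int (sign \<pi>)) :: 'a mpoly)"
      by (simp only: prod_Var perm_monom_def Const_def mult_single) simp
  qed
  finally show ?thesis .
qed

text \<open>With increasing rows and decreasing columns, the identity yields an antidiagonal.  At the first point
  moved by \<open>\<pi>\<close>, the column chosen by \<open>\<pi>\<close> lies further left, hence at an earlier position.\<close>

lemma perm_monom_less:
  assumes \<pi>: "\<pi> permutes {..<s}" "\<pi> \<noteq> id"
    and mono: "\<And>x y. x < y \<Longrightarrow> y < s \<Longrightarrow> \<rho> x < \<rho> y \<and> \<kappa> y < \<kappa> x"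
  shows "perm_monom s \<rho> \<kappa> id < perm_monom s \<rho> \<kappa> \<pi>"
proof -
  define x where "x = (LEAST x. \<pi> x \<noteq> x)"
  have "\<exists>x. \<pi> x \<noteq> x" using \<pi>(2) by auto
  then have x: "\<pi> x \<noteq> x" unfolding x_def by (rule LeastI_ex)
  have below: "\<pi> y = y" if "y < x" for y using that not_less_Least unfolding x_def by blast
  have xs: "x < s" using x \<pi>(1) by (metis lessThan_iff permutes_not_in)
  have \<pi>x: "\<pi> x < s" using xs \<pi>(1) by (metis lessThan_iff permutes_in_image)
  have gt: "x < \<pi> x"
  proof (rule ccontr)
    assume "\<not> x < \<pi> x"
    then have "\<pi> x < x" using x by simp
    then have "\<pi> (\<pi> x) = \<pi> x" by (rule below)
    then show False using x permutes_inj[OF \<pi>(1)] by (auto dest: injD)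
  qed
  have \<kappa>x: "\<kappa> (\<pi> x) < \<kappa> x" using mono[OF gt \<pi>x] by simp
  let ?v = "(\<rho> x, \<kappa> (\<pi> x))"
  have "Poly_Mapping.lookup (perm_monom s \<rho> \<kappa> id) ?v = 0"
    unfolding lookup_perm_monom
  proof (rule sum.neutral, safe)
    fix y assume "y < s"
    have "(\<rho> y, \<kappa> y) \<noteq> ?v"
      by (cases y x rule: linorder_cases) (use mono[of y x] mono[of x y] xs \<open>y < s\<close> \<kappa>x in auto)
    then show "(if (\<rho> y, \<kappa> (id y)) = ?v then 1 else 0) = (0::nat)" by simp
  qed
  moreover have "1 \<le> Poly_Mapping.lookup (perm_monom s \<rho> \<kappa> \<pi>) ?v"
    unfolding lookup_perm_monom
    using member_le_sum[of x "{..<s}" "\<lambda>y. if (\<rho> y, \<kappa> (\<pi> y)) = ?v then 1 else (0::nat)"] xs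
    by (auto simp del: One_nat_def)
  moreover have "Poly_Mapping.lookup (perm_monom s \<rho> \<kappa> id) v = Poly_Mapping.lookup (perm_monom s \<rho> \<kappa> \<pi>) v"
    if "v < ?v" for v
    unfolding lookup_perm_monom
  proof (rule sum.cong)
    fix y assume "y \<in> {..<s}"
    then show "(if (\<rho> y, \<kappa> (id y)) = v then 1 else 0) = (if (\<rho> y, \<kappa> (\<pi> y)) = v then 1 else (0::nat))"
      by (cases y x rule: linorder_cases)
         (use that below[of y] \<kappa>x mono[of x y] in \<open>auto simp: less_prod_def\<close>)
  qed simp
  ultimately show ?thesis unfolding less_monomial_iff by (intro exI[of _ ?v]) auto
qed

lemma chain_at_mono:
  assumes "chain_at S l \<rho> \<kappa>"
  shows "x < y \<Longrightarrow> y \<le> l \<Longrightarrow> \<rho> x < \<rho> y \<and> \<kappa> y < \<kappa> x"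
proof (induction y)
  case (Suc y)
  have "\<rho> y < \<rho> (Suc y) \<and> \<kappa> (Suc y) < \<kappa> y" using assms Suc.prems by (simp add: chain_at_def)
  then show ?case using Suc by (cases "x = y") auto
qed simp

definition monom_degree :: "monomial \<Rightarrow> nat" where
  "monom_degree u = (\<Sum>v\<in>Poly_Mapping.keys u. Poly_Mapping.lookup u v)"

lemma monom_degree_add: "monom_degree (u + w) = monom_degree u + monom_degree w"
  unfolding monom_degree_def by (rule setsum_keys_plus_distrib) auto

lemma monom_degree_perm_monom: "monom_degree (perm_monom s \<rho> \<kappa> \<pi>) = s"
proof -
  have "monom_degree (\<Sum>x\<in>A. Poly_Mapping.single (\<rho> x, \<kappa> (\<pi> x)) 1) = card A" if "finite A" for A
    using that by (induction A) (simp_all add: monom_degree_add, simp_all add: monom_degree_def)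
  then show ?thesis by (simp add: perm_monom_def)
qed

lemma finite_monomials:
  "finite {w::monomial. Poly_Mapping.keys w \<subseteq> {..<r} \<times> {..<n} \<and> monom_degree w \<le> d}"
proof (rule finite_imageD)
  have le: "Poly_Mapping.lookup w v \<le> monom_degree w" for w v
    unfolding monom_degree_def
    by (cases "v \<in> Poly_Mapping.keys w") (auto intro: member_le_sum simp: in_keys_iff)
  show "finite (Poly_Mapping.lookup ` {w::monomial. Poly_Mapping.keys w \<subseteq> {..<r} \<times> {..<n} \<and> monom_degree w \<le> d})"
  proof (rule finite_subset)
    show "finite {f. \<forall>x. (x \<in> {..<r} \<times> {..<n} \<longrightarrow> f x \<in> {..d}) \<and> (x \<notin> {..<r} \<times> {..<n} \<longrightarrow> f x = (0::nat))}"
      by (rule finite_set_of_finite_funs) auto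
    show "Poly_Mapping.lookup ` {w::monomial. Poly_Mapping.keys w \<subseteq> {..<r} \<times> {..<n} \<and> monom_degree w \<le> d}
      \<subseteq> {f. \<forall>x. (x \<in> {..<r} \<times> {..<n} \<longrightarrow> f x \<in> {..d}) \<and> (x \<notin> {..<r} \<times> {..<n} \<longrightarrow> f x = (0::nat))}"
    proof (rule image_subsetI, rule CollectI, rule allI, rule conjI; rule impI)
      fix w :: monomial and v
      assume w: "w \<in> {w. Poly_Mapping.keys w \<subseteq> {..<r} \<times> {..<n} \<and> monom_degree w \<le> d}"
      show "Poly_Mapping.lookup w v \<in> {..d}" using w le[of w v] by simp
      show "Poly_Mapping.lookup w v = 0" if "v \<notin> {..<r} \<times> {..<n}"
      proof -
        have "v \<notin> Poly_Mapping.keys w" using w that by blast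
        then show ?thesis by (simp add: in_keys_iff)
      qed
    qed
  qed
next
  show "inj_on Poly_Mapping.lookup {w::monomial. Poly_Mapping.keys w \<subseteq> {..<r} \<times> {..<n} \<and> monom_degree w \<le> d}"
    by (rule inj_onI) (simp only: poly_mapping_eq_iff)
qed

lemma single_mult_keys_lookup:
  fixes g :: "'k::field_char_0 mpoly"
  shows "Poly_Mapping.keys (Poly_Mapping.single \<nu> c * g) \<subseteq> (\<lambda>m. \<nu> + m) ` Poly_Mapping.keys g"
    and "Poly_Mapping.lookup (Poly_Mapping.single \<nu> c * g) (\<nu> + m) = c * Poly_Mapping.lookup g m"
proof -
  show "Poly_Mapping.keys (Poly_Mapping.single \<nu> c * g) \<subseteq> (\<lambda>m. \<nu> + m) ` Poly_Mapping.keys g"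
    using keys_mult[of "Poly_Mapping.single \<nu> c" g] by (auto split: if_splits)
  have "Poly_Mapping.single \<nu> c * g = (\<Sum>w\<in>Poly_Mapping.keys g. Poly_Mapping.single (\<nu> + w) (c * Poly_Mapping.lookup g w))"
    by (subst sum_of_terms[of g, symmetric]) (simp add: sum_distrib_left mult_single)
  then show "Poly_Mapping.lookup (Poly_Mapping.single \<nu> c * g) (\<nu> + m) = c * Poly_Mapping.lookup g m"
    by (simp add: lookup_sum lookup_single when_def in_keys_iff)
qed

text \<open>The matrix \<open>Y Z\<close> is the point \<open>t = 0\<close> of an arc.\<close>

lemma poly_eval_low_rank_gen_minor:
  "poly_eval Const (low_rank q) (gen_minor (Suc q) \<rho> \<kappa>) = (0 :: 'k::field_char_0 mpoly)"
proof -
  have "(0 :: 'k mpoly) ^ 1 dvd poly_eval Const (factored q (\<lambda>a i. Var (2 * a) i) (tail_scale q 0 (\<lambda>_. 1))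
      (\<lambda>i b. Var (2 * i + 1) b)) (gen_minor (Suc q) \<rho> \<kappa>)"
    using vanishes_gen_minor[of q q "Suc q" \<rho> \<kappa>, where ?'a = 'k]
    by (intro vanishes_specialize[OF Const_hom]) simp
  moreover have "factored q U (tail_scale q 0 (\<lambda>_. 1)) W = factored q U (\<lambda>_. 1) W" for U W :: "nat \<Rightarrow> nat \<Rightarrow> 'k mpoly"
    by (auto simp: factored_def tail_scale_def)
  ultimately show ?thesis by (simp add: low_rank_def)
qed

text \<open>The second fundamental theorem of invariant theory for matrices.  The least monomial of \<open>f\<close> is
  divisible by an antidiagonal of length \<open>q + 1\<close>, which is the least monomial of a minor.  Subtracting
  the corresponding multiple of the minor raises the least monomial without raising the degree, and
  there are only finitely many monomials of bounded degree.\<close>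

lemma low_rank_vanishing_imp_minors:
  fixes f :: "'k::field_char_0 mpoly"
  assumes "f \<in> RR r n" "poly_eval Const (low_rank q) f = 0"
    and D0: "0 \<in> D" and D_add: "\<And>x y. x \<in> D \<Longrightarrow> y \<in> D \<Longrightarrow> x + y \<in> D"
    and D_minor: "\<And>h \<rho> \<kappa>. h \<in> RR r n \<Longrightarrow> \<forall>x\<le>q. \<rho> x < r \<and> \<kappa> x < n \<Longrightarrow> inj_on \<rho> {..q} \<Longrightarrow> inj_on \<kappa> {..q}
      \<Longrightarrow> h * gen_minor (Suc q) \<rho> \<kappa> \<in> D"
  shows "f \<in> D"
proof -
  interpret ev: comm_ring_hom "poly_eval Const (low_rank q) :: 'k mpoly \<Rightarrow> _" by (rule poly_eval_hom[OF Const_hom])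
  define B where "B d = {w::monomial. Poly_Mapping.keys w \<subseteq> {..<r} \<times> {..<n} \<and> monom_degree w \<le> d}" for d
  \<comment> \<open>The termination measure: the monomials of bounded degree that are not below the least monomial of \<open>f\<close>.\<close>
  define up where "up d f = {w \<in> B d. \<exists>u\<in>Poly_Mapping.keys f. u \<le> w}" for d and f :: "'k mpoly"
  have fin: "finite (up d f)" for d f
    by (rule finite_subset[OF _ finite_monomials[of r n d]]) (auto simp: up_def B_def)
  have main: "Poly_Mapping.keys f \<subseteq> B d \<Longrightarrow> poly_eval Const (low_rank q) f = 0 \<Longrightarrow> f \<in> D" for d and f :: "'k mpoly"
  proof (induction "card (up d f)" arbitrary: f rule: less_induct)
    case less
    show ?case
    proof (cases "f = 0")
      case False
      have fR: "f \<in> RR r n" using less.prems(1) by (auto simp: RR_iff B_def)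
      define u where "u = Min (Poly_Mapping.keys f)"
      have uf: "u \<in> Poly_Mapping.keys f" unfolding u_def using False by (intro Min_in) auto
      have ule: "u \<le> w" if "w \<in> Poly_Mapping.keys f" for w unfolding u_def using that by simp
      obtain \<rho> \<kappa> where ch: "chain_at (Poly_Mapping.keys u) q \<rho> \<kappa>"
        using least_monomial_has_chain[OF fR False less.prems(2)] unfolding u_def by blast
      have mono: "\<rho> x < \<rho> y \<and> \<kappa> y < \<kappa> x" if "x < y" "y < Suc q" for x y
        using chain_at_mono[OF ch, of x y] that by simp
      have uB: "u \<in> B d" using uf less.prems(1) by blast
      have box: "\<rho> x < r \<and> \<kappa> x < n" if "x \<le> q" for x
        using ch that uB by (auto simp: chain_at_def B_def)
      have inj: "inj_on \<rho> {..q}" "inj_on \<kappa> {..q}"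
        by (rule linorder_inj_onI; use mono in fastforce)+
      let ?\<mu> = "perm_monom (Suc q) \<rho> \<kappa>"
      define g :: "'k mpoly" where "g = gen_minor (Suc q) \<rho> \<kappa>"
      have \<mu>1: "Poly_Mapping.lookup (?\<mu> id) v \<le> Poly_Mapping.lookup u v" for v
      proof (cases "\<exists>x\<le>q. (\<rho> x, \<kappa> x) = v")
        case True
        then obtain x where x: "x \<le> q" "(\<rho> x, \<kappa> x) = v" by auto
        have "Poly_Mapping.lookup (?\<mu> id) v = (\<Sum>y<Suc q. if y = x then 1 else 0)"
          unfolding lookup_perm_monom
        proof (rule sum.cong, simp)
          fix y assume "y \<in> {..<Suc q}"
          then show "(if (\<rho> y, \<kappa> (id y)) = v then 1 else 0) = (if y = x then 1 else (0::nat))"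
            using x inj(1) by (auto dest: inj_onD)
        qed
        also have "\<dots> = 1" using x by (simp del: sum.lessThan_Suc)
        finally show ?thesis using ch x by (auto simp: chain_at_def in_keys_iff)
      next
        case False
        then show ?thesis unfolding lookup_perm_monom by (subst sum.neutral) auto
      qed
      \<comment> \<open>The least monomial of \<open>f\<close> divided by the antidiagonal of the minor.\<close>
      define \<nu> where "\<nu> = u - ?\<mu> id"
      have u: "u = \<nu> + ?\<mu> id"
        by (rule poly_mapping_eqI) (use \<mu>1 in \<open>simp add: \<nu>_def lookup_add lookup_minus\<close>)
      have \<mu>less: "?\<mu> id < ?\<mu> \<pi>" if "\<pi> permutes {..<Suc q}" "\<pi> \<noteq> id" for \<pi>
        by (rule perm_monom_less[OF that mono])
      have lg: "Poly_Mapping.lookup g w = (\<Sum>\<pi> | \<pi> permutes {..<Suc q}. if ?\<mu> \<pi> = w then of_int (sign \<pi>) else 0)" for w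
        unfolding g_def gen_minor_expand by (simp add: lookup_sum lookup_single when_def)
      have "Poly_Mapping.lookup g (?\<mu> id) = (\<Sum>\<pi>\<in>{id}. if ?\<mu> \<pi> = ?\<mu> id then of_int (sign \<pi>) else 0)"
        unfolding lg
      proof (rule sum.mono_neutral_right)
        show "\<forall>\<pi>\<in>{\<pi>. \<pi> permutes {..<Suc q}} - {id}. (if ?\<mu> \<pi> = ?\<mu> id then of_int (sign \<pi>) else 0) = (0 :: 'k)"
        proof
          fix \<pi> assume "\<pi> \<in> {\<pi>. \<pi> permutes {..<Suc q}} - {id}"
          then have "?\<mu> id < ?\<mu> \<pi>" using \<mu>less by blast
          then show "(if ?\<mu> \<pi> = ?\<mu> id then of_int (sign \<pi>) else 0) = (0 :: 'k)" by auto
        qed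
      qed (auto simp: finite_permutations permutes_id)
      then have g1: "Poly_Mapping.lookup g (?\<mu> id) = 1" by simp
      have gkeys: "\<exists>\<pi>. \<pi> permutes {..<Suc q} \<and> w = ?\<mu> \<pi>" if "w \<in> Poly_Mapping.keys g" for w
      proof (rule ccontr)
        assume "\<not> ?thesis"
        then have "Poly_Mapping.lookup g w = 0" unfolding lg by (intro sum.neutral) auto
        then show False using that by (simp add: in_keys_iff)
      qed
      define c where "c = Poly_Mapping.lookup f u"
      define h where "h = Poly_Mapping.single \<nu> c"
      define f' where "f' = f - h * g"
      have hR: "h \<in> RR r n"
        unfolding h_def using uB by (intro RR_single) (auto simp: B_def u keys_add_monomial)
      have hgkeys: "w \<in> B d \<and> u \<le> w" if w: "w \<in> Poly_Mapping.keys (h * g)" for w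
      proof -
        obtain m where m: "m \<in> Poly_Mapping.keys g" "w = \<nu> + m"
          using w single_mult_keys_lookup(1)[of \<nu> c g] by (auto simp: h_def)
        obtain \<pi> where \<pi>: "\<pi> permutes {..<Suc q}" "m = ?\<mu> \<pi>" using gkeys[OF m(1)] by auto
        have "?\<mu> id \<le> ?\<mu> \<pi>" using \<mu>less[OF \<pi>(1)] by (cases "\<pi> = id") auto
        then have "u \<le> w" by (simp add: u m \<pi>)
        moreover have "monom_degree w = monom_degree u"
          by (simp add: u m \<pi> monom_degree_add monom_degree_perm_monom)
        moreover have "Poly_Mapping.keys m \<subseteq> {..<r} \<times> {..<n}"
        proof
          fix v assume "v \<in> Poly_Mapping.keys m"
          then have "(\<Sum>x<Suc q. if (\<rho> x, \<kappa> (\<pi> x)) = v then 1 else (0::nat)) \<noteq> 0"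
            unfolding \<pi>(2) in_keys_iff lookup_perm_monom .
          then have "\<exists>x<Suc q. (\<rho> x, \<kappa> (\<pi> x)) = v"
            by (rule sum.not_neutral_contains_not_neutral) (auto split: if_splits)
          then obtain x where "x < Suc q" "(\<rho> x, \<kappa> (\<pi> x)) = v" by auto
          moreover have "\<pi> x < Suc q" using calculation(1) \<pi>(1) by (metis lessThan_iff permutes_in_image)
          ultimately show "v \<in> {..<r} \<times> {..<n}" using box[of x] box[of "\<pi> x"] by auto
        qed
        ultimately show ?thesis using uB by (auto simp: B_def m(2) u keys_add_monomial)
      qed
      have f'u: "Poly_Mapping.lookup f' u = 0"
        using single_mult_keys_lookup(2)[of \<nu> c g "?\<mu> id"] by (simp add: f'_def h_def lookup_minus u[symmetric] c_def g1)
      have f'keys: "w \<in> B d \<and> u < w" if "w \<in> Poly_Mapping.keys f'" for w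
      proof -
        have "w \<in> Poly_Mapping.keys f \<or> w \<in> Poly_Mapping.keys (h * g)"
          using that by (auto simp: f'_def in_keys_iff lookup_minus)
        then have "w \<in> B d" "u \<le> w" using hgkeys ule less.prems(1) by auto
        moreover have "w \<noteq> u" using f'u that by (auto simp: in_keys_iff)
        ultimately show ?thesis by simp
      qed
      have "up d f' \<subset> up d f"
      proof
        show "up d f' \<subseteq> up d f"
        proof
          fix w assume "w \<in> up d f'"
          then obtain w' where w': "w \<in> B d" "w' \<in> Poly_Mapping.keys f'" "w' \<le> w" by (auto simp: up_def)
          then have "u \<le> w" using f'keys[of w'] by (meson less_imp_le order_trans)
          then show "w \<in> up d f" using uf w'(1) by (auto simp: up_def)
        qed
        have "u \<in> up d f" using uf uB by (auto simp: up_def)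
        moreover have "u \<notin> up d f'"
        proof
          assume "u \<in> up d f'"
          then obtain w' where "w' \<in> Poly_Mapping.keys f'" "w' \<le> u" by (auto simp: up_def)
          then show False using f'keys[of w'] leD by blast
        qed
        ultimately show "up d f' \<noteq> up d f" by blast
      qed
      then have smaller: "card (up d f') < card (up d f)" using fin by (rule psubset_card_mono[rotated])
      have ev0: "poly_eval Const (low_rank q) f' = 0"
        by (simp add: f'_def ev.hom_minus ev.hom_mult less.prems(2) g_def poly_eval_low_rank_gen_minor)
      have "Poly_Mapping.keys f' \<subseteq> B d" using f'keys by blast
      then have "f' \<in> D" by (rule less.hyps[OF smaller _ ev0])
      moreover have "h * g \<in> D" unfolding g_def by (rule D_minor[OF hR _ inj]) (use box in blast)
      ultimately have "f' + h * g \<in> D" by (rule D_add)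
      then show ?thesis by (simp add: f'_def)
    qed (simp add: D0)
  qed
  define d where "d = Max (monom_degree ` Poly_Mapping.keys f)"
  have "Poly_Mapping.keys f \<subseteq> B d" using assms(1) by (auto simp: RR_iff B_def d_def)
  then show ?thesis using main assms(2) by blast
qed

section \<open>Ideals, powers and localization\<close>

lemma ring_coord_ring: "ring (coord_ring r n)"
  using cring_coord_ring by (rule cring.axioms)

lemma ideal_coord_ring_iff:
  fixes I :: "'k::field_char_0 mpoly set"
  shows "ideal I (coord_ring r n) \<longleftrightarrow> I \<subseteq> RR r n \<and> 0 \<in> I \<and> (\<forall>x\<in>I. \<forall>y\<in>I. x + y \<in> I)
     \<and> (\<forall>x\<in>RR r n. \<forall>y\<in>I. x * y \<in> I)"
    (is "_ \<longleftrightarrow> ?R")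
proof
  assume I: "ideal I (coord_ring r n)"
  interpret I: ideal I "coord_ring r n" by (rule I)
  have add: "additive_subgroup I (coord_ring r n)" by (rule I.is_additive_subgroup)
  show ?R
    using additive_subgroup.a_closed[OF add] additive_subgroup.zero_closed[OF add]
      additive_subgroup.a_subset[OF add] I.I_l_closed by auto
next
  assume R: ?R
  interpret cr: ring "coord_ring r n :: 'k mpoly ring" by (rule ring_coord_ring)
  show "ideal I (coord_ring r n)"
  proof (rule idealI[OF ring_coord_ring])
    show "subgroup I (add_monoid (coord_ring r n))"
    proof (rule cr.add.subgroupI)
      fix a assume a: "a \<in> I"
      then have aR: "a \<in> RR r n" using R by blast
      have "\<ominus>\<^bsub>coord_ring r n\<^esub> a = - a"
        by (rule cr.minus_equality) (use aR in \<open>auto intro: RR_uminus\<close>)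
      moreover have "- 1 * a \<in> I" using R a RR_uminus[OF RR_1] by blast
      ultimately show "\<ominus>\<^bsub>coord_ring r n\<^esub> a \<in> I" by simp
    qed (use R in auto)
  next
    fix a x :: "'k mpoly" assume "a \<in> I" "x \<in> RR r n"
    then show "x \<otimes>\<^bsub>coord_ring r n\<^esub> a \<in> I" "a \<otimes>\<^bsub>coord_ring r n\<^esub> x \<in> I"
      using R by (auto simp: mult.commute)
  qed
qed

lemma ideal_coord_ringD:
  assumes "ideal I (coord_ring r n)"
  shows "x \<in> I \<Longrightarrow> x \<in> RR r n" "0 \<in> I" "x \<in> I \<Longrightarrow> y \<in> I \<Longrightarrow> x + y \<in> I"
    "h \<in> RR r n \<Longrightarrow> x \<in> I \<Longrightarrow> h * x \<in> I"
  using assms[unfolded ideal_coord_ring_iff] by auto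

definition ideal_power :: "nat \<Rightarrow> nat \<Rightarrow> 'k::field_char_0 mpoly set \<Rightarrow> nat \<Rightarrow> 'k mpoly set" where
  "ideal_power r n I m = I [^]\<^bsub>ideals_set (coord_ring r n)\<^esub> m"

lemma ideal_power_0: "ideal_power r n I 0 = RR r n"
  and ideal_power_Suc: "ideal_power r n I (Suc m) = ideal_power r n I m \<cdot>\<^bsub>coord_ring r n\<^esub> I"
  by (simp_all add: ideal_power_def nat_pow_def ideals_set_def)

lemma ideal_ideal_power:
  assumes "ideal I (coord_ring r n)"
  shows "ideal (ideal_power r n I m) (coord_ring r n)"
proof (induction m)
  case 0
  show ?case unfolding ideal_power_0 by (rule ring.oneideal[OF ring_coord_ring])
next
  case (Suc m)
  show ?case unfolding ideal_power_Suc
    by (rule ring.ideal_prod_is_ideal[OF ring_coord_ring Suc assms])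
qed

lemma ideal_power_RR: "ideal I (coord_ring r n) \<Longrightarrow> x \<in> ideal_power r n I m \<Longrightarrow> x \<in> RR r n"
  using ideal_ideal_power[of I r n m] by (auto simp: ideal_coord_ring_iff)

lemma ideal_power_Suc_mult: "x \<in> ideal_power r n I m \<Longrightarrow> y \<in> I \<Longrightarrow> x * y \<in> ideal_power r n I (Suc m)"
  unfolding ideal_power_Suc using ideal_prod.prod[of x _ y _ "coord_ring r n"] by simp

text \<open>The powers of \<open>I\<close> are the least family of additively closed sets that starts with the whole ring and
  that multiplication by \<open>I\<close> raises by one step.  Statements on powers are proved by exhibiting
  such a family.\<close>

lemma ideal_power_subset:
  assumes "RR r n \<subseteq> F 0" and "\<And>m x y. x \<in> F m \<Longrightarrow> y \<in> I \<Longrightarrow> x * y \<in> F (Suc m)"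
    and "\<And>m x y. x \<in> F m \<Longrightarrow> y \<in> F m \<Longrightarrow> x + y \<in> F m"
  shows "ideal_power r n I m \<subseteq> F m"
proof (induction m)
  case 0
  then show ?case using assms(1) by (simp add: ideal_power_0)
next
  case (Suc m)
  have "x \<in> F (Suc m)" if "x \<in> ideal_power r n I (Suc m)" for x
    using that unfolding ideal_power_Suc
  proof (induction rule: ideal_prod.induct)
    case (prod i j)
    then show ?case using assms(2) Suc by auto
  next
    case (sum s1 s2)
    then show ?case using assms(3) by simp
  qed
  then show ?case by blast
qed

lemma ideal_power_mult:
  assumes "ideal I (coord_ring r n)" "x \<in> ideal_power r n I m" "y \<in> ideal_power r n I k"
  shows "x * y \<in> ideal_power r n I (m + k)"
proof -
  note id = ideal_ideal_power[OF assms(1), unfolded ideal_coord_ring_iff]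
  have "ideal_power r n I k \<subseteq> {y. x * y \<in> ideal_power r n I (m + k)}"
  proof (rule ideal_power_subset)
    show "RR r n \<subseteq> {y. x * y \<in> ideal_power r n I (m + 0)}"
      using id[of m] assms(2) by (auto simp: mult.commute)
  next
    fix k z y assume "z \<in> {y. x * y \<in> ideal_power r n I (m + k)}" "y \<in> I"
    then show "z * y \<in> {y. x * y \<in> ideal_power r n I (m + Suc k)}"
      using ideal_power_Suc_mult[of "x * z" r n I "m + k" y] by (simp add: mult.assoc)
  next
    fix k z y assume "z \<in> {y. x * y \<in> ideal_power r n I (m + k)}" "y \<in> {y. x * y \<in> ideal_power r n I (m + k)}"
    then show "z + y \<in> {y. x * y \<in> ideal_power r n I (m + k)}"
      using id[of "m + k"] by (simp add: distrib_left)
  qed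
  then show ?thesis using assms(3) by blast
qed

lemma ideal_power_1:
  assumes "ideal I (coord_ring r n)" "x \<in> I"
  shows "x \<in> ideal_power r n I 1"
  using ideal_power_Suc_mult[of 1 r n I 0 x] assms(2) by (simp add: ideal_power_0)

lemma ideal_power_elem:
  assumes "ideal I (coord_ring r n)" "x \<in> ideal_power r n I k"
  shows "x ^ m \<in> ideal_power r n I (k * m)"
proof (induction m)
  case 0
  then show ?case by (simp add: ideal_power_0)
next
  case (Suc m)
  then show ?case using ideal_power_mult[OF assms(1,2) Suc] by simp
qed

lemma ideal_power_antimono:
  assumes "ideal I (coord_ring r n)" "k \<le> m" "x \<in> ideal_power r n I m"
  shows "x \<in> ideal_power r n I k"
proof -
  have "ideal_power r n I (k + l) \<subseteq> ideal_power r n I k" for l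
  proof (induction l)
    case (Suc l)
    have "ideal_power r n I (Suc (k + l)) \<subseteq> ideal_power r n I (k + l)"
      unfolding ideal_power_Suc
      using ring.ideal_prod_inter[OF ring_coord_ring ideal_ideal_power[OF assms(1)] assms(1)] by blast
    then show ?case using Suc by simp
  qed simp
  from this[of "m - k"] show ?thesis using assms(2,3) by auto
qed

lemma ideal_power_mono:
  assumes "ideal J (coord_ring r n)" "I \<subseteq> J"
  shows "ideal_power r n I m \<subseteq> ideal_power r n J m"
proof (rule ideal_power_subset)
  fix m x y assume "x \<in> ideal_power r n J m" "y \<in> I"
  then show "x * y \<in> ideal_power r n J (Suc m)" using ideal_power_Suc_mult assms(2) by blast
qed (use ideal_ideal_power[OF assms(1)] in \<open>auto simp: ideal_power_0 ideal_coord_ring_iff\<close>)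

lemma ideal_power_vanishes:
  fixes x :: "'k::field_char_0 mpoly"
  assumes "\<And>x. x \<in> I \<Longrightarrow> vanishes r q N x"
  shows "x \<in> ideal_power r n I m \<Longrightarrow> vanishes r q (m * N) x"
proof -
  have "ideal_power r n I m \<subseteq> {x. vanishes r q (m * N) x}"
  proof (rule ideal_power_subset)
    fix m and x y :: "'k mpoly" assume "x \<in> {x. vanishes r q (m * N) x}" "y \<in> I"
    then show "x * y \<in> {x. vanishes r q (Suc m * N) x}"
      using vanishes_mult[of r q "m * N" x N y] assms by (simp add: add.commute)
  qed (auto intro: vanishes_add)
  then show "x \<in> ideal_power r n I m \<Longrightarrow> vanishes r q (m * N) x" by blast
qed

context
  fixes r n :: nat and P :: "'k::field_char_0 mpoly set"
  assumes one: "1 \<notin> P" and zero: "0 \<in> P"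
    and mult: "\<And>x y. x \<in> RR r n \<Longrightarrow> y \<in> RR r n \<Longrightarrow> x \<notin> P \<Longrightarrow> y \<notin> P \<Longrightarrow> x * y \<notin> P"
begin

lemma localization_simps:
  "monoid.mult (localization r n P) = (*)" "one (localization r n P) = 1"
  "ring.zero (localization r n P) = 0" "add (localization r n P) = (+)"
  by (simp_all add: localization_def)

lemma localization_carrierI:
  "a \<in> RR r n \<Longrightarrow> s \<in> RR r n \<Longrightarrow> s \<notin> P \<Longrightarrow> to_fract a / to_fract s \<in> carrier (localization r n P)"
  by (auto simp: localization_def Fract_conv_to_fract)

lemma localization_carrierE:
  assumes "x \<in> carrier (localization r n P)"
  obtains a s where "a \<in> RR r n" "s \<in> RR r n" "s \<notin> P" "s \<noteq> 0" "x = to_fract a / to_fract s"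
  using assms zero by (auto simp: localization_def Fract_conv_to_fract)

lemma fract_add: "s \<noteq> 0 \<Longrightarrow> t \<noteq> 0 \<Longrightarrow>
   to_fract a / to_fract s + to_fract b / to_fract t = to_fract (a * t + b * s) / to_fract (s * t :: 'k mpoly)"
  by (simp add: add_frac_eq)

lemma ring_localization: "ring (localization r n P)"
proof (rule ringI)
  let ?L = "localization r n P"
  have add: "x + y \<in> carrier ?L" if x: "x \<in> carrier ?L" and y: "y \<in> carrier ?L" for x y
  proof -
    obtain a s where *: "a \<in> RR r n" "s \<in> RR r n" "s \<notin> P" "s \<noteq> 0" "x = to_fract a / to_fract s"
      using x by (rule localization_carrierE)
    obtain b t where **: "b \<in> RR r n" "t \<in> RR r n" "t \<notin> P" "t \<noteq> 0" "y = to_fract b / to_fract t"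
      using y by (rule localization_carrierE)
    have "x + y = to_fract (a * t + b * s) / to_fract (s * t)"
      unfolding *(5) **(5) by (rule fract_add[OF *(4) **(4)])
    then show ?thesis
      by (simp only:) (intro localization_carrierI RR_add RR_mult mult * **)
  qed
  have mul: "x * y \<in> carrier ?L" if x: "x \<in> carrier ?L" and y: "y \<in> carrier ?L" for x y
  proof -
    obtain a s where *: "a \<in> RR r n" "s \<in> RR r n" "s \<notin> P" "s \<noteq> 0" "x = to_fract a / to_fract s"
      using x by (rule localization_carrierE)
    obtain b t where **: "b \<in> RR r n" "t \<in> RR r n" "t \<notin> P" "t \<noteq> 0" "y = to_fract b / to_fract t"
      using y by (rule localization_carrierE)
    have "x * y = to_fract (a * b) / to_fract (s * t)" by (simp add: * **)
    then show ?thesis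
      by (simp only:) (intro localization_carrierI RR_mult mult * **)
  qed
  have neg: "- x \<in> carrier ?L" if x: "x \<in> carrier ?L" for x
  proof -
    obtain a s where *: "a \<in> RR r n" "s \<in> RR r n" "s \<notin> P" "s \<noteq> 0" "x = to_fract a / to_fract s"
      using x by (rule localization_carrierE)
    have "- x = to_fract (- a) / to_fract s" by (simp add: *)
    then show ?thesis by (simp only:) (intro localization_carrierI RR_uminus *)
  qed
  have c0: "0 \<in> carrier ?L" and c1: "1 \<in> carrier ?L"
    using localization_carrierI[OF RR_0 RR_1 one] localization_carrierI[OF RR_1 RR_1 one] by simp_all
  show "abelian_group ?L"
    by (rule abelian_groupI)
       (auto simp: localization_simps add c0 add_ac intro!: bexI[of _ "- x" for x] neg)
  show "monoid ?L"
    by (rule monoidI) (auto simp: localization_simps mul c1 mult_ac)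
qed (auto simp: localization_simps algebra_simps)

text \<open>The fractions with numerator in \<open>J\<close> already form an ideal of the localization.\<close>

lemma localization_ideal_iff:
  assumes J: "ideal J (coord_ring r n)" and f: "f \<in> RR r n"
  shows "to_fract f \<in> Idl\<^bsub>localization r n P\<^esub> (to_fract ` J) \<longleftrightarrow> (\<exists>s\<in>RR r n - P. s * f \<in> J)"
proof
  let ?L = "localization r n P"
  note JR = J[unfolded ideal_coord_ring_iff]
  interpret L: ring ?L by (rule ring_localization)
  \<comment> \<open>The candidate for the generated ideal.\<close>
  define Q where "Q = {to_fract a / to_fract s | a s. a \<in> J \<and> s \<in> RR r n - P}"
  have QL: "Q \<subseteq> carrier ?L" using JR by (auto simp: Q_def intro!: localization_carrierI)
  have Qmult: "x * y \<in> Q" if x: "x \<in> carrier ?L" and y: "y \<in> Q" for x y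
  proof -
    obtain a s where *: "a \<in> RR r n" "s \<in> RR r n" "s \<notin> P" "s \<noteq> 0" "x = to_fract a / to_fract s"
      using x by (rule localization_carrierE)
    obtain b t where **: "b \<in> J" "t \<in> RR r n" "t \<notin> P" "y = to_fract b / to_fract t"
      using y by (auto simp: Q_def)
    have "x * y = to_fract (a * b) / to_fract (s * t)" by (simp add: * **)
    moreover have "a * b \<in> J" using JR * ** by blast
    moreover have "s * t \<in> RR r n - P" using * ** mult RR_mult by blast
    ultimately show ?thesis unfolding Q_def by blast
  qed
  have "ideal Q ?L"
  proof (rule idealI[OF ring_localization])
    show "subgroup Q (add_monoid ?L)"
    proof (rule L.add.subgroupI)
      show "Q \<subseteq> carrier ?L" by (rule QL)
      have "to_fract 0 / to_fract 1 \<in> Q" unfolding Q_def using JR one RR_1 by blast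
      then show "Q \<noteq> {}" by blast
    next
      fix x assume x: "x \<in> Q"
      have "\<ominus>\<^bsub>?L\<^esub> \<one>\<^bsub>?L\<^esub> \<otimes>\<^bsub>?L\<^esub> x \<in> Q"
        using Qmult[of "\<ominus>\<^bsub>?L\<^esub> \<one>\<^bsub>?L\<^esub>" x] x by (simp add: localization_simps(1))
      then show "\<ominus>\<^bsub>?L\<^esub> x \<in> Q" using x QL by (simp add: L.l_minus subset_iff)
    next
      fix x y assume "x \<in> Q" "y \<in> Q"
      then obtain a s b t where *: "a \<in> J" "s \<in> RR r n" "s \<notin> P" "x = to_fract a / to_fract s"
        "b \<in> J" "t \<in> RR r n" "t \<notin> P" "y = to_fract b / to_fract t"
        by (auto simp: Q_def)
      then have "s \<noteq> 0" "t \<noteq> 0" using zero by auto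
      then have "x + y = to_fract (t * a + s * b) / to_fract (s * t)"
        unfolding *(4,8) by (simp add: add_frac_eq mult.commute)
      moreover have "t * a + s * b \<in> J" using JR * by blast
      moreover have "s * t \<in> RR r n - P" using * mult RR_mult by blast
      ultimately show "x \<oplus>\<^bsub>?L\<^esub> y \<in> Q" unfolding Q_def localization_simps by blast
    qed
  next
    fix a x assume "a \<in> Q" "x \<in> carrier ?L"
    then show "x \<otimes>\<^bsub>?L\<^esub> a \<in> Q" "a \<otimes>\<^bsub>?L\<^esub> x \<in> Q"
      using Qmult[of x a] by (simp_all add: localization_simps mult.commute)
  qed
  moreover have "to_fract ` J \<subseteq> Q"
  proof
    fix x assume "x \<in> to_fract ` J"
    then obtain a where "a \<in> J" "x = to_fract a / to_fract 1" by auto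
    then show "x \<in> Q" unfolding Q_def using one RR_1 by blast
  qed
  ultimately have sub: "Idl\<^bsub>?L\<^esub> (to_fract ` J) \<subseteq> Q" by (rule L.genideal_minimal)
  {
    assume "to_fract f \<in> Idl\<^bsub>?L\<^esub> (to_fract ` J)"
    then obtain a s where *: "a \<in> J" "s \<in> RR r n - P" "to_fract f = to_fract a / to_fract s"
      using sub by (auto simp: Q_def)
    then have "s \<noteq> 0" using zero by auto
    then have "to_fract (s * f) = to_fract a" using *(3) by simp
    then have "s * f = a" by (simp only: to_fract_eq_iff)
    then show "\<exists>s\<in>RR r n - P. s * f \<in> J" using * by blast
  next
    assume "\<exists>s\<in>RR r n - P. s * f \<in> J"
    then obtain s where s: "s \<in> RR r n" "s \<notin> P" "s * f \<in> J" by blast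
    then have s0: "s \<noteq> 0" using zero by auto
    have JL: "to_fract ` J \<subseteq> carrier ?L"
      using QL \<open>to_fract ` J \<subseteq> Q\<close> by blast
    interpret I: ideal "Idl\<^bsub>?L\<^esub> (to_fract ` J)" ?L by (rule L.genideal_ideal[OF JL])
    have "to_fract (s * f) \<in> Idl\<^bsub>?L\<^esub> (to_fract ` J)"
      using L.genideal_self[OF JL] s(3) by blast
    then have "to_fract 1 / to_fract s \<otimes>\<^bsub>?L\<^esub> to_fract (s * f) \<in> Idl\<^bsub>?L\<^esub> (to_fract ` J)"
      by (rule I.I_l_closed) (rule localization_carrierI[OF RR_1 s(1,2)])
    then show "to_fract f \<in> Idl\<^bsub>?L\<^esub> (to_fract ` J)"
      using s0 by (simp add: localization_simps)
  }
qed

end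

section \<open>Determinantal ideals as vanishing ideals\<close>

lemma minor_transpose: "minor E s \<rho> \<kappa> = minor (\<lambda>(a, b). E (b, a)) s \<kappa> \<rho>"
proof -
  have "transpose_mat (mat s s (\<lambda>(x, y). E (\<rho> x, \<kappa> y))) = mat s s (\<lambda>(x, y). E (\<rho> y, \<kappa> x))"
    by (rule eq_matI) auto
  then show ?thesis
    unfolding minor_def using det_transpose[of "mat s s (\<lambda>(x, y). E (\<rho> x, \<kappa> y))" s] by simp
qed

lemma minor_permute_rows:
  assumes "\<pi> permutes {..<s}" "\<And>x. x < s \<Longrightarrow> \<rho> x = \<rho>' (\<pi> x)"
  shows "minor E s \<rho> \<kappa> = signof \<pi> * minor E s \<rho>' \<kappa>"
proof -
  have "mat s s (\<lambda>(i, j). mat s s (\<lambda>(x, y). E (\<rho>' x, \<kappa> y)) $$ (\<pi> i, j)) = mat s s (\<lambda>(x, y). E (\<rho> x, \<kappa> y))"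
    using assms(2) permutes_in_image[OF assms(1)] by (intro eq_matI) auto
  then show ?thesis
    unfolding minor_def using det_permute_rows[of "mat s s (\<lambda>(x, y). E (\<rho>' x, \<kappa> y))" s \<pi>] assms(1)
    by (simp add: atLeast0LessThan)
qed

text \<open>Any list of distinct rows is a permutation of the increasing list of the same rows, so minors on
  arbitrary lists agree up to sign with the determinants of submatrices.\<close>

lemma inj_on_eq_pick:
  assumes "inj_on \<rho> {..<s}"
  obtains \<pi> where "\<pi> permutes {..<s}" "\<And>x. x < s \<Longrightarrow> \<rho> x = pick (\<rho> ` {..<s}) (\<pi> x)"
proof
  let ?S = "\<rho> ` {..<s}"
  define \<pi> where "\<pi> x = (if x < s then card {a \<in> ?S. a < \<rho> x} else x)" for x
  have cS: "card ?S = s" using assms by (simp add: card_image)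
  show pk: "\<rho> x = pick ?S (\<pi> x)" if "x < s" for x
    using that pick_card_in_set[of "\<rho> x" ?S] by (simp add: \<pi>_def)
  have "\<pi> x < s" if "x < s" for x
  proof -
    have "{a \<in> ?S. a < \<rho> x} \<subset> ?S" using that by auto
    then have "card {a \<in> ?S. a < \<rho> x} < card ?S" by (intro psubset_card_mono) auto
    then show ?thesis using that cS by (simp add: \<pi>_def)
  qed
  then have "\<pi> ` {..<s} \<subseteq> {..<s}" by auto
  moreover have "inj_on \<pi> {..<s}"
    using assms pk by (metis (mono_tags, lifting) inj_onD inj_onI lessThan_iff)
  ultimately have "bij_betw \<pi> {..<s} {..<s}"
    by (simp add: bij_betw_def endo_inj_surj)
  then show "\<pi> permutes {..<s}" by (rule bij_imp_permutes) (simp add: \<pi>_def)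
qed

lemma det_submatrix:
  assumes "S \<subseteq> {..<r}" "T \<subseteq> {..<n}" "card S = s" "card T = s"
  shows "det (submatrix (generic_mat r n) S T) = gen_minor s (pick S) (pick T)"
proof -
  have S: "{i. i < r \<and> i \<in> S} = S" "{j. j < n \<and> j \<in> T} = T" using assms by auto
  have "pick S x < r" "pick T x < n" if "x < s" for x
    using that assms pick_in_set_le[of x S] pick_in_set_le[of x T] by auto
  then show ?thesis
    unfolding submatrix_def minor_def generic_mat_def using assms
    by (intro arg_cong[where f = det] eq_matI) (auto simp: S)
qed

lemma D_generators_RR:
  "{det (submatrix (generic_mat r n) S T) | S T.
        S \<subseteq> {..<r} \<and> T \<subseteq> {..<n} \<and> card S = j \<and> card T = j} \<subseteq> RR r n"
proof safe
  fix S T :: "nat set" assume *: "S \<subseteq> {..<r}" "T \<subseteq> {..<n}" "j = card S" "card T = card S"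
  show "det (submatrix (generic_mat r n) S T) \<in> RR r n"
    unfolding det_submatrix[OF *(1,2) refl *(4)]
    using * pick_in_set_le[of _ S] pick_in_set_le[of _ T] by (intro gen_minor_RR) auto
qed

lemma ideal_D_ideal: "ideal (D_ideal r n j) (coord_ring r n)"
  unfolding D_ideal_def by (rule ring.genideal_ideal[OF ring_coord_ring D_generators_RR])

lemma gen_minor_in_D:
  fixes \<rho> \<kappa> :: "nat \<Rightarrow> nat"
  assumes "\<And>x. x < s \<Longrightarrow> \<rho> x < r" "\<And>x. x < s \<Longrightarrow> \<kappa> x < n" "inj_on \<rho> {..<s}" "inj_on \<kappa> {..<s}"
  shows "gen_minor s \<rho> \<kappa> \<in> (D_ideal r n s :: 'k::field_char_0 mpoly set)"
proof -
  obtain \<pi> where \<pi>: "\<pi> permutes {..<s}" "\<And>x. x < s \<Longrightarrow> \<rho> x = pick (\<rho> ` {..<s}) (\<pi> x)"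
    using inj_on_eq_pick[OF assms(3)] by blast
  obtain \<tau> where \<tau>: "\<tau> permutes {..<s}" "\<And>x. x < s \<Longrightarrow> \<kappa> x = pick (\<kappa> ` {..<s}) (\<tau> x)"
    using inj_on_eq_pick[OF assms(4)] by blast
  let ?S = "\<rho> ` {..<s}" and ?T = "\<kappa> ` {..<s}"
  have "?S \<subseteq> {..<r}" "?T \<subseteq> {..<n}" "card ?S = s" "card ?T = s"
    using assms by (auto simp: card_image)
  then have "det (submatrix (generic_mat r n) ?S ?T) \<in> (D_ideal r n s :: 'k mpoly set)"
    unfolding D_ideal_def
    by (intro subsetD[OF ring.genideal_self[OF ring_coord_ring D_generators_RR]]) blast
  moreover have "det (submatrix (generic_mat r n) ?S ?T) = (gen_minor s (pick ?S) (pick ?T) :: 'k mpoly)"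
    using assms by (intro det_submatrix) (auto simp: card_image)
  ultimately have D: "gen_minor s (pick ?S) (pick ?T) \<in> (D_ideal r n s :: 'k mpoly set)" by simp
  have "(gen_minor s \<rho> \<kappa> :: 'k mpoly) = signof \<pi> * gen_minor s (pick ?S) \<kappa>"
    by (rule minor_permute_rows[where \<pi> = \<pi>]) (use \<pi> in auto)
  also have "gen_minor s (pick ?S) \<kappa> = (signof \<tau> :: 'k mpoly) * gen_minor s (pick ?S) (pick ?T)"
    by (subst (1 2) minor_transpose) (rule minor_permute_rows[where \<pi> = \<tau>], use \<tau> in auto)
  finally have "(gen_minor s \<rho> \<kappa> :: 'k mpoly) = (signof \<pi> * signof \<tau>) * gen_minor s (pick ?S) (pick ?T)"
    by (simp add: mult.assoc)
  moreover have "(signof \<pi> * signof \<tau> :: 'k mpoly) \<in> RR r n"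
    by (intro RR_mult) (use RR_signof[of _ 1] in auto)
  ultimately show ?thesis
    using D ideal_D_ideal[of r n s] unfolding ideal_coord_ring_iff by metis
qed

text \<open>At \<open>t = 0\<close> the arc consists of all products of a matrix with \<open>j - 1\<close> columns and one with \<open>j - 1\<close>
  rows, so vanishing of order one is vanishing at \<open>Y Z\<close>.\<close>

theorem D_ideal_eq_vanishing:
  assumes "1 \<le> j" "j \<le> r"
  shows "(D_ideal r n j :: 'k::field_char_0 mpoly set) = {f \<in> RR r n. vanishes r (j - 1) 1 f}"
proof
  interpret cr: ring "coord_ring r n :: 'k mpoly ring" by (rule ring_coord_ring)
  have "ideal {f \<in> RR r n. vanishes r (j - 1) 1 f} (coord_ring r n :: 'k mpoly ring)"
    unfolding ideal_coord_ring_iff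
    by (auto intro: RR_add RR_mult vanishes_add vanishes_mult_right)
  then show "(D_ideal r n j :: 'k mpoly set) \<subseteq> {f \<in> RR r n. vanishes r (j - 1) 1 f}"
    unfolding D_ideal_def
  proof (rule cr.genideal_minimal)
    show "{det (submatrix (generic_mat r n) S T) :: 'k mpoly | S T.
        S \<subseteq> {..<r} \<and> T \<subseteq> {..<n} \<and> card S = j \<and> card T = j} \<subseteq> {f \<in> RR r n. vanishes r (j - 1) 1 f}"
    proof safe
      fix S T :: "nat set" assume *: "S \<subseteq> {..<r}" "T \<subseteq> {..<n}" "j = card S" "card T = card S"
      show "det (submatrix (generic_mat r n) S T) \<in> (RR r n :: 'k mpoly set)"
        using D_generators_RR[of r n "card S"] * by blast
      have one: "card S - (card S - 1) = 1" and le: "card S - 1 \<le> r" using assms * by simp_all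
      show "vanishes r (card S - 1) 1 (det (submatrix (generic_mat r n) S T) :: 'k mpoly)"
        unfolding det_submatrix[OF *(1,2) refl *(4)]
        using vanishes_gen_minor[OF le, of "card S" "pick S" "pick T", unfolded one] by simp
    qed
  qed
  show "{f \<in> RR r n. vanishes r (j - 1) 1 f} \<subseteq> (D_ideal r n j :: 'k mpoly set)"
  proof
    fix f :: "'k mpoly" assume "f \<in> {f \<in> RR r n. vanishes r (j - 1) 1 f}"
    then have f: "f \<in> RR r n" "vanishes r (j - 1) 1 f" by simp_all
    define q where "q = j - 1"
    have j: "j = Suc q" and q: "q \<le> r" using assms by (auto simp: q_def)
    have "(0 :: 'k mpoly) ^ 1 dvd poly_eval Const (factored r (\<lambda>a i. Var (2 * a) i) (tail_scale q 0 (\<lambda>_. 1))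
      (\<lambda>i b. Var (2 * i + 1) b)) f"
      using f(2) by (intro vanishes_specialize[OF Const_hom]) (simp add: q_def)
    moreover have "factored r U (tail_scale q 0 (\<lambda>_. 1)) W = factored q U (\<lambda>_. 1) W" for U W :: "nat \<Rightarrow> nat \<Rightarrow> 'k mpoly"
      unfolding factored_def
    proof (rule ext, clarify)
      fix a b
      show "(\<Sum>i<r. U a i * tail_scale q 0 (\<lambda>_. 1) i * W i b) = (\<Sum>i<q. U a i * 1 * W i b)"
        by (rule sum.mono_neutral_cong_right) (use q in \<open>auto simp: tail_scale_def\<close>)
    qed
    ultimately have ev: "poly_eval Const (low_rank q) f = 0" by (simp add: low_rank_def)
    have "ideal (D_ideal r n j :: 'k mpoly set) (coord_ring r n)" by (rule ideal_D_ideal)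
    note D = ideal_coord_ringD[OF this]
    have "h * gen_minor (Suc q) \<rho> \<kappa> \<in> D_ideal r n j"
      if h: "h \<in> RR r n" "\<forall>x\<le>q. \<rho> x < r \<and> \<kappa> x < n" "inj_on \<rho> {..q}" "inj_on \<kappa> {..q}"
      for h :: "'k mpoly" and \<rho> \<kappa> :: "nat \<Rightarrow> nat"
    proof -
      have "gen_minor (Suc q) \<rho> \<kappa> \<in> (D_ideal r n j :: 'k mpoly set)"
        unfolding j by (rule gen_minor_in_D) (use h in \<open>auto simp: lessThan_Suc_atMost\<close>)
      then show ?thesis by (rule D(4)[OF h(1)])
    qed
    note D_minor = this
    show "f \<in> D_ideal r n j"
      by (rule low_rank_vanishing_imp_minors[OF f(1) ev]) (use D(2) D(3) D_minor in simp_all)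
  qed
qed

lemma vanishes_1_iff: "vanishes r q 1 f \<longleftrightarrow> poly (degenerate r q f) 0 = 0"
  by (simp add: vanishes_def poly_eq_0_iff_dvd)

text \<open>The value at \<open>t = 0\<close> lies in a domain; this is the primality of the determinantal ideals.\<close>

lemma vanishes_1_mult: "vanishes r q 1 (f * h) \<longleftrightarrow> vanishes r q 1 f \<or> vanishes r q 1 h"
proof -
  interpret comm_ring_hom "degenerate r q" by (rule degenerate_hom)
  show ?thesis unfolding vanishes_1_iff by (simp add: hom_mult)
qed

lemma not_vanishes_1_one: "\<not> vanishes r q 1 1"
proof -
  interpret comm_ring_hom "degenerate r q" by (rule degenerate_hom)
  show ?thesis unfolding vanishes_1_iff by simp
qed

lemma vanishes_cancel:
  assumes "s \<in> RR r n" "f \<in> RR r n" "\<not> vanishes r q 1 s" "vanishes r q N (s * f)"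
  shows "vanishes r q N f"
proof (cases "f = 0")
  case False
  have s: "s \<noteq> 0" using assms(3) by auto
  have "locus_order r q s = 0" using assms(3) vanishes_iff_le_order[OF assms(1) s, of q 1] by simp
  then show ?thesis
    using assms(4) vanishes_iff_le_order[of "s * f" r n q N] vanishes_iff_le_order[OF assms(2) False, of q N]
      locus_order_mult[OF assms(1,2) s False, of q] s False assms(1,2) by (simp add: RR_mult)
qed simp

lemma gen_symbolic_power_iff:
  assumes "1 \<le> p" "p \<le> r" "ideal I (coord_ring r n)"
  shows "f \<in> gen_symbolic_power r n p I m \<longleftrightarrow>
    f \<in> RR r n \<and> (\<exists>s\<in>RR r n. \<not> vanishes r (p - 1) 1 s \<and> s * f \<in> ideal_power r n I m)"
proof -
  have D: "D_ideal r n p = {f \<in> RR r n. vanishes r (p - 1) 1 f}"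
    by (rule D_ideal_eq_vanishing[OF assms(1,2)])
  have "to_fract f \<in> Idl\<^bsub>localization r n (D_ideal r n p)\<^esub> (to_fract ` ideal_power r n I m)
      \<longleftrightarrow> (\<exists>s\<in>RR r n - D_ideal r n p. s * f \<in> ideal_power r n I m)" if "f \<in> RR r n"
    using not_vanishes_1_one by (intro localization_ideal_iff ideal_ideal_power assms(3) that)
      (auto simp: D vanishes_1_mult[unfolded One_nat_def] )
  then show ?thesis unfolding gen_symbolic_power_def ideal_power_def[symmetric] using D by auto
qed

section \<open>Symbolic powers of determinantal ideals\<close>

definition border :: "nat \<Rightarrow> nat \<Rightarrow> nat \<Rightarrow> nat" where
  "border q a x = (if x < q then x else a)"

context
  fixes q :: nat and X :: "nat \<times> nat \<Rightarrow> 'a::idom"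
begin

private definition "A = mat q q X"
private definition "\<Delta> = minor X q id id"
definition cramer :: "nat \<Rightarrow> nat \<Rightarrow> 'a" where
  "cramer i b = (\<Sum>l<q. adj_mat (mat q q X) $$ (i, l) * X (l, b))"
definition schur :: "nat \<Rightarrow> nat \<Rightarrow> 'a" where
  "schur a b = minor X q id id * X (a, b) - (\<Sum>i<q. X (a, i) * cramer i b)"

private lemma A_carrier: "A \<in> carrier_mat q q" by (simp add: A_def)

private lemma det_A: "det A = \<Delta>"
  unfolding \<Delta>_def minor_def A_def by (rule arg_cong[where f = det], rule eq_matI) auto

private lemma adj_entries:
  assumes "i < q" "l < q"
  shows "(\<Sum>k<q. X (i, k) * adj_mat A $$ (k, l)) = (if i = l then \<Delta> else 0)"
    and "(\<Sum>k<q. adj_mat A $$ (i, k) * X (k, l)) = (if i = l then \<Delta> else 0)"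
proof -
  note adj = adj_mat[OF A_carrier]
  have "(A * adj_mat A) $$ (i, l) = (\<Sum>k<q. X (i, k) * adj_mat A $$ (k, l))"
    using assms adj(1) by (simp add: A_def scalar_prod_def atLeast0LessThan)
  then show "(\<Sum>k<q. X (i, k) * adj_mat A $$ (k, l)) = (if i = l then \<Delta> else 0)"
    using assms by (cases "i = l") (simp_all add: adj(2) det_A)
  have "(adj_mat A * A) $$ (i, l) = (\<Sum>k<q. adj_mat A $$ (i, k) * X (k, l))"
    using assms adj(1) by (simp add: A_def scalar_prod_def atLeast0LessThan)
  then show "(\<Sum>k<q. adj_mat A $$ (i, k) * X (k, l)) = (if i = l then \<Delta> else 0)"
    using assms by (cases "i = l") (simp_all add: adj(3) det_A)
qed

text \<open>Cramer's rule without division: \<open>cramer\<close> is the adjugate of the leading block applied to the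
  columns of the matrix.\<close>

lemma cramer_solves:
  assumes "a < q"
  shows "(\<Sum>i<q. X (a, i) * cramer i b) = minor X q id id * X (a, b)"
proof -
  have "(\<Sum>i<q. X (a, i) * cramer i b) = (\<Sum>l<q. (\<Sum>i<q. X (a, i) * adj_mat A $$ (i, l)) * X (l, b))"
    unfolding cramer_def A_def sum_distrib_left sum_distrib_right
    by (subst sum.swap) (simp add: mult.assoc)
  also have "\<dots> = (\<Sum>l<q. if a = l then \<Delta> * X (a, b) else 0)"
    using assms by (intro sum.cong refl) (simp add: adj_entries)
  also have "\<dots> = \<Delta> * X (a, b)" using assms by simp
  finally show ?thesis by (simp add: \<Delta>_def)
qed

lemma cramer_unit:
  assumes "i < q" "b < q"
  shows "cramer i b = (if i = b then minor X q id id else 0)"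
  using adj_entries(2)[OF assms] by (simp add: cramer_def A_def \<Delta>_def)

lemma schur_eq_0: "b < q \<Longrightarrow> schur a b = 0"
proof -
  assume b: "b < q"
  have "(\<Sum>i<q. X (a, i) * cramer i b) = (\<Sum>i<q. if i = b then X (a, b) * minor X q id id else 0)"
    using b by (intro sum.cong) (auto simp: cramer_unit)
  then show ?thesis using b by (simp add: schur_def)
qed

text \<open>Multiplied by \<open>\<Delta>\<close>, the bordered matrix factors as \<open>L N\<close>: the columns of \<open>L\<close> are the first \<open>q\<close> columns of
  the bordered matrix and a unit vector, and \<open>N\<close> is upper triangular with the Cramer solutions above
  and the Schur complement in the corner.  The determinants are \<open>\<Delta>\<close> and \<open>\<Delta>\<^sup>q schur a b\<close>.\<close>

lemma schur_eq_minor: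
  assumes nz: "minor X q id id \<noteq> 0"
  shows "schur a b = minor X (Suc q) (border q a) (border q b)"
proof -
  let ?\<rho> = "border q a" and ?\<kappa> = "border q b"
  define L where "L = mat (Suc q) (Suc q) (\<lambda>(x, y). if y < q then X (?\<rho> x, y) else if x = q then 1 else 0)"
  define N where "N = mat (Suc q) (Suc q) (\<lambda>(x, y). if x < q then cramer x (?\<kappa> y) else if y < q then 0 else schur a b)"
  define M where "M = mat (Suc q) (Suc q) (\<lambda>(x, y). X (?\<rho> x, ?\<kappa> y))"
  have carr: "L \<in> carrier_mat (Suc q) (Suc q)" "N \<in> carrier_mat (Suc q) (Suc q)" "M \<in> carrier_mat (Suc q) (Suc q)"
    by (simp_all add: L_def N_def M_def)
  have "L * N = \<Delta> \<cdot>\<^sub>m M"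
  proof (rule eq_matI)
    fix x y assume "x < dim_row (\<Delta> \<cdot>\<^sub>m M)" "y < dim_col (\<Delta> \<cdot>\<^sub>m M)"
    then have xy: "x < Suc q" "y < Suc q" by (simp_all add: M_def)
    have "(L * N) $$ (x, y) = (\<Sum>i<Suc q. L $$ (x, i) * N $$ (i, y))"
      using xy by (simp add: L_def N_def scalar_prod_def atLeast0LessThan del: sum.lessThan_Suc)
    also have "\<dots> = (\<Sum>i<q. L $$ (x, i) * N $$ (i, y)) + L $$ (x, q) * N $$ (q, y)"
      by simp
    also have "(\<Sum>i<q. L $$ (x, i) * N $$ (i, y)) = (\<Sum>i<q. X (?\<rho> x, i) * cramer i (?\<kappa> y))"
      using xy by (intro sum.cong) (auto simp: L_def N_def)
    also have "\<dots> + L $$ (x, q) * N $$ (q, y) = \<Delta> * X (?\<rho> x, ?\<kappa> y)"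
    proof (cases "x < q")
      case True
      then show ?thesis using xy by (simp add: L_def border_def cramer_solves \<Delta>_def)
    next
      case False
      then have "x = q" using xy by simp
      show ?thesis
      proof (cases "y < q")
        case True
        then show ?thesis using \<open>x = q\<close> schur_eq_0[of y a] by (simp add: L_def N_def border_def schur_def \<Delta>_def)
      next
        case False
        then show ?thesis using \<open>x = q\<close> xy by (simp add: L_def N_def border_def schur_def \<Delta>_def)
      qed
    qed
    finally show "(L * N) $$ (x, y) = (\<Delta> \<cdot>\<^sub>m M) $$ (x, y)" using xy by (simp add: M_def)
  qed (simp_all add: L_def N_def M_def)
  then have "det L * det N = \<Delta> ^ Suc q * det M"
    using det_mult[OF carr(1,2)] carr(3) by simp
  moreover have "det L = \<Delta>"
  proof -
    have "det L = (\<Sum>i<Suc q. L $$ (i, q) * cofactor L i q)"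
      by (rule laplace_expansion_column[OF carr(1)]) simp
    also have "\<dots> = cofactor L q q" by (simp add: L_def)
    also have "\<dots> = det (mat_delete L q q)" by (simp add: cofactor_def)
    also have "mat_delete L q q = A"
      by (rule eq_matI) (auto simp: mat_delete_def L_def A_def border_def)
    finally show ?thesis by (simp add: det_A)
  qed
  moreover have "det N = \<Delta> ^ q * schur a b"
  proof -
    have "upper_triangular N"
      by (rule upper_triangularI) (auto simp: N_def border_def cramer_unit)
    then have "det N = (\<Prod>i<Suc q. N $$ (i, i))"
      using det_upper_triangular[OF _ carr(2)] carr(2) by (simp add: prod_list_diag_prod atLeast0LessThan del: prod.lessThan_Suc)
    also have "\<dots> = (\<Prod>i<q. \<Delta>) * schur a b"
      by (simp add: N_def border_def cramer_unit \<Delta>_def)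
    finally show ?thesis by simp
  qed
  ultimately have "\<Delta> ^ Suc q * schur a b = \<Delta> ^ Suc q * det M" by (simp add: mult.assoc)
  then show ?thesis using nz by (simp add: \<Delta>_def M_def minor_def)
qed

end

text \<open>The diagonal arc at \<open>t = 0\<close> has an identity block of size \<open>q\<close>.\<close>

lemma leading_minor_not_vanishing:
  assumes "s \<le> q" "q \<le> r"
  shows "\<not> vanishes r q 1 (gen_minor s id id :: 'k::field_char_0 mpoly)"
proof
  assume "vanishes r q 1 (gen_minor s id id :: 'k mpoly)"
  then have "(0 :: 'k mpoly) ^ 1 dvd poly_eval Const (factored r (\<lambda>a i. if a = i then 1 else 0)
      (tail_scale q 0 (\<lambda>_. 1)) (\<lambda>a i. if a = i then 1 else 0)) (gen_minor s id id)"
    by (rule vanishes_specialize[OF Const_hom])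
  then show False using assms by (simp add: leading_minor_specialize[OF _ _ Const_hom])
qed

lemma vanishes_leading_minor_iff:
  assumes "s \<le> r" "q \<le> r"
  shows "vanishes r q N (gen_minor s id id :: 'k::field_char_0 mpoly) \<longleftrightarrow> N \<le> s - q"
proof
  assume "vanishes r q N (gen_minor s id id :: 'k mpoly)"
  then have "[:0, 1:] ^ N dvd poly_eval (\<lambda>c. [:c:]) (factored r (\<lambda>a i. if a = i then 1 else 0)
      (tail_scale q [:0, 1:] (\<lambda>_. 1)) (\<lambda>a i. if a = i then 1 else 0)) (gen_minor s id id :: 'k mpoly)"
    by (rule vanishes_specialize[OF comm_ring_hom_const_poly])
  then have "[:0, 1:] ^ N dvd ([:0, 1:] ^ (s - q) :: 'k poly)"
    by (simp only: leading_minor_specialize[OF assms comm_ring_hom_const_poly])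
  then show "N \<le> s - q"
    by (metis dvd_power_le degree_linear_power dvd_imp_degree_le one_neq_zero pCons_eq_0_iff power_not_zero)
next
  assume "N \<le> s - q"
  then show "vanishes r q N (gen_minor s id id :: 'k mpoly)"
    using vanishes_gen_minor[OF assms(2)] vanishes_mono by blast
qed

text \<open>Gaussian elimination factors the generic matrix over the ring with \<open>\<Delta>\<close>, the leading \<open>q\<close>-minor,
  inverted: the first \<open>q\<close> terms have numerators in the whole ring, and the other terms involve
  Schur complements, which are \<open>(q+1)\<close>-minors divided by \<open>\<Delta>\<close>.  With \<open>t\<close> attached to the latter, the
  coefficient of \<open>t\<^sup>i\<close> in \<open>f\<close> lies in \<open>D\<^bsub>q+1\<^esub>\<^sup>i\<close> up to a power of \<open>\<Delta>\<close>; the coefficients below \<open>N\<close>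
  vanish by hypothesis, and \<open>t = 1\<close> returns \<open>f\<close>.\<close>

theorem vanishes_imp_symbolic:
  fixes f :: "'k::field_char_0 mpoly"
  assumes q: "q < r" and rn: "r \<le> n" and f: "f \<in> RR r n" and v: "vanishes r q N f"
  shows "\<exists>s\<in>RR r n. \<not> vanishes r q 1 s \<and> s * f \<in> ideal_power r n (D_ideal r n (Suc q)) N"
proof -
  let ?X = "\<lambda>(a, b). Var a b :: 'k mpoly"
  let ?t = "to_fract :: 'k mpoly \<Rightarrow> _"
  define \<Delta> :: "'k mpoly" where "\<Delta> = gen_minor q id id"
  define D :: "'k mpoly set" where "D = D_ideal r n (Suc q)"
  have D: "ideal D (coord_ring r n)" unfolding D_def by (rule ideal_D_ideal)
  note Dp = ideal_coord_ringD[OF ideal_ideal_power[OF D]]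
  have \<Delta>R: "\<Delta> \<in> RR r n" unfolding \<Delta>_def by (rule gen_minor_RR) (use q rn in auto)
  have \<Delta>v: "\<not> vanishes r q 1 \<Delta>" unfolding \<Delta>_def by (rule leading_minor_not_vanishing) (use q in auto)
  then have \<Delta>0: "\<Delta> \<noteq> 0" by auto
  have adjR: "adj_mat (mat q q ?X) $$ (i, l) \<in> RR r n" if "i < q" "l < q" for i l
  proof -
    have "mat_delete (mat q q ?X) l i = mat (q - 1) (q - 1) (\<lambda>(x, y). Var (insert_index l x) (insert_index i y))"
      by (rule eq_matI) (use that in \<open>auto simp: mat_delete_def insert_index_def\<close>)
    moreover have "det (mat (q - 1) (q - 1) (\<lambda>(x, y). Var (insert_index l x) (insert_index i y) :: 'k mpoly)) \<in> RR r n"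
      by (rule RR_det, rule RR_Var) (use that q rn in \<open>auto simp: insert_index_def\<close>)
    ultimately show ?thesis
      using that by (simp add: adj_mat_def cofactor_def RR_mult RR_power RR_uminus)
  qed
  have cramerR: "cramer q ?X i b \<in> RR r n" if "i < q" "b < n" for i b
    unfolding cramer_def using that q by (intro RR_sum RR_mult adjR) auto
  have schurD: "schur q ?X a b \<in> D" if "q \<le> a" "a < r" "b < n" for a b
  proof (cases "b < q")
    case True
    then show ?thesis using ideal_coord_ringD(2)[OF D] by (simp add: schur_eq_0)
  next
    case False
    have "schur q ?X a b = gen_minor (Suc q) (border q a) (border q b)"
      by (rule schur_eq_minor) (use \<Delta>0 in \<open>simp add: \<Delta>_def\<close>)
    also have "\<dots> \<in> D" unfolding D_def
      by (rule gen_minor_in_D) (use False that q rn in \<open>auto simp: border_def inj_on_def\<close>)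
    finally show ?thesis .
  qed
  \<comment> \<open>Fractions with numerator in the \<open>i\<close>-th power of \<open>D\<close> and a power of \<open>\<Delta>\<close> as denominator.\<close>
  define L where "L i = {x. \<exists>M a. a \<in> ideal_power r n D i \<and> ?t (\<Delta> ^ M) * x = ?t a}" for i
  have L_add: "x + y \<in> L i" if xy: "x \<in> L i" "y \<in> L i" for x y i
  proof -
    obtain M a M' a' where *: "a \<in> ideal_power r n D i" "?t (\<Delta> ^ M) * x = ?t a"
      "a' \<in> ideal_power r n D i" "?t (\<Delta> ^ M') * y = ?t a'" using xy by (auto simp: L_def)
    have "?t (\<Delta> ^ (M + M')) * (x + y) = ?t (\<Delta> ^ M') * (?t (\<Delta> ^ M) * x) + ?t (\<Delta> ^ M) * (?t (\<Delta> ^ M') * y)"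
      by (simp add: power_add algebra_simps)
    also have "\<dots> = ?t (\<Delta> ^ M' * a + \<Delta> ^ M * a')" by (simp only: * to_fract_mult to_fract_add)
    finally show ?thesis unfolding L_def
      using Dp(3)[OF Dp(4)[OF RR_power[OF \<Delta>R] *(1)] Dp(4)[OF RR_power[OF \<Delta>R] *(3)]] by blast
  qed
  have L_mult: "x * y \<in> L (i + k)" if xy: "x \<in> L i" "y \<in> L k" for x y i k
  proof -
    obtain M a M' a' where *: "a \<in> ideal_power r n D i" "?t (\<Delta> ^ M) * x = ?t a"
      "a' \<in> ideal_power r n D k" "?t (\<Delta> ^ M') * y = ?t a'" using xy by (auto simp: L_def)
    have "?t (\<Delta> ^ (M + M')) * (x * y) = (?t (\<Delta> ^ M) * x) * (?t (\<Delta> ^ M') * y)"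
      by (simp add: power_add algebra_simps)
    also have "\<dots> = ?t (a * a')" by (simp only: * to_fract_mult)
    finally show ?thesis unfolding L_def using ideal_power_mult[OF D *(1,3)] by blast
  qed
  have L_0: "0 \<in> L i" for i
    unfolding L_def using Dp(2) by (intro CollectI exI[of _ 0]) auto
  have L_sum: "sum F S \<in> L i" if "\<And>x. x \<in> S \<Longrightarrow> F x \<in> L i" for F i and S :: "'z set"
    using that by (induction S rule: infinite_finite_induct) (auto intro: L_add L_0)
  have L_RR: "?t a \<in> L 0" if "a \<in> RR r n" for a
    unfolding L_def using that by (intro CollectI exI[of _ 0] exI[of _ a]) (simp add: ideal_power_0)
  have L_div: "?t a / ?t \<Delta> \<in> L i" if "a \<in> ideal_power r n D i" for a i
    unfolding L_def using that \<Delta>0 by (intro CollectI exI[of _ 1] exI[of _ a]) simp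
  \<comment> \<open>The polynomials in \<open>t\<close> whose coefficients respect this filtration form a subring.\<close>
  define G where "G = {Q. \<forall>i. coeff Q i \<in> L i}"
  have G_add: "P + Q \<in> G" if "P \<in> G" "Q \<in> G" for P Q
    using that by (auto simp: G_def intro: L_add)
  have G_mult: "P * Q \<in> G" if PQ: "P \<in> G" "Q \<in> G" for P Q
  proof -
    have "coeff P i * coeff Q (k - i) \<in> L k" if "i \<le> k" for i k
      using L_mult[of "coeff P i" i "coeff Q (k - i)" "k - i"] PQ that by (simp add: G_def)
    then show ?thesis by (auto simp: G_def coeff_mult intro!: L_sum)
  qed
  have G_const: "[:x:] \<in> G" if "x \<in> L 0" for x
    using that L_0 by (auto simp: G_def coeff_pCons split: nat.split)
  have G_sum: "sum F S \<in> G" if "\<And>x. x \<in> S \<Longrightarrow> F x \<in> G" for F and S :: "'z set"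
    using that G_const[OF L_0] by (induction S rule: infinite_finite_induct) (auto intro: G_add)
  have G_1: "1 \<in> G" using G_const[OF L_RR[OF RR_1]] by (simp add: one_pCons)
  have G_pow: "Q ^ k \<in> G" if "Q \<in> G" for Q k
    using that G_1 by (induction k) (auto intro: G_mult)
  have G_prod: "prod F S \<in> G" if "\<And>x. x \<in> S \<Longrightarrow> F x \<in> G" for F and S :: "'z set"
    using that G_1 by (induction S rule: infinite_finite_induct) (auto intro: G_mult)
  \<comment> \<open>The factors of the elimination; the rows of \<open>W\<close> from \<open>q\<close> on form the Schur complement.\<close>
  define U where "U a i = (if i < q then ?t (Var a i) else if a = i then 1 else 0)" for a i
  define W where "W i b = ?t (if i < q then cramer q ?X i b else schur q ?X i b) / ?t \<Delta>" for i b
  let ?T = "tail_scale q [:0, 1:] (\<lambda>_. 1)"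
  let ?F = "factored r (\<lambda>a i. [:U a i:]) ?T (\<lambda>i b. [:W i b:])"
  let ?\<kappa> = "\<lambda>c. [:?t (Const c):]"
  have \<kappa>: "comm_ring_hom ?\<kappa>"
    by (rule comm_ring_hom_comp[OF comm_ring_hom_const_poly comm_ring_hom_comp[OF comm_ring_hom_to_fract Const_hom]])
  define P where "P = poly_eval ?\<kappa> ?F f"
  have "[:0, 1:] ^ N dvd P" unfolding P_def by (rule vanishes_specialize[OF \<kappa> v])
  then have P0: "coeff P i = 0" if "i < N" for i
    using that monom_1_dvd_iff'[of N P] by (simp add: monom_altdef)
  have FG: "?F (a, b) \<in> G" if ab: "a < r" "b < n" for a b
  proof -
    have "[:U a i:] * ?T i * [:W i b:] \<in> G" if i: "i < r" for i
    proof (cases "i < q")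
      case True
      then have "U a i * W i b \<in> L (0 + 0)"
        using ab i q rn by (intro L_mult) (auto simp: U_def W_def ideal_power_0 intro!: L_RR L_div cramerR)
      then have "[:U a i * W i b:] \<in> G" by (intro G_const) simp
      then show ?thesis using True by (simp add: tail_scale_def mult.commute)
    next
      case False
      have "W i b \<in> L 1" using False i ab schurD[of i b] ideal_power_1[OF D] by (auto simp: W_def intro!: L_div)
      moreover have "U a i \<in> L 0" using False L_RR[OF RR_1] L_0 by (auto simp: U_def)
      ultimately have "U a i * W i b \<in> L 1" using L_mult[of "U a i" 0 "W i b" 1] by simp
      then have "[:0, U a i * W i b:] \<in> G" using L_0 by (auto simp: G_def coeff_pCons split: nat.split)
      then show ?thesis using False by (simp add: tail_scale_def mult.commute)
    qed
    then show ?thesis unfolding factored_def prod.case by (intro G_sum) auto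
  qed
  have "P \<in> G" unfolding P_def poly_eval_def monom_eval_def
  proof (intro G_sum G_mult G_const L_RR RR_Const G_prod G_pow)
    fix u v assume "u \<in> Poly_Mapping.keys f" "v \<in> Poly_Mapping.keys u"
    then have "v \<in> {..<r} \<times> {..<n}" using f by (auto simp: RR_iff)
    then show "?F v \<in> G" using FG by (cases v) auto
  qed
  have "poly P 1 = poly_eval (\<lambda>c. ?t (Const c)) (\<lambda>v. poly (?F v) 1) f"
    unfolding P_def by (subst hom_poly_eval[OF \<kappa> comm_ring_hom_poly]) simp
  also have "\<dots> = poly_eval (\<lambda>c. ?t (Const c)) (\<lambda>v. ?t (?X v)) f"
  proof (rule poly_eval_cong[OF f])
    fix a b assume ab: "a < r" "b < n"
    have "poly (?F (a, b)) 1 = (\<Sum>i<r. U a i * W i b)"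
      by (simp add: factored_def poly_sum tail_scale_def if_distrib[of "\<lambda>p. poly p 1"] cong: if_cong)
         (intro sum.cong refl, simp)
    also have "\<dots> = (\<Sum>i<q. U a i * W i b) + (\<Sum>i\<in>{q..<r}. U a i * W i b)"
      using sum.atLeastLessThan_concat[of 0 q r "\<lambda>i. U a i * W i b"] q by (simp add: atLeast0LessThan)
    also have "(\<Sum>i<q. U a i * W i b) = ?t (\<Sum>i<q. Var a i * cramer q ?X i b) / ?t \<Delta>"
      by (simp add: U_def W_def sum_divide_distrib)
    also have "(\<Sum>i\<in>{q..<r}. U a i * W i b) = (if q \<le> a then ?t (schur q ?X a b) / ?t \<Delta> else 0)"
    proof -
      have "(\<Sum>i\<in>{q..<r}. U a i * W i b) = (\<Sum>i\<in>{q..<r}. if a = i then ?t (schur q ?X a b) / ?t \<Delta> else 0)"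
        by (rule sum.cong) (auto simp: U_def W_def)
      then show ?thesis using ab by simp
    qed
    also have "?t (\<Sum>i<q. Var a i * cramer q ?X i b) / ?t \<Delta> + (if q \<le> a then ?t (schur q ?X a b) / ?t \<Delta> else 0)
        = ?t (\<Delta> * Var a b) / ?t \<Delta>"
    proof (cases "q \<le> a")
      case True
      have "(\<Sum>i<q. Var a i * cramer q ?X i b) + schur q ?X a b = \<Delta> * Var a b"
        by (simp add: schur_def \<Delta>_def)
      then show ?thesis using True by (simp only: if_True add_divide_distrib[symmetric] to_fract_add[symmetric])
    next
      case False
      then have "(\<Sum>i<q. Var a i * cramer q ?X i b) = \<Delta> * Var a b"
        using cramer_solves[of a q ?X b] by (simp add: \<Delta>_def)
      then show ?thesis using False by (simp only: if_False add_0_right)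
    qed
    also have "\<dots> = ?t (Var a b)" using \<Delta>0 by simp
    finally show "poly (?F (a, b)) 1 = ?t (?X (a, b))" by simp
  qed
  also have "\<dots> = ?t f"
    using hom_poly_eval[OF Const_hom comm_ring_hom_to_fract, of ?X f] by (simp add: poly_eval_identity)
  finally have "?t f = (\<Sum>i\<le>degree P. coeff P i)" by (simp add: poly_altdef)
  also have "\<dots> \<in> L N"
  proof (rule L_sum)
    fix i assume "i \<in> {..degree P}"
    show "coeff P i \<in> L N"
    proof (cases "i < N")
      case True
      then show ?thesis using P0 L_0 by simp
    next
      case False
      have "coeff P i \<in> L i" using \<open>P \<in> G\<close> by (simp add: G_def)
      then obtain M a where "a \<in> ideal_power r n D i" "?t (\<Delta> ^ M) * coeff P i = ?t a"
        by (auto simp: L_def)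
      moreover from this have "a \<in> ideal_power r n D N"
        using False by (intro ideal_power_antimono[OF D, of N i]) auto
      ultimately show ?thesis unfolding L_def by blast
    qed
  qed
  finally obtain M a where Ma: "a \<in> ideal_power r n D N" "?t (\<Delta> ^ M) * ?t f = ?t a" by (auto simp: L_def)
  have "?t (\<Delta> ^ M * f) = ?t a" using Ma(2) by simp
  then have "\<Delta> ^ M * f = a" by (simp only: to_fract_eq_iff)
  moreover have "\<not> vanishes r q 1 (\<Delta> ^ M)"
    by (induction M) (use \<Delta>v in \<open>auto simp only: power_0 power_Suc not_vanishes_1_one vanishes_1_mult\<close>)
  ultimately show ?thesis using Ma(1) RR_power[OF \<Delta>R] unfolding D_def by blast
qed

theorem gamma_poly_eq_locus_order:
  fixes f :: "'k::field_char_0 mpoly"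
  assumes "1 \<le> j" "j \<le> r" "r \<le> n" "f \<in> RR r n" "f \<noteq> 0"
  shows "gamma_poly r n j f = locus_order r (j - 1) f"
proof -
  have D: "D_ideal r n j = {f \<in> RR r n. vanishes r (j - 1) 1 f}"
    by (rule D_ideal_eq_vanishing[OF assms(1,2)])
  have "f \<in> gen_symbolic_power r n j (D_ideal r n j) i \<longleftrightarrow> i \<le> locus_order r (j - 1) f" for i
  proof
    assume "f \<in> gen_symbolic_power r n j (D_ideal r n j) i"
    then obtain s where s: "s \<in> RR r n" "\<not> vanishes r (j - 1) 1 s" "s * f \<in> ideal_power r n (D_ideal r n j) i"
      unfolding gen_symbolic_power_iff[OF assms(1,2) ideal_D_ideal] by auto
    have "vanishes r (j - 1) (i * 1) (s * f)"
      by (rule ideal_power_vanishes[OF _ s(3)]) (simp add: D)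
    then have "vanishes r (j - 1) i f" using vanishes_cancel[OF s(1) assms(4) s(2)] by simp
    then show "i \<le> locus_order r (j - 1) f" using vanishes_iff_le_order[OF assms(4,5)] by simp
  next
    assume "i \<le> locus_order r (j - 1) f"
    then have "vanishes r (j - 1) i f" using vanishes_iff_le_order[OF assms(4,5)] by simp
    then show "f \<in> gen_symbolic_power r n j (D_ideal r n j) i"
      unfolding gen_symbolic_power_iff[OF assms(1,2) ideal_D_ideal]
      using vanishes_imp_symbolic[of "j - 1" r n f i] assms by simp
  qed
  then have "{i. f \<in> gen_symbolic_power r n j (D_ideal r n j) i} = {..locus_order r (j - 1) f}"
    by auto
  then show ?thesis unfolding gamma_poly_def by (simp add: Max_eq_iff)
qed

section \<open>Torus weights and the comparison of orders\<close>

lemma map_poly_hom_const: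
  assumes "comm_ring_hom \<phi>" shows "map_poly \<phi> [:x:] = [:\<phi> x:]"
proof -
  interpret \<phi>: comm_ring_hom \<phi> by fact
  show ?thesis by (simp add: monom_0[symmetric] map_poly_monom)
qed

lemma map_poly_hom_monom:
  assumes "comm_ring_hom \<phi>" shows "map_poly \<phi> (monom x k) = monom (\<phi> x) k"
proof -
  interpret \<phi>: comm_ring_hom \<phi> by fact
  show ?thesis by (simp add: map_poly_monom)
qed

lemma sum_monom: "(\<Sum>i\<in>A. monom (F i) k) = monom (\<Sum>i\<in>A. F i) k"
  by (rule poly_eqI) (simp add: coeff_sum coeff_monom)

definition monom_weight :: "(nat \<times> nat \<Rightarrow> nat) \<Rightarrow> monomial \<Rightarrow> nat" where
  "monom_weight w u = (\<Sum>v\<in>Poly_Mapping.keys u. Poly_Mapping.lookup u v * w v)"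

text \<open>Collects the terms of weight \<open>i\<close> in the coefficient of \<open>t\<^sup>i\<close>.\<close>

definition grade :: "(nat \<times> nat \<Rightarrow> nat) \<Rightarrow> 'k::field_char_0 mpoly \<Rightarrow> 'k mpoly poly" where
  "grade w = poly_eval (\<lambda>c. [:Const c:]) (\<lambda>(x, y). monom (Var x y) (w (x, y)))"

lemma monom_eval_grade:
  "monom_eval (\<lambda>(x, y). monom (Var x y) (w (x, y))) u
    = (monom (Poly_Mapping.single u 1) (monom_weight w u) :: 'k::field_char_0 mpoly poly)"
proof -
  have pm: "(\<Prod>v\<in>B. monom (F v) (e v)) = monom (prod F B) (sum e B)"
    if "finite B" for F :: "nat \<times> nat \<Rightarrow> 'k mpoly" and e :: "nat \<times> nat \<Rightarrow> nat" and B
    using that by (induction B) (simp_all add: mult_monom)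
  have "(\<Prod>v\<in>Poly_Mapping.keys u. monom (Var (fst v) (snd v) ^ Poly_Mapping.lookup u v) (Poly_Mapping.lookup u v * w v))
     = (monom (\<Prod>v\<in>Poly_Mapping.keys u. Var (fst v) (snd v) ^ Poly_Mapping.lookup u v)
         (\<Sum>v\<in>Poly_Mapping.keys u. Poly_Mapping.lookup u v * w v) :: 'k mpoly poly)"
    by (rule pm) simp
  then have "monom_eval (\<lambda>(x, y). monom (Var x y) (w (x, y))) u =
     (monom (monom_eval (\<lambda>(x, y). Var x y) u) (monom_weight w u) :: 'k mpoly poly)"
    by (simp add: monom_eval_def monom_weight_def monom_power split_def mult.commute)
  moreover have "(\<lambda>(x, y). Var x y) = (\<lambda>v. Poly_Mapping.single (Poly_Mapping.single v 1) (1 :: 'k))"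
    by (auto simp: Var_def)
  ultimately show ?thesis by (simp only: monom_eval_Var)
qed

lemma lookup_coeff_grade:
  "Poly_Mapping.lookup (coeff (grade w F) i) u = (if monom_weight w u = i then Poly_Mapping.lookup F u else 0)"
proof -
  have "grade w F = (\<Sum>u\<in>Poly_Mapping.keys F. monom (Poly_Mapping.single u (Poly_Mapping.lookup F u)) (monom_weight w u))"
    unfolding grade_def poly_eval_def monom_eval_grade
    by (intro sum.cong refl) (simp add: Const_def smult_monom mult_single)
  then have "Poly_Mapping.lookup (coeff (grade w F) i) u = (\<Sum>x\<in>Poly_Mapping.keys F.
      Poly_Mapping.lookup (coeff (monom (Poly_Mapping.single x (Poly_Mapping.lookup F x)) (monom_weight w x)) i) u)"
    by (simp add: coeff_sum lookup_sum)
  also have "\<dots> = (\<Sum>x\<in>Poly_Mapping.keys F.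
      if x = u then (if monom_weight w u = i then Poly_Mapping.lookup F u else 0) else 0)"
    by (intro sum.cong refl) (auto simp: coeff_monom lookup_single when_def)
  finally show ?thesis by (simp add: in_keys_iff)
qed

lemma X_power_dvd_iff: "[:0, 1:] ^ N dvd (P :: 'a::comm_ring_1 poly) \<longleftrightarrow> (\<forall>i<N. coeff P i = 0)"
  using monom_1_dvd_iff'[of N P] by (simp add: monom_altdef)

lemma power_dvd_grade_iff:
  "[:0, 1:] ^ N dvd grade w F \<longleftrightarrow> (\<forall>u\<in>Poly_Mapping.keys F. N \<le> monom_weight w u)"
proof -
  have "(\<forall>i<N. coeff (grade w F) i = 0) \<longleftrightarrow> (\<forall>i<N. \<forall>u. monom_weight w u = i \<longrightarrow> Poly_Mapping.lookup F u = 0)"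
    by (simp add: poly_mapping_eq_iff fun_eq_iff lookup_coeff_grade)
  also have "\<dots> \<longleftrightarrow> (\<forall>u\<in>Poly_Mapping.keys F. N \<le> monom_weight w u)"
    by (auto simp: in_keys_iff not_less[symmetric])
  finally show ?thesis by (simp only: X_power_dvd_iff)
qed

lemma grade_hom: "comm_ring_hom (grade w)"
  unfolding grade_def by (rule poly_eval_hom[OF comm_ring_hom_const_const])

lemma grade_Var: "grade w (Var x y) = monom (Var x y) (w (x, y))"
  by (simp add: grade_def poly_eval_Var[OF comm_ring_hom_const_const])

lemma grade_Const: "grade w (Const c) = [:Const c:]"
  by (simp add: grade_def poly_eval_Const[OF comm_ring_hom_const_const])

definition torus_expansion :: "nat \<Rightarrow> 'k::field_char_0 mpoly \<Rightarrow> 'k mpoly" where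
  "torus_expansion r = poly_eval Const (factored r genU gend genW)"

text \<open>The weight of a monomial is its degree in the \<open>d\<^sub>i\<close> with \<open>i \<in> S\<close>.\<close>

definition torus_weight :: "nat set \<Rightarrow> nat \<times> nat \<Rightarrow> nat" where
  "torus_weight S = (\<lambda>(x, y). if x mod 3 = 1 \<and> x div 3 \<in> S then 1 else 0)"

lemma grade_torus_expansion:
  fixes f :: "'k::field_char_0 mpoly"
  shows "grade (torus_weight S) (torus_expansion r f) = poly_eval (\<lambda>c. [:Const c:])
     (factored r (\<lambda>a i. [:genU a i:]) (\<lambda>i. if i \<in> S then [:0, 1:] * [:gend i:] else [:gend i:])
        (\<lambda>i b. [:genW i b:])) f"
proof -
  interpret g: comm_ring_hom "grade (torus_weight S) :: 'k mpoly \<Rightarrow> _" by (rule grade_hom)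
  have mods: "(3 * a) mod 3 \<noteq> Suc 0" "Suc (3 * a) mod 3 = Suc 0" "Suc (Suc (3 * a)) mod 3 \<noteq> Suc 0"
     "Suc (3 * a) div 3 = a" for a :: nat by presburger+
  have 1: "grade (torus_weight S) (genU a i) = [:genU a i :: 'k mpoly:]"
    "grade (torus_weight S) (gend i) = (if i \<in> S then [:0, 1:] * [:gend i:] else [:gend i :: 'k mpoly:])"
    "grade (torus_weight S) (genW i b) = [:genW i b :: 'k mpoly:]" for a i b
    by (simp_all add: genU_def gend_def genW_def grade_Var torus_weight_def mods monom_0 monom_Suc)
  have "grade (torus_weight S) (factored r genU gend genW v) = factored r (\<lambda>a i. [:genU a i :: 'k mpoly:])
      (\<lambda>i. if i \<in> S then [:0, 1:] * [:gend i:] else [:gend i:]) (\<lambda>i b. [:genW i b:]) v" for v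
    by (cases v) (simp only: factored_def prod.case g.hom_sum g.hom_mult 1)
  then have "(\<lambda>v. grade (torus_weight S) (factored r genU gend genW v)) = factored r (\<lambda>a i. [:genU a i :: 'k mpoly:])
      (\<lambda>i. if i \<in> S then [:0, 1:] * [:gend i:] else [:gend i:]) (\<lambda>i b. [:genW i b:])" by (rule ext)
  then show ?thesis
    unfolding torus_expansion_def
    by (subst hom_poly_eval[OF Const_hom grade_hom]) (simp only: grade_Const)
qed

text \<open>So the order at rank \<open>q\<close> is the least total degree in \<open>d\<^sub>q, \<dots>, d\<^bsub>r-1\<^esub>\<close> among the monomials of
  \<open>f(U diag(d) W)\<close>.\<close>

lemma degenerate_eq_grade:
  "degenerate r q f = grade (torus_weight {q..<r}) (torus_expansion r f)"
proof -
  have "factored r U (tail_scale q t d) W = factored r U (\<lambda>i. if i \<in> {q..<r} then t * d i else d i) W"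
    for U :: "nat \<Rightarrow> nat \<Rightarrow> 'a mpoly poly" and t d W
    unfolding factored_def by (intro ext, clarify, intro sum.cong) (auto simp: tail_scale_def)
  then show ?thesis unfolding degenerate_def grade_torus_expansion by simp
qed

text \<open>Permuting the columns of \<open>U\<close>, the entries of \<open>d\<close> and the rows of \<open>W\<close> simultaneously does not change
  the product, so the parameter \<open>t\<close> may be attached to any \<open>r - q\<close> of the diagonal entries.\<close>

lemma vanishes_permuted:
  fixes f :: "'k::field_char_0 mpoly"
  assumes v: "vanishes r q N f" and S: "S \<subseteq> {..<r}" "card S = r - q" "q \<le> r"
  shows "[:0, 1:] ^ N dvd grade (torus_weight S) (torus_expansion r f)"
proof -
  have "card {q..<r} = card S" using S by simp
  moreover have "finite S" using S(1) finite_subset by blast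
  ultimately obtain \<pi>1 where p1: "bij_betw \<pi>1 {q..<r} S"
    using finite_same_card_bij[of "{q..<r}" S] by auto
  have "card {..<q} = card ({..<r} - S)" using S \<open>finite S\<close> by (simp add: card_Diff_subset)
  then obtain \<pi>2 where p2: "bij_betw \<pi>2 {..<q} ({..<r} - S)"
    using finite_same_card_bij[of "{..<q}" "{..<r} - S"] by auto
  \<comment> \<open>A permutation of all indices that sends the last \<open>r - q\<close> of them onto \<open>S\<close>.\<close>
  define \<pi> where "\<pi> i = (if i < q then \<pi>2 i else \<pi>1 i)" for i
  have b1: "bij_betw \<pi> {q..<r} S" using p1 by (subst bij_betw_cong[of _ _ \<pi>1]) (auto simp: \<pi>_def)
  have b2: "bij_betw \<pi> {..<q} ({..<r} - S)" using p2 by (subst bij_betw_cong[of _ _ \<pi>2]) (auto simp: \<pi>_def)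
  have "bij_betw \<pi> ({..<q} \<union> {q..<r}) (({..<r} - S) \<union> S)"
    by (rule bij_betw_combine[OF b2 b1]) auto
  moreover have "{..<q} \<union> {q..<r} = {..<r}" "({..<r} - S) \<union> S = {..<r}" using S by auto
  ultimately have b: "bij_betw \<pi> {..<r} {..<r}" by simp
  have inS: "\<pi> i \<in> S \<longleftrightarrow> q \<le> i" if "i < r" for i
    using bij_betw_apply[OF b1, of i] bij_betw_apply[OF b2, of i] that by (cases "q \<le> i") auto
  let ?d = "\<lambda>i. if i \<in> S then [:0, 1:] * [:gend i:] else [:gend i :: 'k mpoly:]"
  let ?U = "\<lambda>a i. [:genU a (\<pi> i) :: 'k mpoly:]" and ?W = "\<lambda>i b. [:genW (\<pi> i) b :: 'k mpoly:]"
  have "factored r (\<lambda>a i. [:genU a i:]) ?d (\<lambda>i b. [:genW i b:])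
      = factored r ?U (tail_scale q [:0, 1:] (\<lambda>i. [:gend (\<pi> i):])) ?W"
  proof (rule ext, clarify)
    fix a b
    have "(\<Sum>i<r. [:genU a i:] * ?d i * [:genW i b:]) = (\<Sum>i<r. [:genU a (\<pi> i):] * ?d (\<pi> i) * [:genW (\<pi> i) b:])"
      by (rule sum.reindex_bij_betw[OF \<open>bij_betw \<pi> {..<r} {..<r}\<close>, symmetric])
    also have "\<dots> = (\<Sum>i<r. ?U a i * tail_scale q [:0, 1:] (\<lambda>i. [:gend (\<pi> i):]) i * ?W i b)"
      by (rule sum.cong) (simp_all add: inS tail_scale_def)
    finally show "factored r (\<lambda>a i. [:genU a i:]) ?d (\<lambda>i b. [:genW i b:]) (a, b)
      = factored r ?U (tail_scale q [:0, 1:] (\<lambda>i. [:gend (\<pi> i):])) ?W (a, b)"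
      by (simp only: factored_def prod.case)
  qed
  then show ?thesis
    unfolding grade_torus_expansion
    using vanishes_specialize[OF comm_ring_hom_const_const v, of "[:0, 1:]" ?U "\<lambda>i. [:gend (\<pi> i):]" ?W] by simp
qed

text \<open>Add the hypothesis over the \<open>Q\<close> cyclic windows of \<open>w\<close> consecutive indices; each index lies in
  exactly \<open>w\<close> of them.\<close>

lemma cyclic_window_average:
  fixes e :: "nat \<Rightarrow> nat"
  assumes w: "w \<le> Q" and windows: "\<And>S. S \<subseteq> {..<Q} \<Longrightarrow> card S = w \<Longrightarrow> N \<le> (\<Sum>i\<in>S. e i)"
  shows "Q * N \<le> w * (\<Sum>i<Q. e i)"
proof (cases "Q = 0")
  case False
  have win: "N \<le> (\<Sum>l<w. e ((s + l) mod Q))" if "s < Q" for s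
  proof -
    have inj: "inj_on (\<lambda>l. (s + l) mod Q) {..<w}"
    proof (rule inj_onI)
      fix x y assume xy: "x \<in> {..<w}" "y \<in> {..<w}" "(s + x) mod Q = (s + y) mod Q"
      then have "x mod Q = y mod Q" by (auto simp: nat_mod_eq_iff)
      then show "x = y" using xy w by simp
    qed
    have "N \<le> (\<Sum>i\<in>(\<lambda>l. (s + l) mod Q) ` {..<w}. e i)"
      by (rule windows) (use False inj in \<open>auto simp: card_image\<close>)
    then show ?thesis by (simp add: sum.reindex[OF inj])
  qed
  have shift: "(\<Sum>s<Q. e ((s + l) mod Q)) = (\<Sum>i<Q. e i)" for l
  proof (induction l)
    case 0
    show ?case by (rule sum.cong) auto
  next
    case (Suc l)
    obtain Q' where Q: "Q = Suc Q'" using False by (cases Q) auto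
    have "(\<Sum>s<Q. e ((s + Suc l) mod Q)) = (\<Sum>s<Q'. e ((Suc s + l) mod Q)) + e ((Q + l) mod Q)"
      by (simp add: Q)
    also have "\<dots> = e ((0 + l) mod Q) + (\<Sum>s<Q'. e ((Suc s + l) mod Q))" by simp
    also have "\<dots> = (\<Sum>s<Q. e ((s + l) mod Q))" unfolding Q sum.lessThan_Suc_shift by simp
    finally show ?case using Suc by simp
  qed
  have "Q * N = (\<Sum>s<Q. N)" by simp
  also have "\<dots> \<le> (\<Sum>s<Q. \<Sum>l<w. e ((s + l) mod Q))" using win by (intro sum_mono) simp
  also have "\<dots> = (\<Sum>l<w. \<Sum>s<Q. e ((s + l) mod Q))" by (rule sum.swap)
  also have "\<dots> = w * (\<Sum>i<Q. e i)" by (simp add: shift)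
  finally show ?thesis .
qed simp

text \<open>Take a monomial of \<open>f(U diag(d) W)\<close> for which the exponents \<open>e\<^sub>q, \<dots>, e\<^bsub>r-1\<^esub>\<close> of the \<open>d\<^sub>i\<close> have
  the least sum, the order at rank \<open>q\<close>.  By \<open>vanishes_permuted\<close> any \<open>r - p\<close> of these exponents have
  sum at least \<open>N\<close>, and averaging over such choices compares the two.\<close>

theorem locus_order_lower_bound:
  fixes f :: "'k::field_char_0 mpoly"
  assumes f: "f \<in> RR r n" "f \<noteq> 0" and v: "vanishes r p N f" and qp: "q \<le> p" "p \<le> r"
  shows "(r - q) * N \<le> (r - p) * locus_order r q f"
proof -
  define d where "d = locus_order r q f"
  have "vanishes r q d f" "\<not> vanishes r q (Suc d) f"
    using vanishes_iff_le_order[OF f, of q] by (simp_all add: d_def)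
  then obtain u where u: "u \<in> Poly_Mapping.keys (torus_expansion r f)" "monom_weight (torus_weight {q..<r}) u \<le> d"
    unfolding vanishes_def degenerate_eq_grade power_dvd_grade_iff by (auto simp: not_le less_Suc_eq_le)
  \<comment> \<open>The exponent of \<open>d\<^sub>i\<close> in the monomial.\<close>
  define e where "e i = (\<Sum>v\<in>Poly_Mapping.keys u. if fst v mod 3 = 1 \<and> fst v div 3 = i then Poly_Mapping.lookup u v else 0)" for i
  have weight: "monom_weight (torus_weight S) u = (\<Sum>i\<in>S. e i)" if "finite S" for S
  proof -
    have "(\<Sum>i\<in>S. e i) = (\<Sum>v\<in>Poly_Mapping.keys u. \<Sum>i\<in>S. if fst v mod 3 = 1 \<and> fst v div 3 = i then Poly_Mapping.lookup u v else 0)"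
      unfolding e_def by (rule sum.swap)
    also have "\<dots> = (\<Sum>v\<in>Poly_Mapping.keys u. Poly_Mapping.lookup u v * torus_weight S v)"
    proof (rule sum.cong[OF refl])
      fix v assume "v \<in> Poly_Mapping.keys u"
      show "(\<Sum>i\<in>S. if fst v mod 3 = 1 \<and> fst v div 3 = i then Poly_Mapping.lookup u v else 0)
        = Poly_Mapping.lookup u v * torus_weight S v"
        using that by (cases "fst v mod 3 = 1") (simp_all add: torus_weight_def split_def)
    qed
    finally show ?thesis by (simp add: monom_weight_def)
  qed
  have win: "N \<le> (\<Sum>i\<in>S. e i)" if "S \<subseteq> {..<r}" "card S = r - p" for S
    using vanishes_permuted[OF v that qp(2)] u(1) weight[of S] that(1) finite_subset
    unfolding power_dvd_grade_iff by fastforce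
  have "(r - q) * N \<le> (r - p) * (\<Sum>i<r - q. e (q + i))"
  proof (rule cyclic_window_average)
    fix S assume S: "S \<subseteq> {..<r - q}" "card S = r - p"
    have "N \<le> (\<Sum>i\<in>(+) q ` S. e i)"
      using S by (intro win) (auto simp: card_image)
    then show "N \<le> (\<Sum>i\<in>S. e (q + i))" by (simp add: sum.reindex)
  qed (use qp in simp)
  also have "(\<Sum>i<r - q. e (q + i)) = (\<Sum>i\<in>{q..<r}. e i)"
    using sum.shift_bounds_nat_ivl[of e 0 q "r - q"] qp by (simp add: atLeast0LessThan add.commute)
  also have "\<dots> \<le> d" using u(2) weight[of "{q..<r}"] by simp
  finally show ?thesis by (simp add: d_def)
qed

section \<open>Homogeneous polynomials\<close>

text \<open>Homogeneity as an equation between values of ring homomorphisms makes it stable under products and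
  linear substitutions.\<close>

lemma homogeneous_iff_grade:
  "homogeneous_of_degree d f \<longleftrightarrow> grade (\<lambda>_. 1) f = monom f d"
proof
  assume h: "homogeneous_of_degree d f"
  show "grade (\<lambda>_. 1) f = monom f d"
  proof (rule poly_eqI, rule poly_mapping_eqI)
    fix i u
    show "Poly_Mapping.lookup (coeff (grade (\<lambda>_. 1) f) i) u = Poly_Mapping.lookup (coeff (monom f d) i) u"
      unfolding lookup_coeff_grade coeff_monom using h
      by (cases "u \<in> Poly_Mapping.keys f")
         (auto simp: homogeneous_of_degree_def monom_weight_def in_keys_iff)
  qed
next
  assume g: "grade (\<lambda>_. 1) f = monom f d"
  show "homogeneous_of_degree d f"
    unfolding homogeneous_of_degree_def
  proof
    fix u assume u: "u \<in> Poly_Mapping.keys f"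
    have "Poly_Mapping.lookup (coeff (grade (\<lambda>_. 1) f) (monom_weight (\<lambda>_. 1) u)) u = Poly_Mapping.lookup f u"
      by (simp add: lookup_coeff_grade)
    then have "d = monom_weight (\<lambda>_. 1) u"
      using u unfolding g by (auto simp: coeff_monom in_keys_iff split: if_splits)
    then show "(\<Sum>v\<in>Poly_Mapping.keys u. Poly_Mapping.lookup u v) = d" by (simp add: monom_weight_def)
  qed
qed

lemma homogeneous_mult:
  assumes "homogeneous_of_degree d f" "homogeneous_of_degree e h"
  shows "homogeneous_of_degree (d + e) (f * h)"
proof -
  interpret g: comm_ring_hom "grade (\<lambda>_. 1) :: 'a mpoly \<Rightarrow> _" by (rule grade_hom)
  show ?thesis using assms unfolding homogeneous_iff_grade by (simp add: g.hom_mult mult_monom del: One_nat_def)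
qed

lemma homogeneous_1: "homogeneous_of_degree 0 1"
  by (simp add: homogeneous_of_degree_def)

lemma homogeneous_power:
  "homogeneous_of_degree d f \<Longrightarrow> homogeneous_of_degree (k * d) (f ^ k)"
  by (induction k) (auto simp: homogeneous_1 intro: homogeneous_mult)

lemma homogeneous_linear_subst:
  assumes f: "homogeneous_of_degree d f" "f \<in> RR r n"
    and g: "\<And>a b. a < r \<Longrightarrow> b < n \<Longrightarrow> homogeneous_of_degree 1 (g (a, b))"
  shows "homogeneous_of_degree d (poly_eval Const g f)"
proof -
  let ?\<theta> = "poly_eval Const g"
  have \<theta>: "comm_ring_hom ?\<theta>" by (rule poly_eval_hom[OF Const_hom])
  interpret t: comm_ring_hom ?\<theta> by (rule \<theta>)
  have "grade (\<lambda>_. 1) (?\<theta> f) = poly_eval (\<lambda>c. [:Const c:]) (\<lambda>v. grade (\<lambda>_. 1) (g v)) f"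
    by (subst hom_poly_eval[OF Const_hom grade_hom]) (simp only: grade_Const)
  also have "\<dots> = poly_eval (\<lambda>c. [:Const c:]) (\<lambda>v. map_poly ?\<theta> (monom (case v of (x, y) \<Rightarrow> Var x y) 1)) f"
    by (rule poly_eval_cong[OF f(2)])
       (use g in \<open>simp add: homogeneous_iff_grade map_poly_hom_monom[OF \<theta>] poly_eval_Var[OF Const_hom] del: One_nat_def\<close>)
  also have "\<dots> = map_poly ?\<theta> (grade (\<lambda>_. 1) f)"
    unfolding grade_def
    by (subst hom_poly_eval[OF comm_ring_hom_const_const comm_ring_hom_map_poly[OF \<theta>]])
       (simp add: map_poly_hom_const[OF \<theta>] poly_eval_Const[OF Const_hom] split_def del: One_nat_def)
  also have "\<dots> = monom (?\<theta> f) d"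
    using f(1) by (simp add: homogeneous_iff_grade map_poly_hom_monom[OF \<theta>] del: One_nat_def)
  finally show ?thesis by (simp add: homogeneous_iff_grade)
qed

lemma homogeneous_lin_subst:
  assumes "homogeneous_of_degree d f" "f \<in> RR r n"
  shows "homogeneous_of_degree d (lin_subst r n A B f)"
  unfolding lin_subst_def
proof (rule homogeneous_linear_subst[OF assms])
  fix a b :: nat
  interpret g: comm_ring_hom "grade (\<lambda>_. 1) :: 'a mpoly \<Rightarrow> _" by (rule grade_hom)
  show "homogeneous_of_degree 1 (case (a, b) of (a, b) \<Rightarrow>
      \<Sum>i<r. \<Sum>j<n. Const (A $$ (a, i)) * Var i j * Const (B $$ (j, b)))"
    unfolding homogeneous_iff_grade
    by (simp add: g.hom_sum g.hom_mult grade_Const grade_Var smult_monom sum_monom mult_ac del: One_nat_def)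
qed

lemma homogeneous_gen_minor: "homogeneous_of_degree s (gen_minor s \<rho> \<kappa>)"
proof -
  have "Poly_Mapping.keys (gen_minor s \<rho> \<kappa> :: 'a mpoly) \<subseteq> (\<Union>\<pi>\<in>{\<pi>. \<pi> permutes {..<s}}. {perm_monom s \<rho> \<kappa> \<pi>})"
    unfolding gen_minor_expand using Poly_Mapping.keys_sum by (fastforce split: if_splits)
  then show ?thesis
    using monom_degree_perm_monom[of s \<rho> \<kappa>] unfolding homogeneous_of_degree_def monom_degree_def by blast
qed

text \<open>For \<open>q = 0\<close> the arc is \<open>t\<close> times a fixed matrix, so a homogeneous polynomial of degree \<open>d\<close> picks up
  exactly \<open>t\<^sup>d\<close>.\<close>

lemma locus_order_0_le_degree:
  fixes f :: "'k::field_char_0 mpoly"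
  assumes f: "f \<in> RR r n" "f \<noteq> 0" "homogeneous_of_degree d f"
  shows "locus_order r 0 f \<le> d"
proof -
  let ?Y = "factored r genU gend genW :: nat \<times> nat \<Rightarrow> 'k mpoly"
  define \<phi> where "\<phi> = poly_eval Const ?Y"
  have \<phi>: "comm_ring_hom \<phi>" unfolding \<phi>_def by (rule poly_eval_hom[OF Const_hom])
  have \<phi>_simps: "\<phi> (Const c) = Const c" "\<phi> (Var x y) = ?Y (x, y)" for c x y
    by (simp_all add: \<phi>_def poly_eval_Const[OF Const_hom] poly_eval_Var[OF Const_hom])
  have "degenerate r 0 f = map_poly \<phi> (grade (\<lambda>_. 1) f)"
    unfolding grade_def
  proof (subst hom_poly_eval[OF comm_ring_hom_const_const comm_ring_hom_map_poly[OF \<phi>]])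
    have "factored r (\<lambda>a i. [:genU a i:]) (tail_scale 0 [:0, 1:] (\<lambda>i. [:gend i:])) (\<lambda>i b. [:genW i b:]) (x, y)
       = monom (?Y (x, y)) 1" for x y
    proof -
      have "[:genU x i:] * ([:0, 1:] * [:gend i:]) * [:genW i y:] = monom (genU x i * gend i * genW i y :: 'k mpoly) 1" for i
        by (simp add: monom_Suc monom_0 mult_ac)
      then show ?thesis by (simp add: factored_def tail_scale_def sum_monom del: One_nat_def)
    qed
    then show "degenerate r 0 f = poly_eval (\<lambda>c. map_poly \<phi> [:Const c:]) (\<lambda>v. map_poly \<phi> (case v of (x, y) \<Rightarrow> monom (Var x y) 1)) f"
      unfolding degenerate_def
      by (intro arg_cong2[where f = "\<lambda>c g. poly_eval c g f"] ext)
        (auto simp: map_poly_hom_const[OF \<phi>] map_poly_hom_monom[OF \<phi>] \<phi>_simps simp del: One_nat_def)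
  qed
  also have "\<dots> = monom (\<phi> f) d"
  proof -
    interpret p: comm_ring_hom \<phi> by (rule \<phi>)
    show ?thesis using f(3) by (simp add: homogeneous_iff_grade map_poly_hom_monom[OF \<phi>] del: One_nat_def)
  qed
  finally have deg: "degenerate r 0 f = monom (\<phi> f) d" .
  have "degenerate r 0 f \<noteq> 0" using degenerate_eq_0_iff[OF f(1)] f(2) by simp
  then have "\<phi> f \<noteq> 0" using deg by auto
  then have "\<not> vanishes r 0 (Suc d) f"
    unfolding vanishes_def deg X_power_dvd_iff by (auto simp: coeff_monom)
  then show ?thesis using vanishes_iff_le_order[OF f(1,2), of 0 "Suc d"] by simp
qed

section \<open>Invariant ideals\<close>

lemma ideal_diff:
  assumes "ideal I (coord_ring r n)" "x \<in> I" "y \<in> I"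
  shows "x - y \<in> I"
proof -
  have "(- 1) * y \<in> I" by (rule ideal_coord_ringD(4)[OF assms(1) RR_uminus[OF RR_1] assms(3)])
  then have "x + (- 1) * y \<in> I" by (rule ideal_coord_ringD(3)[OF assms(1,2)])
  then show ?thesis by simp
qed

text \<open>The action involves the inverse of the left matrix, so it is applied to the inverse of \<open>A\<close>.\<close>

lemma invariant_lin_subst:
  fixes I :: "'k::field_char_0 mpoly set"
  assumes I: "invariant_ideal r n I" and A: "A \<in> GL r" and B: "B \<in> GL n" and f: "f \<in> I"
  shows "lin_subst r n A B f \<in> I"
proof -
  interpret S: semiring "ring_mat TYPE('k) r ()" by (rule semiring_mat)
  have id: "ideal I (coord_ring r n)" using I by (simp add: invariant_ideal_def)
  have "act r n (inv\<^bsub>ring_mat TYPE('k) r ()\<^esub> A) B f \<in> I"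
    using I f A B S.Units_inv_Units[OF A] unfolding invariant_ideal_def by blast
  then show ?thesis
    using act_eq_lin_subst[OF ideal_coord_ringD(1)[OF id f] S.Units_inv_Units[OF A] B]
    by (simp add: S.Units_inv_inv[OF A])
qed

lemma invariant_idealI:
  fixes I :: "'k::field_char_0 mpoly set"
  assumes "ideal I (coord_ring r n)" "\<And>A B f. f \<in> I \<Longrightarrow> lin_subst r n A B f \<in> I"
  shows "invariant_ideal r n I"
  unfolding invariant_ideal_def
  using assms act_eq_lin_subst[OF ideal_coord_ringD(1)[OF assms(1)]] by auto

lemma invariant_RR: "invariant_ideal r n (RR r n)"
  by (rule invariant_idealI) (auto simp: ideal_coord_ring_iff intro: RR_add RR_mult lin_subst_RR)

lemma invariant_vanishing: "invariant_ideal r n {f \<in> RR r n. vanishes r q N f}"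
  by (rule invariant_idealI)
     (auto simp: ideal_coord_ring_iff
       intro: RR_add RR_mult lin_subst_RR vanishes_add vanishes_mult_right vanishes_lin_subst)

lemma invariant_Inter:
  assumes "\<And>I. I \<in> S \<Longrightarrow> invariant_ideal r n I" "S \<noteq> {}"
  shows "invariant_ideal r n (\<Inter>S)"
  unfolding invariant_ideal_def
proof (intro conjI ballI image_subsetI)
  show "ideal (\<Inter>S) (coord_ring r n)"
    using assms unfolding invariant_ideal_def ideal_coord_ring_iff by blast
  show "act r n A B x \<in> \<Inter>S" if "A \<in> GL r" "B \<in> GL n" "x \<in> \<Inter>S" for A B x
    using assms that unfolding invariant_ideal_def by blast
qed

lemma det_leading_submatrix:
  assumes "s \<le> r" "r \<le> n"
  shows "det (submatrix (generic_mat r n) {..<s} {..<s}) = gen_minor s id id"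
proof -
  have p: "pick {..<s} x = x" if "x < s" for x
  proof -
    have "{a \<in> {..<s}. a < x} = {..<x}" using that by auto
    then show ?thesis using pick_card_in_set[of x "{..<s}"] that by simp
  qed
  have "det (submatrix (generic_mat r n) {..<s} {..<s}) = gen_minor s (pick {..<s}) (pick {..<s})"
    by (rule det_submatrix) (use assms in auto)
  also have "\<dots> = gen_minor s id id" by (rule minor_cong) (simp add: p)
  finally show ?thesis .
qed

abbreviation leading_minor :: "nat \<Rightarrow> 'k::field_char_0 mpoly" where
  "leading_minor s \<equiv> gen_minor s id id"

lemma K_poly_eq:
  assumes "\<sigma> \<in> H r" "r \<le> n"
  shows "K_poly r n \<sigma> = (\<Prod>s\<leftarrow>\<sigma>. leading_minor s)"
  unfolding K_poly_def
  by (rule arg_cong[where f = prod_list], rule map_cong[OF refl])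
     (use assms in \<open>auto simp: H_def intro: det_leading_submatrix\<close>)

lemma leading_minor_RR: "s \<le> r \<Longrightarrow> r \<le> n \<Longrightarrow> leading_minor s \<in> RR r n"
  by (rule gen_minor_RR) auto

lemma K_poly_RR:
  assumes "\<sigma> \<in> H r" "r \<le> n"
  shows "K_poly r n \<sigma> \<in> RR r n"
  unfolding K_poly_eq[OF assms]
  by (rule RR_prod_list) (use assms in \<open>auto simp: H_def intro: leading_minor_RR\<close>)

context
  fixes r n :: nat and \<sigma> :: "nat list"
  assumes \<sigma>: "\<sigma> \<in> H r" and rn: "r \<le> n"
begin

lemma invariant_I_diagram: "invariant_ideal r n (I_diagram r n \<sigma> :: 'k::field_char_0 mpoly set)"
  unfolding I_diagram_def
  by (rule invariant_Inter) (use invariant_RR K_poly_RR[OF \<sigma> rn] in auto)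

lemma ideal_I_diagram: "ideal (I_diagram r n \<sigma> :: 'k::field_char_0 mpoly set) (coord_ring r n)"
  by (rule conjunct1[OF invariant_I_diagram[unfolded invariant_ideal_def]])

lemma K_poly_in_I_diagram: "K_poly r n \<sigma> \<in> I_diagram r n \<sigma>"
  by (auto simp: I_diagram_def)

lemma gamma_diagram_eq: "1 \<le> j \<Longrightarrow> gamma_diagram j \<sigma> = (\<Sum>s\<leftarrow>\<sigma>. s - (j - 1))"
  unfolding gamma_diagram_def by (rule arg_cong[where f = sum_list], rule map_cong) auto

lemma vanishes_prod_leading:
  assumes "q \<le> r"
  shows "vanishes r q (\<Sum>s\<leftarrow>\<tau>. s - q) (\<Prod>s\<leftarrow>\<tau>. leading_minor s)"
  by (induction \<tau>) (auto intro: vanishes_mult vanishes_gen_minor[OF assms])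

text \<open>The polynomials of order at least \<open>\<gamma>\<^sub>j(\<sigma>)\<close> form an invariant ideal that contains \<open>K\<^sub>\<sigma>\<close>, hence
  contain the smallest such ideal.\<close>

lemma I_diagram_vanishes:
  assumes "1 \<le> j" "j \<le> r" "f \<in> I_diagram r n \<sigma>"
  shows "vanishes r (j - 1) (gamma_diagram j \<sigma>) f"
proof -
  have "vanishes r (j - 1) (gamma_diagram j \<sigma>) (K_poly r n \<sigma>)"
    unfolding K_poly_eq[OF \<sigma> rn] gamma_diagram_eq[OF assms(1)]
    by (rule vanishes_prod_leading) (use assms in simp)
  then show ?thesis
    using assms(3) K_poly_RR[OF \<sigma> rn] invariant_vanishing[of r n "j - 1" "gamma_diagram j \<sigma>"]
    unfolding I_diagram_def by auto
qed

lemma poly_eval_prod_leading: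
  assumes "q \<le> r" "comm_ring_hom c" "\<forall>s\<in>set \<tau>. s \<le> r"
  shows "poly_eval c (factored r (\<lambda>a i. if a = i then 1 else 0) (tail_scale q t (\<lambda>_. 1))
           (\<lambda>a i. if a = i then 1 else 0)) (\<Prod>s\<leftarrow>\<tau>. leading_minor s) = (t :: 'a::comm_ring_1) ^ (\<Sum>s\<leftarrow>\<tau>. s - q)"
  using assms(3)
proof (induction \<tau>)
  case Nil
  interpret h: comm_ring_hom "poly_eval c (factored r (\<lambda>a i. if a = i then 1 else 0) (tail_scale q t (\<lambda>_. 1))
           (\<lambda>a i. if a = i then 1 else 0))" by (rule poly_eval_hom[OF assms(2)])
  show ?case by simp
next
  case (Cons s \<tau>)
  interpret h: comm_ring_hom "poly_eval c (factored r (\<lambda>a i. if a = i then 1 else 0) (tail_scale q t (\<lambda>_. 1))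
           (\<lambda>a i. if a = i then 1 else 0))" by (rule poly_eval_hom[OF assms(2)])
  have "poly_eval c (factored r (\<lambda>a i. if a = i then 1 else 0) (tail_scale q t (\<lambda>_. 1))
           (\<lambda>a i. if a = i then 1 else 0)) (leading_minor s) = t ^ (s - q)"
    by (rule leading_minor_specialize) (use assms Cons.prems in auto)
  moreover have "poly_eval c (factored r (\<lambda>a i. if a = i then 1 else 0) (tail_scale q t (\<lambda>_. 1))
           (\<lambda>a i. if a = i then 1 else 0)) (\<Prod>s\<leftarrow>\<tau>. leading_minor s) = t ^ (\<Sum>s\<leftarrow>\<tau>. s - q)"
    by (rule Cons.IH) (use Cons.prems in simp)
  ultimately show ?case by (simp only: list.map prod_list.Cons sum_list.Cons h.hom_mult power_add)
qed

text \<open>On the diagonal arc the power of \<open>K\<^sub>\<sigma>\<close> becomes a power of \<open>t\<close>, which bounds its order from above.\<close>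

lemma K_poly_power_order:
  assumes "1 \<le> j" "j \<le> r"
  shows "(K_poly r n \<sigma> ^ m :: 'k::field_char_0 mpoly) \<noteq> 0"
    and "locus_order r (j - 1) (K_poly r n \<sigma> ^ m :: 'k mpoly) \<le> m * gamma_diagram j \<sigma>"
proof -
  let ?ev = "poly_eval (\<lambda>c::'k. [:c:]) (factored r (\<lambda>a i. if a = i then 1 else 0) (tail_scale (j - 1) [:0, 1:] (\<lambda>_. 1))
           (\<lambda>a i. if a = i then 1 else 0))"
  interpret h: comm_ring_hom ?ev by (rule poly_eval_hom[OF comm_ring_hom_const_poly])
  have "?ev (K_poly r n \<sigma>) = [:0, 1:] ^ gamma_diagram j \<sigma>"
    unfolding K_poly_eq[OF \<sigma> rn] gamma_diagram_eq[OF assms(1)]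
    by (rule poly_eval_prod_leading) (use assms \<sigma> in \<open>auto simp: H_def comm_ring_hom_const_poly\<close>)
  then have ev: "?ev (K_poly r n \<sigma> ^ m) = [:0, 1:] ^ (m * gamma_diagram j \<sigma>)"
    unfolding h.hom_power by (simp only: power_mult[symmetric] mult.commute)
  show nz: "(K_poly r n \<sigma> ^ m :: 'k mpoly) \<noteq> 0"
  proof
    assume "(K_poly r n \<sigma> ^ m :: 'k mpoly) = 0"
    then have "?ev (K_poly r n \<sigma> ^ m) = 0" by (simp only: h.hom_zero)
    then have "([:0, 1:] :: 'k poly) ^ (m * gamma_diagram j \<sigma>) = 0" by (simp only: ev)
    then show False by simp
  qed
  define d where "d = locus_order r (j - 1) (K_poly r n \<sigma> ^ m :: 'k mpoly)"
  have "vanishes r (j - 1) d (K_poly r n \<sigma> ^ m :: 'k mpoly)"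
    using vanishes_iff_le_order[OF RR_power[OF K_poly_RR[OF \<sigma> rn]] nz] by (simp add: d_def)
  then have "[:0, 1:] ^ d dvd ?ev (K_poly r n \<sigma> ^ m)"
    by (rule vanishes_specialize[OF comm_ring_hom_const_poly])
  then have "[:0, 1:] ^ d dvd ([:0, 1:] :: 'k poly) ^ (m * gamma_diagram j \<sigma>)"
    by (simp only: ev)
  then have "d \<le> m * gamma_diagram j \<sigma>"
    using dvd_imp_degree_le[of "[:0, 1::'k:] ^ d" "[:0, 1:] ^ (m * gamma_diagram j \<sigma>)"]
    by (simp add: degree_linear_power)
  then show "locus_order r (j - 1) (K_poly r n \<sigma> ^ m :: 'k mpoly) \<le> m * gamma_diagram j \<sigma>"
    by (simp add: d_def)
qed

end

lemma ideal_I_diagrams: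
  assumes "\<Sigma> \<subseteq> H r" "finite \<Sigma>" "r \<le> n"
  shows "ideal (I_diagrams r n \<Sigma> :: 'k::field_char_0 mpoly set) (coord_ring r n)"
proof -
  have I: "ideal (I_diagram r n \<sigma> :: 'k mpoly set) (coord_ring r n)" if "\<sigma> \<in> \<Sigma>" for \<sigma>
    using ideal_I_diagram assms that by blast
  note D = ideal_coord_ringD[OF I]
  show ?thesis
    unfolding ideal_coord_ring_iff
  proof (intro conjI ballI subsetI)
    fix x :: "'k mpoly" assume "x \<in> I_diagrams r n \<Sigma>"
    then obtain h where h: "x = sum h \<Sigma>" "\<forall>\<sigma>\<in>\<Sigma>. h \<sigma> \<in> I_diagram r n \<sigma>"
      unfolding I_diagrams_def by auto
    show "x \<in> RR r n" unfolding h(1) by (rule RR_sum) (use h D(1) in blast)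
    {
      fix y :: "'k mpoly" assume y: "y \<in> RR r n"
      have "y * x = (\<Sum>\<sigma>\<in>\<Sigma>. y * h \<sigma>)" by (simp add: h(1) sum_distrib_left)
      moreover have "\<forall>\<sigma>\<in>\<Sigma>. y * h \<sigma> \<in> I_diagram r n \<sigma>" using h(2) D(4) y by blast
      ultimately show "y * x \<in> I_diagrams r n \<Sigma>"
        unfolding I_diagrams_def by (intro CollectI exI[of _ "\<lambda>\<sigma>. y * h \<sigma>"]) simp
    }
    fix y :: "'k mpoly" assume "y \<in> I_diagrams r n \<Sigma>"
    then obtain h' where h': "y = sum h' \<Sigma>" "\<forall>\<sigma>\<in>\<Sigma>. h' \<sigma> \<in> I_diagram r n \<sigma>"
      unfolding I_diagrams_def by auto
    have "x + y = (\<Sum>\<sigma>\<in>\<Sigma>. h \<sigma> + h' \<sigma>)" by (simp add: h(1) h'(1) sum.distrib)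
    moreover have "\<forall>\<sigma>\<in>\<Sigma>. h \<sigma> + h' \<sigma> \<in> I_diagram r n \<sigma>" using h(2) h'(2) D(3) by blast
    ultimately show "x + y \<in> I_diagrams r n \<Sigma>"
      unfolding I_diagrams_def by (intro CollectI exI[of _ "\<lambda>\<sigma>. h \<sigma> + h' \<sigma>"]) simp
  next
    show "0 \<in> (I_diagrams r n \<Sigma> :: 'k mpoly set)"
      unfolding I_diagrams_def using D(2) by (intro CollectI exI[of _ "\<lambda>_. 0"]) simp
  qed
qed

lemma I_diagram_subset:
  assumes "\<Sigma> \<subseteq> H r" "finite \<Sigma>" "r \<le> n" "\<sigma> \<in> \<Sigma>"
  shows "I_diagram r n \<sigma> \<subseteq> (I_diagrams r n \<Sigma> :: 'k::field_char_0 mpoly set)"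
proof
  fix x :: "'k mpoly" assume x: "x \<in> I_diagram r n \<sigma>"
  have "(\<Sum>\<tau>\<in>\<Sigma>. if \<tau> = \<sigma> then x else 0) = x" using assms by simp
  moreover have "\<forall>\<tau>\<in>\<Sigma>. (if \<tau> = \<sigma> then x else 0) \<in> I_diagram r n \<tau>"
  proof
    fix \<tau> assume "\<tau> \<in> \<Sigma>"
    then have "ideal (I_diagram r n \<tau> :: 'k mpoly set) (coord_ring r n)"
      using ideal_I_diagram assms by blast
    from ideal_coord_ringD(2)[OF this] show "(if \<tau> = \<sigma> then x else 0) \<in> I_diagram r n \<tau>" using x by simp
  qed
  ultimately show "x \<in> I_diagrams r n \<Sigma>"
    unfolding I_diagrams_def by (intro CollectI exI[of _ "\<lambda>\<tau>. if \<tau> = \<sigma> then x else 0"]) simp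
qed

lemma I_diagrams_vanishes:
  fixes f :: "'k::field_char_0 mpoly"
  assumes "\<Sigma> \<subseteq> H r" "finite \<Sigma>" "r \<le> n" "1 \<le> j" "j \<le> r" "f \<in> I_diagrams r n \<Sigma>"
  shows "vanishes r (j - 1) (gamma_diagrams j \<Sigma>) f"
proof -
  obtain h where h: "f = sum h \<Sigma>" "\<forall>\<sigma>\<in>\<Sigma>. h \<sigma> \<in> I_diagram r n \<sigma>"
    using assms(6) unfolding I_diagrams_def by auto
  have "vanishes r (j - 1) (gamma_diagrams j \<Sigma>) (h \<sigma>)" if "\<sigma> \<in> \<Sigma>" for \<sigma>
  proof -
    have "vanishes r (j - 1) (gamma_diagram j \<sigma>) (h \<sigma>)"
      by (rule I_diagram_vanishes[where n = n]) (use assms h that in auto)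
    moreover have "gamma_diagrams j \<Sigma> \<le> gamma_diagram j \<sigma>"
      unfolding gamma_diagrams_def using assms(2) that by simp
    ultimately show ?thesis by (rule vanishes_mono)
  qed
  then have v: "\<And>\<sigma>. \<sigma> \<in> \<Sigma> \<Longrightarrow> vanishes r (j - 1) (gamma_diagrams j \<Sigma>) (h \<sigma>)" .
  have "vanishes r (j - 1) (gamma_diagrams j \<Sigma>) (sum h S)" if "S \<subseteq> \<Sigma>" for S
  proof -
    have "finite S" using that assms(2) finite_subset by blast
    then show ?thesis using that by (induction S rule: finite_induct) (auto intro: vanishes_add v simp del: One_nat_def)
  qed
  then show ?thesis using h(1) by simp
qed

lemma ideal_power_lin_subst:
  fixes I :: "'k::field_char_0 mpoly set"
  assumes I: "invariant_ideal r n I" and A: "A \<in> GL r" and B: "B \<in> GL n" and f: "f \<in> ideal_power r n I m"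
  shows "lin_subst r n A B f \<in> ideal_power r n I m"
proof -
  have id: "ideal I (coord_ring r n)" using I by (simp add: invariant_ideal_def)
  interpret h: comm_ring_hom "lin_subst r n A B" by (rule lin_subst_hom)
  have "ideal_power r n I m \<subseteq> {f. lin_subst r n A B f \<in> ideal_power r n I m}"
  proof (rule ideal_power_subset)
    show "RR r n \<subseteq> {f. lin_subst r n A B f \<in> ideal_power r n I 0}"
      by (auto simp: ideal_power_0 lin_subst_RR)
  next
    fix m x y assume "x \<in> {f. lin_subst r n A B f \<in> ideal_power r n I m}" "y \<in> I"
    then show "x * y \<in> {f. lin_subst r n A B f \<in> ideal_power r n I (Suc m)}"
      using invariant_lin_subst[OF I A B, of y] by (simp add: h.hom_mult ideal_power_Suc_mult)
  next
    fix m x y assume "x \<in> {f. lin_subst r n A B f \<in> ideal_power r n I m}" "y \<in> {f. lin_subst r n A B f \<in> ideal_power r n I m}"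
    then show "x + y \<in> {f. lin_subst r n A B f \<in> ideal_power r n I m}"
      using ideal_coord_ringD(3)[OF ideal_ideal_power[OF id]] by (simp add: h.hom_add)
  qed
  then show ?thesis using f by blast
qed

section \<open>Transvections\<close>

lemma GL_1: "1\<^sub>m d \<in> GL d"
proof -
  interpret S: semiring "ring_mat TYPE('a) d ()" by (rule semiring_mat)
  show ?thesis using S.Units_one_closed by (simp add: ring_mat_def)
qed

text \<open>Elementary matrices act by adding a multiple of one row to another.\<close>

lemma lin_subst_row:
  fixes f :: "'k::field_char_0 mpoly"
  assumes "f \<in> RR r n" "i < r" "k < r" "i \<noteq> k"
  shows "lin_subst r n (addrow_mat r \<tau> i k) (1\<^sub>m n) f
    = poly_eval Const (\<lambda>(a, b). Var a b + (if a = i then Const \<tau> * Var k b else 0)) f"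
  unfolding lin_subst_def
proof (rule poly_eval_cong[OF assms(1)])
  fix a b assume ab: "a < r" "b < n"
  interpret C: comm_ring_hom "Const :: 'k \<Rightarrow> _" by (rule Const_hom)
  have "(\<Sum>j<n. Const (addrow_mat r \<tau> i k $$ (a, l)) * Var l j * Const (1\<^sub>m n $$ (j, b)))
     = Const (addrow_mat r \<tau> i k $$ (a, l)) * Var l b" for l
  proof -
    have "(\<Sum>j<n. Const (addrow_mat r \<tau> i k $$ (a, l)) * Var l j * Const (1\<^sub>m n $$ (j, b)))
       = (\<Sum>j<n. if j = b then Const (addrow_mat r \<tau> i k $$ (a, l)) * Var l b else 0)"
      using ab by (intro sum.cong) auto
    then show ?thesis using ab by simp
  qed
  then have "(\<Sum>l<r. \<Sum>j<n. Const (addrow_mat r \<tau> i k $$ (a, l)) * Var l j * Const (1\<^sub>m n $$ (j, b)))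
      = (\<Sum>l<r. Const (addrow_mat r \<tau> i k $$ (a, l)) * Var l b)" by simp
  also have "\<dots> = (\<Sum>l<r. (if l = a then Var a b else 0) + (if l = k then if a = i then Const \<tau> * Var k b else 0 else 0))"
    using ab assms by (intro sum.cong) (auto simp: addrow_mat_def)
  also have "\<dots> = Var a b + (if a = i then Const \<tau> * Var k b else 0)"
    using ab assms by (simp add: sum.distrib)
  finally show "(case (a, b) of (a, b) \<Rightarrow> \<Sum>l<r. \<Sum>j<n. Const (addrow_mat r \<tau> i k $$ (a, l)) * Var l j * Const (1\<^sub>m n $$ (j, b)))
     = (case (a, b) of (a, b) \<Rightarrow> Var a b + (if a = i then Const \<tau> * Var k b else 0))" by simp
qed

lemma lin_subst_col:
  fixes f :: "'k::field_char_0 mpoly"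
  assumes "f \<in> RR r n" "i < n" "k < n" "i \<noteq> k"
  shows "lin_subst r n (1\<^sub>m r) (addrow_mat n \<tau> k i) f
    = poly_eval Const (\<lambda>(a, b). Var a b + (if b = i then Const \<tau> * Var a k else 0)) f"
  unfolding lin_subst_def
proof (rule poly_eval_cong[OF assms(1)])
  fix a b assume ab: "a < r" "b < n"
  interpret C: comm_ring_hom "Const :: 'k \<Rightarrow> _" by (rule Const_hom)
  have "(\<Sum>l<r. \<Sum>j<n. Const (1\<^sub>m r $$ (a, l)) * Var l j * Const (addrow_mat n \<tau> k i $$ (j, b)))
     = (\<Sum>l<r. if l = a then (\<Sum>j<n. Var a j * Const (addrow_mat n \<tau> k i $$ (j, b))) else 0)"
    using ab by (intro sum.cong) auto
  also have "\<dots> = (\<Sum>j<n. Var a j * Const (addrow_mat n \<tau> k i $$ (j, b)))" using ab by simp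
  also have "\<dots> = (\<Sum>j<n. (if j = b then Var a b else 0) + (if j = k then if b = i then Const \<tau> * Var a k else 0 else 0))"
    using ab assms by (intro sum.cong) (auto simp: addrow_mat_def mult.commute)
  also have "\<dots> = Var a b + (if b = i then Const \<tau> * Var a k else 0)"
    using ab assms by (simp add: sum.distrib)
  finally show "(case (a, b) of (a, b) \<Rightarrow> \<Sum>l<r. \<Sum>j<n. Const (1\<^sub>m r $$ (a, l)) * Var l j * Const (addrow_mat n \<tau> k i $$ (j, b)))
     = (case (a, b) of (a, b) \<Rightarrow> Var a b + (if b = i then Const \<tau> * Var a k else 0))" by simp
qed

text \<open>For an injective list \<open>\<rho>\<close> this replaces the entry \<open>i\<close> by \<open>k\<close>, in place.\<close>

definition redirect :: "nat \<Rightarrow> nat \<Rightarrow> (nat \<Rightarrow> nat) \<Rightarrow> nat \<Rightarrow> nat" where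
  "redirect i k \<rho> x = (if \<rho> x = i then k else \<rho> x)"

text \<open>A minor is linear in each row, and in an injective list only one row changes.  A row that
  occurs already makes the second minor vanish.\<close>

lemma minor_row_add:
  assumes inj: "inj_on \<rho> {..<s}"
  shows "minor (\<lambda>(a, b). E (a, b) + (if a = i then c * E (k, b) else 0)) s \<rho> \<kappa>
     = minor E s \<rho> \<kappa> + c * (if i \<in> \<rho> ` {..<s} then minor E s (redirect i k \<rho>) \<kappa> else (0::'a::comm_ring_1))"
proof (cases "i \<in> \<rho> ` {..<s}")
  case False
  then have "minor (\<lambda>(a, b). E (a, b) + (if a = i then c * E (k, b) else 0)) s \<rho> \<kappa> = minor E s \<rho> \<kappa>"
    by (intro minor_cong) auto
  then show ?thesis using False by simp
next
  case True
  then obtain x0 where x0: "x0 < s" "\<rho> x0 = i" by auto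
  have other: "\<rho> x \<noteq> i" if "x < s" "x \<noteq> x0" for x
    using that x0 inj by (auto dest: inj_onD)
  define M1 where "M1 = mat s s (\<lambda>(x, y). (\<lambda>(a, b). E (a, b) + (if a = i then c * E (k, b) else 0)) (\<rho> x, \<kappa> y))"
  define M2 where "M2 = mat s s (\<lambda>(x, y). E (\<rho> x, \<kappa> y))"
  define M3 where "M3 = mat s s (\<lambda>(x, y). E (redirect i k \<rho> x, \<kappa> y))"
  have carr: "M1 \<in> carrier_mat s s" "M2 \<in> carrier_mat s s" "M3 \<in> carrier_mat s s"
    by (simp_all add: M1_def M2_def M3_def)
  have "mat_delete M1 x0 y = mat_delete M2 x0 y" "mat_delete M3 x0 y = mat_delete M2 x0 y" for y
    by (rule eq_matI; use x0 other in \<open>auto simp: mat_delete_def M1_def M2_def M3_def redirect_def\<close>)+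
  then have cof: "cofactor M1 x0 y = cofactor M2 x0 y" "cofactor M3 x0 y = cofactor M2 x0 y" for y
    by (simp_all add: cofactor_def)
  have "det M1 = (\<Sum>y<s. M1 $$ (x0, y) * cofactor M2 x0 y)"
    by (subst laplace_expansion_row[OF carr(1) x0(1)]) (simp add: cof)
  also have "\<dots> = (\<Sum>y<s. M2 $$ (x0, y) * cofactor M2 x0 y + c * (M3 $$ (x0, y) * cofactor M3 x0 y))"
  proof (rule sum.cong[OF refl])
    fix y assume "y \<in> {..<s}"
    then have "M1 $$ (x0, y) = M2 $$ (x0, y) + c * M3 $$ (x0, y)"
      using x0 by (simp add: M1_def M2_def M3_def redirect_def)
    then show "M1 $$ (x0, y) * cofactor M2 x0 y = M2 $$ (x0, y) * cofactor M2 x0 y + c * (M3 $$ (x0, y) * cofactor M3 x0 y)"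
      by (simp add: cof algebra_simps)
  qed
  also have "\<dots> = det M2 + c * det M3"
    by (simp add: sum.distrib sum_distrib_left[symmetric] laplace_expansion_row[OF carr(2) x0(1)] laplace_expansion_row[OF carr(3) x0(1)])
  finally show ?thesis using True by (simp add: minor_def M1_def M2_def M3_def)
qed

lemma minor_col_add:
  assumes "inj_on \<kappa> {..<s}"
  shows "minor (\<lambda>(a, b). E (a, b) + (if b = i then c * E (a, k) else 0)) s \<rho> \<kappa>
     = minor E s \<rho> \<kappa> + c * (if i \<in> \<kappa> ` {..<s} then minor E s \<rho> (redirect i k \<kappa>) else (0::'a::comm_ring_1))"
  using minor_row_add[OF assms, where E = "\<lambda>(a, b). E (b, a)" and i = i and c = c and k = k and \<kappa> = \<rho>, unfolded prod.case]
  by (subst (1 2 3) minor_transpose) simp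

section \<open>Almost integral elements\<close>

definition homog_nonzero :: "nat \<Rightarrow> nat \<Rightarrow> 'k::field_char_0 mpoly set" where
  "homog_nonzero r n = {a \<in> RR r n. a \<noteq> 0 \<and> (\<exists>d. homogeneous_of_degree d a)}"

lemma homog_nonzero_1: "1 \<in> homog_nonzero r n"
  using homogeneous_1 by (auto simp: homog_nonzero_def)

lemma homog_nonzero_mult: "a \<in> homog_nonzero r n \<Longrightarrow> b \<in> homog_nonzero r n \<Longrightarrow> a * b \<in> homog_nonzero r n"
  unfolding homog_nonzero_def by (auto intro: RR_mult homogeneous_mult)

lemma homog_nonzero_power: "a \<in> homog_nonzero r n \<Longrightarrow> a ^ k \<in> homog_nonzero r n"
  by (induction k) (auto intro: homog_nonzero_1 homog_nonzero_mult)

lemma homog_nonzero_RR: "a \<in> homog_nonzero r n \<Longrightarrow> a \<in> RR r n"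
  by (simp add: homog_nonzero_def)

text \<open>A form of integrality over the \<open>k\<close>-th power of \<open>I\<close>: one multiplier \<open>a\<close> serves all exponents \<open>l\<close>, but it
  may depend on \<open>f\<close>.  It is homogeneous, so that the degrees of elements built from it are known.\<close>

definition almost_integral :: "nat \<Rightarrow> nat \<Rightarrow> 'k::field_char_0 mpoly set \<Rightarrow> nat \<Rightarrow> 'k mpoly set" where
  "almost_integral r n I k =
     {f \<in> RR r n. \<exists>a\<in>homog_nonzero r n. \<forall>l. a * f ^ l \<in> ideal_power r n I (k * l)}"

context
  fixes r n :: nat and I :: "'k::field_char_0 mpoly set" and k :: nat
  assumes I: "ideal I (coord_ring r n)"
begin

lemma almost_integral_RR: "f \<in> almost_integral r n I k \<Longrightarrow> f \<in> RR r n"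
  by (simp add: almost_integral_def)

private lemmas pow = ideal_coord_ringD[OF ideal_ideal_power[OF I]]

lemma ideal_power_almost_integral:
  assumes "f \<in> ideal_power r n I k"
  shows "f \<in> almost_integral r n I k"
  unfolding almost_integral_def
proof (intro CollectI conjI bexI[of _ 1] allI)
  show "f \<in> RR r n" by (rule ideal_power_RR[OF I assms])
  show "1 * f ^ l \<in> ideal_power r n I (k * l)" for l using ideal_power_elem[OF I assms] by simp
qed (rule homog_nonzero_1)

lemma almost_integral_0: "0 \<in> almost_integral r n I k"
proof -
  have "0 \<in> ideal_power r n I k" by (rule pow(2))
  then show ?thesis by (rule ideal_power_almost_integral)
qed

lemma almost_integral_mult:
  assumes "h \<in> RR r n" "f \<in> almost_integral r n I k"
  shows "h * f \<in> almost_integral r n I k"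
proof -
  obtain a where a: "a \<in> homog_nonzero r n" "\<forall>l. a * f ^ l \<in> ideal_power r n I (k * l)" and f: "f \<in> RR r n"
    using assms(2) by (auto simp: almost_integral_def)
  have "a * (h * f) ^ l \<in> ideal_power r n I (k * l)" for l
  proof -
    have "h ^ l * (a * f ^ l) \<in> ideal_power r n I (k * l)"
      by (rule pow(4)) (use a assms RR_power in auto)
    then show ?thesis by (simp add: power_mult_distrib mult_ac)
  qed
  then show ?thesis using a(1) f assms(1) unfolding almost_integral_def by (auto intro: RR_mult)
qed

text \<open>The product of the two multipliers serves every term of the binomial expansion.\<close>

lemma almost_integral_add:
  assumes "f \<in> almost_integral r n I k" "g \<in> almost_integral r n I k"
  shows "f + g \<in> almost_integral r n I k"
proof -
  obtain a where a: "a \<in> homog_nonzero r n" "\<And>l. a * f ^ l \<in> ideal_power r n I (k * l)" and f: "f \<in> RR r n"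
    using assms(1) by (auto simp: almost_integral_def)
  obtain b where b: "b \<in> homog_nonzero r n" "\<And>l. b * g ^ l \<in> ideal_power r n I (k * l)" and g: "g \<in> RR r n"
    using assms(2) by (auto simp: almost_integral_def)
  have psum: "sum F S \<in> ideal_power r n I m" if "\<And>x. x \<in> S \<Longrightarrow> F x \<in> ideal_power r n I m"
    for F and S :: "nat set" and m
    using that by (induction S rule: infinite_finite_induct) (auto intro: pow(2) pow(3))
  have "(a * b) * (f + g) ^ l \<in> ideal_power r n I (k * l)" for l
  proof -
    have "(a * b) * (f + g) ^ l = (\<Sum>i\<le>l. of_nat (l choose i) * ((a * f ^ i) * (b * g ^ (l - i))))"
      by (simp add: binomial_ring sum_distrib_left mult_ac)
    also have "\<dots> \<in> ideal_power r n I (k * l)"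
    proof (rule psum)
      fix i assume i: "i \<in> {..l}"
      have "(a * f ^ i) * (b * g ^ (l - i)) \<in> ideal_power r n I (k * i + k * (l - i))"
        by (rule ideal_power_mult[OF I a(2) b(2)])
      moreover have "k * i + k * (l - i) = k * l" using i by (simp add: distrib_left[symmetric])
      moreover have "(of_nat (l choose i) :: 'k mpoly) \<in> RR r n"
      proof -
        interpret C: comm_ring_hom "Const :: 'k \<Rightarrow> _" by (rule Const_hom)
        have "Const (of_nat (l choose i) :: 'k) \<in> RR r n" by (rule RR_Const)
        then show ?thesis by (simp only: C.hom_of_nat)
      qed
      ultimately show "of_nat (l choose i) * ((a * f ^ i) * (b * g ^ (l - i))) \<in> ideal_power r n I (k * l)"
        using pow(4) by metis
    qed
    finally show ?thesis .
  qed
  then show ?thesis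
    using homog_nonzero_mult[OF a(1) b(1)] f g unfolding almost_integral_def by (auto intro: RR_add)
qed

text \<open>Group the factors of a product by their value and multiply the multipliers of the finitely many
  values.\<close>

lemma common_multiplier:
  assumes "finite S" "S \<subseteq> almost_integral r n I k"
  obtains a where "a \<in> homog_nonzero r n"
    "\<And>xs. set xs \<subseteq> S \<Longrightarrow> a * prod_list xs \<in> ideal_power r n I (k * length xs)"
  using assms
proof (induction S arbitrary: thesis rule: finite_induct)
  case empty
  show ?case
  proof (rule empty.prems(1)[OF homog_nonzero_1])
    fix xs :: "'k mpoly list" assume "set xs \<subseteq> {}"
    then show "1 * prod_list xs \<in> ideal_power r n I (k * length xs)"
      by (simp add: ideal_power_0)
  qed
next
  case (insert f S)
  obtain a where a: "a \<in> homog_nonzero r n"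
    "\<And>xs. set xs \<subseteq> S \<Longrightarrow> a * prod_list xs \<in> ideal_power r n I (k * length xs)"
    using insert.IH insert.prems(2) by blast
  obtain b where b: "b \<in> homog_nonzero r n" "\<And>l. b * f ^ l \<in> ideal_power r n I (k * l)"
    using insert.prems(2) by (auto simp: almost_integral_def)
  show ?case
  proof (rule insert.prems(1)[OF homog_nonzero_mult[OF a(1) b(1)]])
    fix xs assume xs: "set xs \<subseteq> insert f S"
    define ys where "ys = filter (\<lambda>x. x \<noteq> f) xs"
    define l where "l = length (filter (\<lambda>x. x = f) xs)"
    have split: "prod_list xs = prod_list ys * f ^ l" "length xs = length ys + l"
      unfolding ys_def l_def by (induction xs) (auto simp: mult_ac)
    have "set ys \<subseteq> S" using xs by (auto simp: ys_def)
    then have "(a * prod_list ys) * (b * f ^ l) \<in> ideal_power r n I (k * length ys + k * l)"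
      by (intro ideal_power_mult[OF I] a(2) b(2))
    then show "a * b * prod_list xs \<in> ideal_power r n I (k * length xs)"
      by (simp add: split distrib_left mult_ac)
  qed
qed

text \<open>The terms \<open>a g\<^bsub>i+1\<^esub> + b g\<^sub>i\<close> are the coefficients of \<open>(a + b T) G\<close>.  Multiplied by the monomials of
  degree \<open>N\<close> in \<open>a\<close> and \<open>b\<close>, they determine the monomials of degree \<open>N + 1\<close> times the \<open>g\<^sub>i\<close>: the
  relations are solved upwards from \<open>a g\<^sub>0\<close> for exponents of \<open>a\<close> above \<open>i\<close>, and downwards from
  \<open>g\<^bsub>N+1\<^esub> = 0\<close> for the others.\<close>

lemma linear_content_step:
  fixes a b :: "'k mpoly" and g :: "nat \<Rightarrow> 'k mpoly"
  assumes diff: "\<And>x y. x \<in> X \<Longrightarrow> y \<in> X \<Longrightarrow> x - y \<in> X"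
    and h0: "\<And>i. i \<le> N \<Longrightarrow> a * g 0 * (a ^ i * b ^ (N - i)) \<in> X"
    and h: "\<And>\<kappa> i. \<kappa> \<le> N \<Longrightarrow> i \<le> N \<Longrightarrow> (a * g (Suc \<kappa>) + b * g \<kappa>) * (a ^ i * b ^ (N - i)) \<in> X"
    and top: "g (Suc N) = 0"
  shows "\<kappa> \<le> N \<Longrightarrow> e \<le> Suc N \<Longrightarrow> a ^ e * b ^ (Suc N - e) * g \<kappa> \<in> X"
proof -
  have up: "\<kappa> < e \<Longrightarrow> e \<le> Suc N \<Longrightarrow> a ^ e * b ^ (Suc N - e) * g \<kappa> \<in> X" for \<kappa> e
  proof (induction \<kappa> arbitrary: e)
    case 0
    then obtain i where i: "e = Suc i" "i \<le> N" by (cases e) auto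
    have "a * g 0 * (a ^ i * b ^ (N - i)) \<in> X" by (rule h0[OF i(2)])
    then show ?case by (simp add: i(1) mult_ac)
  next
    case (Suc \<kappa>)
    then obtain i where i: "e = Suc i" "i \<le> N" "\<kappa> < i" by (cases e) auto
    have "(a * g (Suc \<kappa>) + b * g \<kappa>) * (a ^ i * b ^ (N - i)) - a ^ i * b ^ (Suc N - i) * g \<kappa> \<in> X"
      by (rule diff[OF h Suc.IH]) (use i in auto)
    moreover have "(a * g (Suc \<kappa>) + b * g \<kappa>) * (a ^ i * b ^ (N - i)) - a ^ i * b ^ (Suc N - i) * g \<kappa>
       = a ^ e * b ^ (Suc N - e) * g (Suc \<kappa>)"
      using i by (simp add: Suc_diff_le algebra_simps)
    ultimately show ?case by simp
  qed
  have down: "e \<le> \<kappa> \<Longrightarrow> \<kappa> \<le> N \<Longrightarrow> a ^ e * b ^ (Suc N - e) * g \<kappa> \<in> X" for \<kappa> e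
  proof (induction "N - \<kappa>" arbitrary: \<kappa> e)
    case 0
    then have \<kappa>: "\<kappa> = N" by simp
    have "(a * g (Suc N) + b * g N) * (a ^ e * b ^ (N - e)) \<in> X" by (rule h) (use 0 in auto)
    then show ?case using 0 by (simp add: \<kappa> top Suc_diff_le mult_ac)
  next
    case (Suc j)
    have "(a * g (Suc \<kappa>) + b * g \<kappa>) * (a ^ e * b ^ (N - e)) - a ^ Suc e * b ^ (Suc N - Suc e) * g (Suc \<kappa>) \<in> X"
      by (rule diff[OF h Suc.hyps(1)]) (use Suc in auto)
    moreover have "(a * g (Suc \<kappa>) + b * g \<kappa>) * (a ^ e * b ^ (N - e)) - a ^ Suc e * b ^ (Suc N - Suc e) * g (Suc \<kappa>)
       = a ^ e * b ^ (Suc N - e) * g \<kappa>"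
      using Suc.prems by (simp add: Suc_diff_le algebra_simps)
    ultimately show ?case by simp
  qed
  show "\<kappa> \<le> N \<Longrightarrow> e \<le> Suc N \<Longrightarrow> a ^ e * b ^ (Suc N - e) * g \<kappa> \<in> X"
    using up down by (cases "\<kappa> < e") auto
qed

text \<open>A Dedekind-Mertens argument.  Let \<open>h\<^sub>i\<close> be the coefficients of \<open>(a + b T) G\<close>, and let \<open>V\<close> be the span
  of the monomials \<open>m\<^sub>i\<close> of degree \<open>N\<close> in \<open>a\<close> and \<open>b\<close>.  By \<open>linear_content_step\<close>, multiplication by
  \<open>y = a g\<^sub>i\<close> or \<open>y = b g\<^sub>i\<close> maps \<open>V\<close> into the sum of the \<open>h\<^sub>i V\<close>.  Iterating, \<open>y\<^sup>l m\<^sub>i\<close> is a combination of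
  products of \<open>l\<close> coefficients \<open>h\<^sub>i\<close> with elements of \<open>V\<close>, so a common multiplier for the \<open>h\<^sub>i\<close>, times
  a nonzero \<open>m\<^sub>i\<close>, is a multiplier for \<open>y\<close>.\<close>

lemma linear_content:
  assumes a: "a \<in> insert 0 (homog_nonzero r n)" and b: "b \<in> insert 0 (homog_nonzero r n)"
    and G: "\<And>i. coeff G i \<in> RR r n"
    and prod: "\<And>i. coeff ([:a, b:] * G) i \<in> almost_integral r n I k"
  shows "a * coeff G i \<in> almost_integral r n I k" "b * coeff G i \<in> almost_integral r n I k"
proof -
  define N where "N = degree G"
  define h where "h i = coeff ([:a, b:] * G) i" for i
  have aR: "a \<in> RR r n" and bR: "b \<in> RR r n" using a b homog_nonzero_RR by auto
  have h_Suc: "h (Suc i) = a * coeff G (Suc i) + b * coeff G i" and h_0: "h 0 = a * coeff G 0" for i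
    by (simp_all add: h_def)
  \<comment> \<open>These monomials stand in for a generating set of a module that \<open>y\<close> multiplies into itself.\<close>
  define m where "m i = a ^ i * b ^ (N - i)" for i
  have mR: "m i \<in> RR r n" for i unfolding m_def by (intro RR_mult RR_power aR bR)
  obtain A where A: "A \<in> homog_nonzero r n"
    "\<And>xs. set xs \<subseteq> h ` {..Suc N} \<Longrightarrow> A * prod_list xs \<in> ideal_power r n I (k * length xs)"
    by (rule common_multiplier[of "h ` {..Suc N}"]) (use prod in \<open>auto simp: h_def\<close>)
  have key: "y \<in> almost_integral r n I k"
    if nz: "\<not> (a = 0 \<and> b = 0)" and y: "y \<in> RR r n" and span: "\<And>X i. (\<And>u v. u \<in> X \<Longrightarrow> v \<in> X \<Longrightarrow> u - v \<in> X) \<Longrightarrow>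
      (\<And>\<kappa> i. \<kappa> \<le> Suc N \<Longrightarrow> i \<le> N \<Longrightarrow> h \<kappa> * m i \<in> X) \<Longrightarrow> i \<le> N \<Longrightarrow> y * m i \<in> X" for y
  proof -
    \<comment> \<open>Each factor \<open>y\<close> is traded for a factor \<open>h \<kappa>\<close>, which the list \<open>xs\<close> records.\<close>
    have main: "set xs \<subseteq> h ` {..Suc N} \<Longrightarrow> i \<le> N \<Longrightarrow>
        A * prod_list xs * y ^ l * m i \<in> ideal_power r n I (k * (length xs + l))" for xs l i
    proof (induction l arbitrary: xs i)
      case 0
      then show ?case using pow(4)[OF mR A(2)] by (simp add: mult.commute)
    next
      case (Suc l)
      let ?X = "{x. A * prod_list xs * y ^ l * x \<in> ideal_power r n I (k * (length xs + Suc l))}"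
      have "y * m i \<in> ?X"
      proof (rule span[OF _ _ Suc.prems(2)])
        fix u v assume "u \<in> ?X" "v \<in> ?X"
        then show "u - v \<in> ?X"
          using ideal_diff[OF ideal_ideal_power[OF I]] by (simp add: right_diff_distrib)
      next
        fix \<kappa> i assume "\<kappa> \<le> Suc N" "i \<le> N"
        then show "h \<kappa> * m i \<in> ?X"
          using Suc.IH[of "h \<kappa> # xs" i] Suc.prems(1) by (simp add: mult_ac)
      qed
      then show ?case by (simp add: mult_ac)
    qed
    obtain i where i: "i \<le> N" "m i \<in> homog_nonzero r n"
    proof (cases "a = 0")
      case True
      then have "m 0 \<in> homog_nonzero r n" using b nz by (auto simp: m_def intro: homog_nonzero_power)
      then show ?thesis using that[of 0] by simp
    next
      case False
      then have "m N \<in> homog_nonzero r n" using a by (auto simp: m_def intro: homog_nonzero_power)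
      then show ?thesis using that[of N] by simp
    qed
    have "(A * m i) * y ^ l \<in> ideal_power r n I (k * l)" for l
      using main[of "[]" i l] i(1) by (simp add: mult_ac)
    then show ?thesis
      using homog_nonzero_mult[OF A(1) i(2)] y unfolding almost_integral_def by blast
  qed
  have step: "a ^ e * b ^ (Suc N - e) * coeff G \<kappa> \<in> X"
    if X: "\<And>u v. u \<in> X \<Longrightarrow> v \<in> X \<Longrightarrow> u - v \<in> X"
      "\<And>\<kappa> i. \<kappa> \<le> Suc N \<Longrightarrow> i \<le> N \<Longrightarrow> h \<kappa> * m i \<in> X" and "\<kappa> \<le> N" "e \<le> Suc N" for X e \<kappa>
  proof -
    have d: "x - y \<in> X" if "x \<in> X" "y \<in> X" for x y using that by (rule X(1))
    have h0: "a * coeff G 0 * (a ^ i * b ^ (N - i)) \<in> X" if "i \<le> N" for i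
      using X(2)[of 0 i] that by (simp add: h_0 m_def)
    have h: "(a * coeff G (Suc \<kappa>) + b * coeff G \<kappa>) * (a ^ i * b ^ (N - i)) \<in> X" if "\<kappa> \<le> N" "i \<le> N" for \<kappa> i
      using X(2)[of "Suc \<kappa>" i] that by (simp add: h_Suc m_def)
    have top: "coeff G (Suc N) = 0" unfolding N_def by (rule coeff_eq_0) simp
    show ?thesis
      by (rule linear_content_step[where X = X and N = N and g = "coeff G" and a = a and b = b])
        (fact d h0 h top that(3,4))+
  qed
  have "a * coeff G i \<in> almost_integral r n I k \<and> b * coeff G i \<in> almost_integral r n I k"
  proof (cases "a = 0 \<and> b = 0")
    case True
    then show ?thesis using almost_integral_0 by auto
  next
    case nz: False
    show ?thesis
    proof (cases "i \<le> N")
      case False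
      then have "coeff G i = 0" unfolding N_def by (intro coeff_eq_0) simp
      then show ?thesis using almost_integral_0 by simp
    next
      case True
      have "a * coeff G i * m j \<in> X" "b * coeff G i * m j \<in> X"
        if X: "\<And>u v. u \<in> X \<Longrightarrow> v \<in> X \<Longrightarrow> u - v \<in> X"
          "\<And>\<kappa> i. \<kappa> \<le> Suc N \<Longrightarrow> i \<le> N \<Longrightarrow> h \<kappa> * m i \<in> X" and j: "j \<le> N" for X j
        using step[OF X True, of "Suc j"] step[OF X True, of j] j
        by (simp_all add: m_def Suc_diff_le mult_ac)
      then show ?thesis using aR bR G by (intro conjI key[OF nz] RR_mult) auto
    qed
  qed
  then show "a * coeff G i \<in> almost_integral r n I k" "b * coeff G i \<in> almost_integral r n I k" by auto
qed

text \<open>The linear factors are split off one at a time, each time keeping either of its two coefficients.\<close>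

lemma linear_product_content:
  assumes "\<And>a b. (a, b) \<in> set L \<Longrightarrow> a \<in> insert 0 (homog_nonzero r n) \<and> b \<in> insert 0 (homog_nonzero r n)"
    and "\<And>i. coeff G i \<in> RR r n"
    and "\<And>i. coeff ((\<Prod>(a, b)\<leftarrow>L. [:a, b:]) * G) i \<in> almost_integral r n I k"
    and "list_all2 (\<lambda>c (a, b). c = a \<or> c = b) cs L"
  shows "prod_list cs * coeff G i \<in> almost_integral r n I k"
  using assms
proof (induction L arbitrary: cs G i)
  case Nil
  then show ?case by simp
next
  case (Cons ab L)
  obtain a b where ab: "ab = (a, b)" by (cases ab)
  obtain c cs' where cs: "cs = c # cs'" "c = a \<or> c = b" "list_all2 (\<lambda>c (a, b). c = a \<or> c = b) cs' L"
    using Cons.prems(4) ab by (cases cs) auto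
  have hom: "a \<in> insert 0 (homog_nonzero r n)" "b \<in> insert 0 (homog_nonzero r n)"
    using Cons.prems(1)[of a b] ab by auto
  then have abR: "a \<in> RR r n" "b \<in> RR r n" using homog_nonzero_RR by auto
  have csR: "prod_list cs' \<in> RR r n"
  proof (rule RR_prod_list)
    fix x assume "x \<in> set cs'"
    then obtain a' b' where "(a', b') \<in> set L" "x = a' \<or> x = b'"
      using cs(3) by (fastforce simp: list_all2_conv_all_nth in_set_conv_nth)
    then have "x \<in> insert 0 (homog_nonzero r n)" using Cons.prems(1)[of a' b'] by auto
    then show "x \<in> RR r n" using homog_nonzero_RR by auto
  qed
  have IH: "prod_list cs' * coeff ([:a, b:] * G) j \<in> almost_integral r n I k" for j
  proof (rule Cons.IH)
    show "coeff ([:a, b:] * G) j \<in> RR r n" for j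
      using Cons.prems(2) abR by (cases j) (auto intro: RR_add RR_mult)
    show "coeff ((\<Prod>(a, b)\<leftarrow>L. [:a, b:]) * ([:a, b:] * G)) i \<in> almost_integral r n I k" for i
      using Cons.prems(3)[of i] unfolding ab by (simp only: list.map prod_list.Cons prod.case mult_ac)
  qed (use Cons.prems(1) cs(3) in auto)
  have "coeff ([:a, b:] * smult (prod_list cs') G) j \<in> almost_integral r n I k" for j
    using IH[of j] by (simp only: mult_smult_right coeff_smult)
  then have "a * coeff (smult (prod_list cs') G) i \<in> almost_integral r n I k"
    "b * coeff (smult (prod_list cs') G) i \<in> almost_integral r n I k"
    by (intro linear_content[OF hom]; use csR Cons.prems(2) in \<open>auto intro: RR_mult\<close>)+
  then show ?case using cs by (auto simp: mult.assoc)
qed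

text \<open>Newton interpolation at pairwise distinct constants, which exist in abundance since the field is
  infinite; the set \<open>S\<close> collects the points already used.\<close>

lemma coefficients_almost_integral:
  fixes F :: "'k mpoly poly"
  assumes "finite S" "\<And>\<tau>. \<tau> \<notin> S \<Longrightarrow> poly F (Const \<tau>) \<in> almost_integral r n I k"
  shows "coeff F i \<in> almost_integral r n I k"
  using assms
proof (induction "degree F" arbitrary: F S i rule: less_induct)
  case less
  interpret C: comm_ring_hom "Const :: 'k \<Rightarrow> 'k mpoly" by (rule Const_hom)
  obtain \<tau>0 where \<tau>0: "\<tau>0 \<notin> S" using ex_new_if_finite[OF infinite_UNIV_char_0 less.prems(1)] by blast
  show ?case
  proof (cases "degree F = 0")
    case True
    then obtain c where "F = [:c:]" by (rule degree_eq_zeroE)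
    then have "c \<in> almost_integral r n I k" using less.prems(2)[OF \<tau>0] by simp
    then show ?thesis using \<open>F = [:c:]\<close> almost_integral_0 by (cases i) auto
  next
    case False
    define G where "G = synthetic_div F (Const \<tau>0)"
    have FG: "F = [:- Const \<tau>0, 1:] * G + [:poly F (Const \<tau>0):]"
      unfolding G_def using synthetic_div_correct'[of "Const \<tau>0" F] by simp
    have degG: "degree G < degree F" using False by (simp add: G_def degree_synthetic_div)
    have p0: "poly F (Const \<tau>0) \<in> almost_integral r n I k" by (rule less.prems(2)[OF \<tau>0])
    have neg: "- x \<in> almost_integral r n I k" if "x \<in> almost_integral r n I k" for x
      using almost_integral_mult[OF RR_uminus[OF RR_1] that] by simp
    have Gc: "coeff G j \<in> almost_integral r n I k" for j
    proof (rule less.hyps[OF degG])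
      show "finite (insert \<tau>0 S)" using less.prems(1) by simp
      fix \<tau> assume \<tau>: "\<tau> \<notin> insert \<tau>0 S"
      have "poly F (Const \<tau>) = (Const \<tau> - Const \<tau>0) * poly G (Const \<tau>) + poly F (Const \<tau>0)"
        by (subst FG) (simp add: algebra_simps)
      then have "poly F (Const \<tau>) + - poly F (Const \<tau>0) = Const (\<tau> - \<tau>0) * poly G (Const \<tau>)"
        by (simp add: C.hom_minus)
      moreover have "poly F (Const \<tau>) + - poly F (Const \<tau>0) \<in> almost_integral r n I k"
        using \<tau> by (intro almost_integral_add neg p0 less.prems(2)) auto
      ultimately have "Const (inverse (\<tau> - \<tau>0)) * (Const (\<tau> - \<tau>0) * poly G (Const \<tau>)) \<in> almost_integral r n I k"
        using almost_integral_mult[OF RR_Const] by metis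
      moreover have "Const (inverse (\<tau> - \<tau>0)) * Const (\<tau> - \<tau>0) = 1"
        using \<tau> by (simp add: C.hom_mult[symmetric] del: C.hom_mult C.hom_minus)
      ultimately show "poly G (Const \<tau>) \<in> almost_integral r n I k"
        by (simp only: mult.assoc[symmetric] mult_1)
    qed
    have "coeff F i = (- Const \<tau>0) * coeff G i + (if i = 0 then poly F (Const \<tau>0) else coeff G (i - 1))"
      by (subst FG) (cases i; simp)
    moreover have "(- Const \<tau>0) * coeff G i \<in> almost_integral r n I k"
      by (intro almost_integral_mult RR_uminus RR_Const Gc)
    moreover have "(if i = 0 then poly F (Const \<tau>0) else coeff G (i - 1)) \<in> almost_integral r n I k"
      using p0 Gc by simp
    ultimately show ?thesis by (simp only: almost_integral_add)
  qed
qed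

end

text \<open>The image of the multiplier is again a multiplier, provided that it is nonzero.\<close>

lemma almost_integral_lin_subst:
  fixes I :: "'k::field_char_0 mpoly set"
  assumes I: "invariant_ideal r n I" and A: "A \<in> GL r" and B: "B \<in> GL n"
    and inj: "\<And>f. f \<in> RR r n \<Longrightarrow> lin_subst r n A B f = 0 \<Longrightarrow> f = 0"
    and f: "f \<in> almost_integral r n I k"
  shows "lin_subst r n A B f \<in> almost_integral r n I k"
proof -
  interpret h: comm_ring_hom "lin_subst r n A B" by (rule lin_subst_hom)
  obtain a where a: "a \<in> homog_nonzero r n" "\<And>l. a * f ^ l \<in> ideal_power r n I (k * l)" and fR: "f \<in> RR r n"
    using f by (auto simp: almost_integral_def)
  have "lin_subst r n A B a \<in> homog_nonzero r n"
    using a(1) homogeneous_lin_subst[of _ a r n A B] inj[of a] lin_subst_RR[of a r n A B]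
    by (auto simp: homog_nonzero_def)
  moreover have "lin_subst r n A B a * lin_subst r n A B f ^ l \<in> ideal_power r n I (k * l)" for l
    using ideal_power_lin_subst[OF I A B a(2)[of l]] by (simp add: h.hom_mult h.hom_power)
  ultimately show ?thesis using lin_subst_RR[OF fR] unfolding almost_integral_def by blast
qed

section \<open>Exchanging sizes in products of minors\<close>

definition row_op :: "nat \<Rightarrow> nat \<Rightarrow> 'k::field_char_0 \<Rightarrow> 'k mpoly \<Rightarrow> 'k mpoly" where
  "row_op i l \<tau> = poly_eval Const (\<lambda>(a, b). Var a b + (if a = i then Const \<tau> * Var l b else 0))"

definition col_op :: "nat \<Rightarrow> nat \<Rightarrow> 'k::field_char_0 \<Rightarrow> 'k mpoly \<Rightarrow> 'k mpoly" where
  "col_op i l \<tau> = poly_eval Const (\<lambda>(a, b). Var a b + (if b = i then Const \<tau> * Var a l else 0))"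

lemma row_op_hom: "comm_ring_hom (row_op i l \<tau>)" and col_op_hom: "comm_ring_hom (col_op i l \<tau>)"
  unfolding row_op_def col_op_def by (rule poly_eval_hom[OF Const_hom])+

lemma row_op_inverse:
  assumes "i \<noteq> l" shows "row_op i l (- \<tau>) (row_op i l \<tau> f) = f"
proof -
  interpret h: comm_ring_hom "row_op i l (- \<tau>)" by (rule row_op_hom)
  interpret C: comm_ring_hom "Const :: 'a \<Rightarrow> _" by (rule Const_hom)
  have C: "row_op i l (- \<tau>) (Const c) = Const c" for c
    by (simp add: row_op_def poly_eval_Const[OF Const_hom])
  have V: "row_op i l (- \<tau>) (Var a b) = Var a b + (if a = i then Const (- \<tau>) * Var l b else 0)" for a b
    by (simp add: row_op_def poly_eval_Var[OF Const_hom])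
  have "row_op i l (- \<tau>) (row_op i l \<tau> f) = poly_eval (\<lambda>c. row_op i l (- \<tau>) (Const c))
     (\<lambda>v. row_op i l (- \<tau>) (case v of (a, b) \<Rightarrow> Var a b + (if a = i then Const \<tau> * Var l b else 0))) f"
    unfolding row_op_def[of i l \<tau>] by (rule hom_poly_eval[OF Const_hom row_op_hom])
  also have "\<dots> = poly_eval Const (\<lambda>(a, b). Var a b) f"
    unfolding C
    by (rule arg_cong2[where f = "poly_eval Const"])
       (use assms in \<open>auto simp: fun_eq_iff h.hom_add h.hom_mult C V C.hom_uminus\<close>)
  finally show ?thesis by (simp add: poly_eval_identity)
qed

lemma col_op_inverse:
  assumes "i \<noteq> l" shows "col_op i l (- \<tau>) (col_op i l \<tau> f) = f"
proof -
  interpret h: comm_ring_hom "col_op i l (- \<tau>)" by (rule col_op_hom)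
  interpret C: comm_ring_hom "Const :: 'a \<Rightarrow> _" by (rule Const_hom)
  have C: "col_op i l (- \<tau>) (Const c) = Const c" for c
    by (simp add: col_op_def poly_eval_Const[OF Const_hom])
  have V: "col_op i l (- \<tau>) (Var a b) = Var a b + (if b = i then Const (- \<tau>) * Var a l else 0)" for a b
    by (simp add: col_op_def poly_eval_Var[OF Const_hom])
  have "col_op i l (- \<tau>) (col_op i l \<tau> f) = poly_eval (\<lambda>c. col_op i l (- \<tau>) (Const c))
     (\<lambda>v. col_op i l (- \<tau>) (case v of (a, b) \<Rightarrow> Var a b + (if b = i then Const \<tau> * Var a l else 0))) f"
    unfolding col_op_def[of i l \<tau>] by (rule hom_poly_eval[OF Const_hom col_op_hom])
  also have "\<dots> = poly_eval Const (\<lambda>(a, b). Var a b) f"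
    unfolding C
    by (rule arg_cong2[where f = "poly_eval Const"])
       (use assms in \<open>auto simp: fun_eq_iff h.hom_add h.hom_mult C V C.hom_uminus\<close>)
  finally show ?thesis by (simp add: poly_eval_identity)
qed

type_synonym minor_index = "nat \<times> (nat \<Rightarrow> nat) \<times> (nat \<Rightarrow> nat)"

definition valid_index :: "nat \<Rightarrow> nat \<Rightarrow> minor_index \<Rightarrow> bool" where
  "valid_index r n = (\<lambda>(s, \<rho>, \<kappa>). inj_on \<rho> {..<s} \<and> inj_on \<kappa> {..<s}
     \<and> (\<forall>x<s. \<rho> x < r \<and> \<kappa> x < n))"

definition index_minor :: "minor_index \<Rightarrow> 'k::field_char_0 mpoly" where
  "index_minor t = gen_minor (fst t) (fst (snd t)) (snd (snd t))"

lemma index_minor_simps [simp]: "index_minor (s, \<rho>, \<kappa>) = gen_minor s \<rho> \<kappa>"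
  by (simp only: index_minor_def fst_conv snd_conv)

lemma gen_minor_homog:
  assumes "\<And>x. x < s \<Longrightarrow> \<rho> x < r \<and> \<kappa> x < n"
  shows "(gen_minor s \<rho> \<kappa> :: 'k::field_char_0 mpoly) \<in> insert 0 (homog_nonzero r n)"
proof -
  have "(gen_minor s \<rho> \<kappa> :: 'k mpoly) \<in> RR r n" by (rule gen_minor_RR) (use assms in auto)
  moreover have "homogeneous_of_degree s (gen_minor s \<rho> \<kappa> :: 'k mpoly)" by (rule homogeneous_gen_minor)
  ultimately show ?thesis by (auto simp: homog_nonzero_def)
qed

lemma row_op_minor:
  assumes "inj_on \<rho> {..<s}"
  shows "row_op i l \<tau> (gen_minor s \<rho> \<kappa>) = gen_minor s \<rho> \<kappa>
    + Const \<tau> * (if i \<in> \<rho> ` {..<s} then gen_minor s (redirect i l \<rho>) \<kappa> else 0)"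
  unfolding row_op_def poly_eval_minor[OF Const_hom]
  using minor_row_add[OF assms, where E = "\<lambda>(a, b). Var a b" and i = i and c = "Const \<tau>" and k = l, unfolded prod.case] .

lemma col_op_minor:
  assumes "inj_on \<kappa> {..<s}"
  shows "col_op i l \<tau> (gen_minor s \<rho> \<kappa>) = gen_minor s \<rho> \<kappa>
    + Const \<tau> * (if i \<in> \<kappa> ` {..<s} then gen_minor s \<rho> (redirect i l \<kappa>) else 0)"
  unfolding col_op_def poly_eval_minor[OF Const_hom]
  using minor_col_add[OF assms, where E = "\<lambda>(a, b). Var a b" and i = i and c = "Const \<tau>" and k = l, unfolded prod.case] .

text \<open>Let \<open>N\<^sub>j\<close> be the minor of size \<open>a + 1\<close> with its last column replaced by column \<open>j\<close>.  Summing the expansions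
  of the \<open>N\<^sub>j\<close> along this column against the cofactors of row \<open>a\<close> in the block of size \<open>b\<close> leaves the determinant
  of the block times the leading minor of size \<open>a\<close>.  For \<open>j < a\<close> a column repeats and the term vanishes.\<close>

lemma laplace_exchange:
  fixes E :: "nat \<times> nat \<Rightarrow> 'a::comm_ring_1"
  assumes ab: "a < b"
  shows "minor E a id id * minor E b id id = (\<Sum>j\<in>{a..<b}. (- 1) ^ (a + j) *
     (minor E (Suc a) id (redirect a j id) * minor E (b - 1) (insert_index a) (insert_index j)))"
proof -
  define B where "B = mat b b E"
  define N where "N j = minor E (Suc a) id (redirect a j id)" for j
  define M where "M j = mat (Suc a) (Suc a) (\<lambda>(x, y). E (x, redirect a j id y))" for j
  define cof where "cof x = cofactor (M a) x a" for x
  have B: "B \<in> carrier_mat b b" and M: "M j \<in> carrier_mat (Suc a) (Suc a)" for j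
    by (simp_all add: B_def M_def)
  have NM: "N j = det (M j)" for j by (simp add: N_def minor_def M_def)
  have md: "mat_delete (M j) x a = mat_delete (M a) x a" if "x < Suc a" for j x
  proof (rule eq_matI)
    fix i' j' assume "i' < dim_row (mat_delete (M a) x a)" "j' < dim_col (mat_delete (M a) x a)"
    then have "i' < a" "j' < a" by (simp_all add: M_def)
    then show "mat_delete (M j) x a $$ (i', j') = mat_delete (M a) x a $$ (i', j')"
      using that by (simp add: mat_delete_def M_def redirect_def)
  qed (simp_all add: M_def)
  have cofM: "cofactor (M j) x a = cof x" if "x < Suc a" for j x
    by (simp only: cofactor_def cof_def md[OF that, of j])
  have N_expand: "N j = (\<Sum>x<Suc a. E (x, j) * cof x)" for j
  proof -
    have "N j = (\<Sum>x<Suc a. M j $$ (x, a) * cofactor (M j) x a)"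
      unfolding NM by (rule laplace_expansion_column[OF M]) simp
    also have "\<dots> = (\<Sum>x<Suc a. E (x, j) * cof x)"
    proof (rule sum.cong[OF refl])
      fix x assume "x \<in> {..<Suc a}"
      then have "M j $$ (x, a) = E (x, j)" "cofactor (M j) x a = cof x"
        by (simp_all add: cofM) (simp add: M_def redirect_def)
      then show "M j $$ (x, a) * cofactor (M j) x a = E (x, j) * cof x" by simp
    qed
    finally show ?thesis .
  qed
  have cof_a: "cof a = minor E a id id"
  proof -
    have "mat_delete (M a) a a = mat a a (\<lambda>(x, y). E (id x, id y))"
      by (rule eq_matI) (simp_all add: mat_delete_def M_def redirect_def)
    then show ?thesis by (simp add: cof_def cofactor_def minor_def)
  qed
  have N0: "N j = 0" if "j < a" for j
    unfolding NM
    by (rule det_identical_columns[OF M, of j a]) (use that in \<open>auto simp: M_def redirect_def intro!: eq_vecI\<close>)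
  have cofB: "cofactor B a j = (- 1) ^ (a + j) * minor E (b - 1) (insert_index a) (insert_index j)" if "j < b" for j
  proof -
    have "mat_delete B a j = mat (b - 1) (b - 1) (\<lambda>(x, y). E (insert_index a x, insert_index j y))"
      by (rule eq_matI) (use that ab in \<open>simp_all add: mat_delete_def B_def insert_index_def\<close>)
    then show ?thesis by (simp add: cofactor_def minor_def)
  qed
  have adj: "(\<Sum>j<b. E (x, j) * cofactor B a j) = (if x = a then det B else 0)" if "x < b" for x
  proof -
    have "(B * adj_mat B) $$ (x, a) = (\<Sum>j<b. E (x, j) * cofactor B a j)"
      using that ab by (simp add: adj_mat_def B_def scalar_prod_def atLeast0LessThan)
    then show ?thesis using that ab by (cases "x = a") (simp_all add: adj_mat(2)[OF B])
  qed
  have "(\<Sum>j<b. N j * cofactor B a j) = (\<Sum>j<b. \<Sum>x<Suc a. cof x * (E (x, j) * cofactor B a j))"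
    unfolding N_expand sum_distrib_right by (intro sum.cong refl) (simp add: mult_ac)
  also have "\<dots> = (\<Sum>x<Suc a. cof x * (\<Sum>j<b. E (x, j) * cofactor B a j))"
    by (subst sum.swap) (simp only: sum_distrib_left)
  also have "\<dots> = (\<Sum>x<Suc a. cof x * (if x = a then det B else 0))"
    by (intro sum.cong refl) (use ab in \<open>simp add: adj\<close>)
  also have "\<dots> = cof a * det B" by simp
  also have "\<dots> = minor E a id id * minor E b id id"
  proof -
    have "B = mat b b (\<lambda>(x, y). E (id x, id y))" by (auto simp: B_def)
    then show ?thesis by (simp add: cof_a minor_def)
  qed
  finally have "minor E a id id * minor E b id id = (\<Sum>j<b. N j * cofactor B a j)" ..
  also have "\<dots> = (\<Sum>j\<in>{a..<b}. N j * cofactor B a j)"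
    by (rule sum.mono_neutral_right) (auto simp: N0)
  also have "\<dots> = (\<Sum>j\<in>{a..<b}. (- 1) ^ (a + j) * (N j * minor E (b - 1) (insert_index a) (insert_index j)))"
    by (intro sum.cong refl) (simp add: cofB mult_ac)
  finally show ?thesis by (simp add: N_def)
qed

lemma redirect_insert_index: "redirect c (Suc c) (insert_index (Suc c)) = insert_index c"
  by (auto simp: fun_eq_iff redirect_def insert_index_def)

context
  fixes r n :: nat and I :: "'k::field_char_0 mpoly set" and k :: nat
  assumes inv: "invariant_ideal r n I"
begin

private lemma I: "ideal I (coord_ring r n)"
  using inv by (simp add: invariant_ideal_def)

lemma row_op_almost_integral:
  assumes "f \<in> almost_integral r n I k" "i < r" "l < r" "i \<noteq> l"
  shows "row_op i l \<tau> f \<in> almost_integral r n I k"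
proof -
  have eq: "lin_subst r n (addrow_mat r \<tau> i l) (1\<^sub>m n) f = row_op i l \<tau> f" if "f \<in> RR r n" for f
    unfolding row_op_def by (rule lin_subst_row[OF that assms(2-4)])
  have "lin_subst r n (addrow_mat r \<tau> i l) (1\<^sub>m n) f \<in> almost_integral r n I k"
  proof (rule almost_integral_lin_subst[OF inv _ GL_1 _ assms(1)])
    show "addrow_mat r \<tau> i l \<in> GL r" by (rule addrow_mat_Unit[OF assms(2-4)])
    fix h :: "'k mpoly" assume h: "h \<in> RR r n" "lin_subst r n (addrow_mat r \<tau> i l) (1\<^sub>m n) h = 0"
    interpret o: comm_ring_hom "row_op i l (- \<tau>)" by (rule row_op_hom)
    show "h = 0" using row_op_inverse[OF assms(4), of \<tau> h] h by (simp add: eq)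
  qed
  then show ?thesis using eq almost_integral_RR[OF I assms(1)] by simp
qed

lemma col_op_almost_integral:
  assumes "f \<in> almost_integral r n I k" "i < n" "l < n" "i \<noteq> l"
  shows "col_op i l \<tau> f \<in> almost_integral r n I k"
proof -
  have eq: "lin_subst r n (1\<^sub>m r) (addrow_mat n \<tau> l i) f = col_op i l \<tau> f" if "f \<in> RR r n" for f
    unfolding col_op_def by (rule lin_subst_col[OF that assms(2-4)])
  have "lin_subst r n (1\<^sub>m r) (addrow_mat n \<tau> l i) f \<in> almost_integral r n I k"
  proof (rule almost_integral_lin_subst[OF inv GL_1 _ _ assms(1)])
    show "addrow_mat n \<tau> l i \<in> GL n" by (rule addrow_mat_Unit) (use assms in auto)
    fix h :: "'k mpoly" assume h: "h \<in> RR r n" "lin_subst r n (1\<^sub>m r) (addrow_mat n \<tau> l i) h = 0"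
    interpret o: comm_ring_hom "col_op i l (- \<tau>)" by (rule col_op_hom)
    show "h = 0" using col_op_inverse[OF assms(4), of \<tau> h] h by (simp add: eq)
  qed
  then show ?thesis using eq almost_integral_RR[OF I assms(1)] by simp
qed

text \<open>As a polynomial in \<open>\<tau>\<close> the product has almost integral coefficients by interpolation, and its content
  is controlled factor by factor: every choice of one summand per factor gives an almost integral
  product.  The conclusion takes the \<open>B\<close> summand in the first factor only.\<close>

lemma separate_factor:
  fixes A B :: "'x \<Rightarrow> 'k mpoly"
  assumes hom: "\<And>x. x \<in> set (x0 # L) \<Longrightarrow> A x \<in> insert 0 (homog_nonzero r n) \<and> B x \<in> insert 0 (homog_nonzero r n)"
    and all: "\<And>\<tau>. (\<Prod>x\<leftarrow>x0 # L. A x + Const \<tau> * B x) \<in> almost_integral r n I k"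
  shows "B x0 * (\<Prod>x\<leftarrow>L. A x) \<in> almost_integral r n I k"
proof -
  define F where "F = (\<Prod>(a, b)\<leftarrow>map (\<lambda>x. (A x, B x)) (x0 # L). [:a, b:])"
  have "poly F (Const \<tau>) = (\<Prod>x\<leftarrow>x0 # L. A x + Const \<tau> * B x)" for \<tau>
  proof -
    have "poly (\<Prod>(a, b)\<leftarrow>map (\<lambda>x. (A x, B x)) xs. [:a, b:]) (Const \<tau>) = (\<Prod>x\<leftarrow>xs. A x + Const \<tau> * B x)" for xs
      by (induction xs) (simp_all add: algebra_simps)
    then show ?thesis by (simp only: F_def)
  qed
  then have F: "coeff F i \<in> almost_integral r n I k" for i
    using coefficients_almost_integral[OF I, of "{}" F k i] all by simp
  have "prod_list (B x0 # map A L) * coeff 1 0 \<in> almost_integral r n I k"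
  proof (rule linear_product_content[OF I, where L = "map (\<lambda>x. (A x, B x)) (x0 # L)" and G = 1])
    show "coeff ((\<Prod>(a, b)\<leftarrow>map (\<lambda>x. (A x, B x)) (x0 # L). [:a, b:]) * 1) i \<in> almost_integral r n I k" for i
      using F[of i] by (simp only: F_def mult_1_right)
    show "coeff 1 i \<in> RR r n" for i by (cases i) auto
    show "list_all2 (\<lambda>c (a, b). c = a \<or> c = b) (B x0 # map A L) (map (\<lambda>x. (A x, B x)) (x0 # L))"
      by (simp, simp add: list_all2_conv_all_nth)
  qed (use hom in auto)
  then show ?thesis by simp
qed

text \<open>A transvection with parameter \<open>\<tau>\<close> turns each minor that contains row \<open>i\<close> into a linear polynomial in
  \<open>\<tau>\<close>, and \<open>separate_factor\<close> isolates the change in a single factor.\<close>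

lemma row_move:
  assumes valid: "\<And>t. t \<in> set ((s, \<rho>, \<kappa>) # L) \<Longrightarrow> valid_index r n t"
    and prod: "gen_minor s \<rho> \<kappa> * (\<Prod>t\<leftarrow>L. index_minor t) \<in> almost_integral r n I k"
    and i: "i \<in> \<rho> ` {..<s}" "i \<noteq> l" "l < r"
  shows "gen_minor s (redirect i l \<rho>) \<kappa> * (\<Prod>t\<leftarrow>L. index_minor t) \<in> almost_integral r n I k"
proof -
  define B :: "minor_index \<Rightarrow> 'k mpoly" where "B = (\<lambda>(s, \<rho>, \<kappa>). if i \<in> \<rho> ` {..<s} then gen_minor s (redirect i l \<rho>) \<kappa> else 0)"
  have ir: "i < r" using valid[of "(s, \<rho>, \<kappa>)"] i by (auto simp: valid_index_def)
  have "B (s, \<rho>, \<kappa>) * (\<Prod>t\<leftarrow>L. index_minor t) \<in> almost_integral r n I k"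
  proof (rule separate_factor)
    fix t assume tin: "t \<in> set ((s, \<rho>, \<kappa>) # L)"
    obtain s' \<rho>' \<kappa>' where t: "t = (s', \<rho>', \<kappa>')" by (cases t)
    have v: "\<forall>x<s'. \<rho>' x < r \<and> \<kappa>' x < n" using valid[OF tin] by (simp add: t valid_index_def)
    have "(gen_minor s' \<rho>' \<kappa>' :: 'k mpoly) \<in> insert 0 (homog_nonzero r n)"
      by (rule gen_minor_homog) (use v in auto)
    moreover have "(gen_minor s' (redirect i l \<rho>') \<kappa>' :: 'k mpoly) \<in> insert 0 (homog_nonzero r n)"
      by (rule gen_minor_homog) (use v i(3) in \<open>auto simp: redirect_def\<close>)
    ultimately show "(index_minor t :: 'k mpoly) \<in> insert 0 (homog_nonzero r n) \<and> B t \<in> insert 0 (homog_nonzero r n)"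
      by (simp add: t B_def)
  next
    fix \<tau> :: 'k
    interpret o: comm_ring_hom "row_op i l \<tau>" by (rule row_op_hom)
    have "row_op i l \<tau> (\<Prod>t\<leftarrow>(s, \<rho>, \<kappa>) # L. index_minor t) = (\<Prod>t\<leftarrow>(s, \<rho>, \<kappa>) # L. row_op i l \<tau> (index_minor t))"
      by (simp only: o.hom_prod_list map_map comp_def)
    also have "\<dots> = (\<Prod>t\<leftarrow>(s, \<rho>, \<kappa>) # L. index_minor t + Const \<tau> * B t)"
    proof (rule arg_cong[where f = prod_list], rule map_cong[OF refl])
      fix t assume "t \<in> set ((s, \<rho>, \<kappa>) # L)"
      then have "valid_index r n t" by (rule valid)
      then show "row_op i l \<tau> (index_minor t) = index_minor t + Const \<tau> * B t"
        by (cases t) (auto simp: B_def valid_index_def row_op_minor)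
    qed
    finally show "(\<Prod>t\<leftarrow>(s, \<rho>, \<kappa>) # L. index_minor t + Const \<tau> * B t) \<in> almost_integral r n I k"
      using row_op_almost_integral[OF prod ir i(3,2), of \<tau>] by simp
  qed
  then show ?thesis using i(1) by (simp add: B_def)
qed

lemma col_move:
  assumes valid: "\<And>t. t \<in> set ((s, \<rho>, \<kappa>) # L) \<Longrightarrow> valid_index r n t"
    and prod: "gen_minor s \<rho> \<kappa> * (\<Prod>t\<leftarrow>L. index_minor t) \<in> almost_integral r n I k"
    and i: "i \<in> \<kappa> ` {..<s}" "i \<noteq> l" "l < n"
  shows "gen_minor s \<rho> (redirect i l \<kappa>) * (\<Prod>t\<leftarrow>L. index_minor t) \<in> almost_integral r n I k"
proof -
  define B :: "minor_index \<Rightarrow> 'k mpoly" where "B = (\<lambda>(s, \<rho>, \<kappa>). if i \<in> \<kappa> ` {..<s} then gen_minor s \<rho> (redirect i l \<kappa>) else 0)"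
  have ir: "i < n" using valid[of "(s, \<rho>, \<kappa>)"] i by (auto simp: valid_index_def)
  have "B (s, \<rho>, \<kappa>) * (\<Prod>t\<leftarrow>L. index_minor t) \<in> almost_integral r n I k"
  proof (rule separate_factor)
    fix t assume tin: "t \<in> set ((s, \<rho>, \<kappa>) # L)"
    obtain s' \<rho>' \<kappa>' where t: "t = (s', \<rho>', \<kappa>')" by (cases t)
    have v: "\<forall>x<s'. \<rho>' x < r \<and> \<kappa>' x < n" using valid[OF tin] by (simp add: t valid_index_def)
    have "(gen_minor s' \<rho>' \<kappa>' :: 'k mpoly) \<in> insert 0 (homog_nonzero r n)"
      by (rule gen_minor_homog) (use v in auto)
    moreover have "(gen_minor s' \<rho>' (redirect i l \<kappa>') :: 'k mpoly) \<in> insert 0 (homog_nonzero r n)"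
      by (rule gen_minor_homog) (use v i(3) in \<open>auto simp: redirect_def\<close>)
    ultimately show "(index_minor t :: 'k mpoly) \<in> insert 0 (homog_nonzero r n) \<and> B t \<in> insert 0 (homog_nonzero r n)"
      by (simp add: t B_def)
  next
    fix \<tau> :: 'k
    interpret o: comm_ring_hom "col_op i l \<tau>" by (rule col_op_hom)
    have "col_op i l \<tau> (\<Prod>t\<leftarrow>(s, \<rho>, \<kappa>) # L. index_minor t) = (\<Prod>t\<leftarrow>(s, \<rho>, \<kappa>) # L. col_op i l \<tau> (index_minor t))"
      by (simp only: o.hom_prod_list map_map comp_def)
    also have "\<dots> = (\<Prod>t\<leftarrow>(s, \<rho>, \<kappa>) # L. index_minor t + Const \<tau> * B t)"
    proof (rule arg_cong[where f = prod_list], rule map_cong[OF refl])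
      fix t assume "t \<in> set ((s, \<rho>, \<kappa>) # L)"
      then have "valid_index r n t" by (rule valid)
      then show "col_op i l \<tau> (index_minor t) = index_minor t + Const \<tau> * B t"
        by (cases t) (auto simp: B_def valid_index_def col_op_minor)
    qed
    finally show "(\<Prod>t\<leftarrow>(s, \<rho>, \<kappa>) # L. index_minor t + Const \<tau> * B t) \<in> almost_integral r n I k"
      using col_op_almost_integral[OF prod ir i(3,2), of \<tau>] by simp
  qed
  then show ?thesis using i(1) by (simp add: B_def)
qed

text \<open>By \<open>laplace_exchange\<close> the product of leading minors of sizes \<open>a\<close> and \<open>y + 1\<close> is a combination of products
  of minors of sizes \<open>a + 1\<close> and \<open>y\<close>.  Each of these is reached from the leading minors of these sizes by moving
  single rows and columns.\<close>

lemma exchange_step: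
  assumes valid: "\<And>t. t \<in> set L \<Longrightarrow> valid_index r n t"
    and xy: "Suc a \<le> y" "y < r" "r \<le> n"
    and prod: "leading_minor (Suc a) * (leading_minor y * (\<Prod>t\<leftarrow>L. index_minor t)) \<in> almost_integral r n I k"
  shows "leading_minor a * (leading_minor (Suc y) * (\<Prod>t\<leftarrow>L. index_minor t)) \<in> almost_integral r n I k"
proof -
  let ?R = "\<Prod>t\<leftarrow>L. index_minor t :: 'k mpoly"
  let ?x = "(Suc a, id, id) :: minor_index"
  have vx: "valid_index r n ?x" using xy by (auto simp: valid_index_def)
  have ins: "inj_on (insert_index c) {..<y}" "\<forall>x<y. insert_index c x < r \<and> insert_index c x < n" for c
    using xy by (auto simp: insert_index_def inj_on_def)
  have idy: "inj_on id {..<y}" "\<forall>x<y. id x < r \<and> id x < n" using xy by auto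
  \<comment> \<open>The list \<open>insert_index c\<close> omits the row \<open>c\<close>.  The gap starts at the end, \<open>c = y\<close>, and moves down by one place
    with every row move.\<close>
  have rows: "gen_minor y (insert_index c) id * (\<Prod>t\<leftarrow>?x # L. index_minor t) \<in> almost_integral r n I k"
    if "c \<le> y" for c
    using that
  proof (induction rule: inc_induct)
    case base
    have "gen_minor y (insert_index y) id = (gen_minor y id id :: 'k mpoly)"
      by (rule minor_cong) simp
    then show ?case using prod by (simp only: list.map prod_list.Cons index_minor_simps mult.left_commute)
  next
    case (step c)
    have "gen_minor y (redirect c (Suc c) (insert_index (Suc c))) id * (\<Prod>t\<leftarrow>?x # L. index_minor t) \<in> almost_integral r n I k"
    proof (rule row_move[OF _ step.IH])
      show "valid_index r n t" if "t \<in> set ((y, insert_index (Suc c), id) # ?x # L)" for t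
        using that vx valid ins[of "Suc c"] idy by (auto simp: valid_index_def)
      show "c \<in> insert_index (Suc c) ` {..<y}" using step.hyps by (intro image_eqI[of _ _ c]) (auto simp: insert_index_def)
    qed (use step.hyps xy in auto)
    then show ?case by (simp only: redirect_insert_index)
  qed
  have cols: "gen_minor y (insert_index a) (insert_index c) * (\<Prod>t\<leftarrow>?x # L. index_minor t) \<in> almost_integral r n I k"
    if "c \<le> y" for c
    using that
  proof (induction rule: inc_induct)
    case base
    have eq: "gen_minor y (insert_index a) (insert_index y) = (gen_minor y (insert_index a) id :: 'k mpoly)"
      by (rule minor_cong) simp
    show ?case unfolding eq by (rule rows) (use xy in simp)
  next
    case (step c)
    have "gen_minor y (insert_index a) (redirect c (Suc c) (insert_index (Suc c))) * (\<Prod>t\<leftarrow>?x # L. index_minor t) \<in> almost_integral r n I k"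
    proof (rule col_move[OF _ step.IH])
      show "valid_index r n t" if "t \<in> set ((y, insert_index a, insert_index (Suc c)) # ?x # L)" for t
        using that vx valid ins[of "Suc c"] ins[of a] by (auto simp: valid_index_def)
      show "c \<in> insert_index (Suc c) ` {..<y}" using step.hyps by (intro image_eqI[of _ _ c]) (auto simp: insert_index_def)
    qed (use step.hyps xy in auto)
    then show ?case by (simp only: redirect_insert_index)
  qed
  have terms: "gen_minor (Suc a) id (redirect a j id) * (gen_minor y (insert_index a) (insert_index j) * ?R) \<in> almost_integral r n I k"
    if j: "a \<le> j" "j \<le> y" for j
  proof -
    have 0: "gen_minor (Suc a) id id * (\<Prod>t\<leftarrow>(y, insert_index a, insert_index j) # L. index_minor t) \<in> almost_integral r n I k"
      using cols[OF j(2)] by (simp only: list.map prod_list.Cons index_minor_simps mult.left_commute)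
    show ?thesis
    proof (cases "j = a")
      case True
      have "redirect a a id = id" by (auto simp: redirect_def)
      then show ?thesis using 0 True by simp
    next
      case False
      have "gen_minor (Suc a) id (redirect a j id) * (\<Prod>t\<leftarrow>(y, insert_index a, insert_index j) # L. index_minor t) \<in> almost_integral r n I k"
      proof (rule col_move[OF _ 0])
        show "valid_index r n t" if "t \<in> set (?x # (y, insert_index a, insert_index j) # L)" for t
          using that vx valid ins[of a] ins[of j] by (auto simp: valid_index_def)
      qed (use False j xy in auto)
      then show ?thesis by simp
    qed
  qed
  have "leading_minor a * (leading_minor (Suc y) * ?R) = (leading_minor a * leading_minor (Suc y)) * ?R"
    by (simp only: mult.assoc)
  also have "\<dots> = (\<Sum>j\<in>{a..<Suc y}. (- 1) ^ (a + j) *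
      (gen_minor (Suc a) id (redirect a j id) * (gen_minor y (insert_index a) (insert_index j) * ?R)))"
    using laplace_exchange[of a "Suc y" "\<lambda>(a, b). Var a b :: 'k mpoly"] xy
    by (simp only: less_Suc_eq_le Suc_leD sum_distrib_right mult.assoc diff_Suc_1)
  finally have eq: "leading_minor a * (leading_minor (Suc y) * ?R) = (\<Sum>j\<in>{a..<Suc y}. (- 1) ^ (a + j) *
      (gen_minor (Suc a) id (redirect a j id) * (gen_minor y (insert_index a) (insert_index j) * ?R)))" .
  have sums: "sum F S \<in> almost_integral r n I k" if "\<And>j. j \<in> S \<Longrightarrow> F j \<in> almost_integral r n I k" for F and S :: "nat set"
    using that by (induction S rule: infinite_finite_induct)
      (auto intro: almost_integral_0[OF I] almost_integral_add[OF I])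
  show ?thesis
    unfolding eq
  proof (rule sums)
    fix j assume "j \<in> {a..<Suc y}"
    then have "gen_minor (Suc a) id (redirect a j id) * (gen_minor y (insert_index a) (insert_index j) * ?R) \<in> almost_integral r n I k"
      by (intro terms) auto
    then show "(- 1) ^ (a + j) * (gen_minor (Suc a) id (redirect a j id) *
        (gen_minor y (insert_index a) (insert_index j) * ?R)) \<in> almost_integral r n I k"
      by (rule almost_integral_mult[OF I RR_power[OF RR_uminus[OF RR_1]]])
  qed
qed

end

section \<open>Spreading sizes\<close>

abbreviation leading_product :: "nat multiset \<Rightarrow> 'k::field_char_0 mpoly" where
  "leading_product M \<equiv> prod_mset (image_mset leading_minor M)"

lemma spread_step:
  fixes I :: "'k::field_char_0 mpoly set"
  assumes inv: "invariant_ideal r n I" and xy: "Suc a \<le> y" "y < r" "r \<le> n"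
    and N: "\<forall>s\<in>#N. s \<le> r"
    and prod: "leading_product (add_mset (Suc a) (add_mset y N)) \<in> almost_integral r n I k"
  shows "leading_product (add_mset a (add_mset (Suc y) N)) \<in> almost_integral r n I k"
proof -
  obtain xs where xs: "N = mset xs" by (metis ex_mset)
  let ?L = "map (\<lambda>s. (s, id, id)) xs"
  have R: "(\<Prod>t\<leftarrow>?L. index_minor t) = (leading_product N :: 'k mpoly)"
    unfolding xs by (induction xs) (simp_all only: list.map prod_list.Nil prod_list.Cons index_minor_simps
        mset.simps image_mset_empty image_mset_add_mset prod_mset.empty prod_mset.add_mset)
  have "leading_minor a * (leading_minor (Suc y) * (\<Prod>t\<leftarrow>?L. index_minor t)) \<in> almost_integral r n I k"
  proof (rule exchange_step[OF inv _ xy])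
    fix t :: minor_index assume "t \<in> set ?L"
    then obtain s where "s \<in> set xs" "t = (s, id, id)" by auto
    then show "valid_index r n t" using N xy(3) by (auto simp: xs valid_index_def)
  next
    show "leading_minor (Suc a) * (leading_minor y * (\<Prod>t\<leftarrow>?L. index_minor t)) \<in> almost_integral r n I k"
      using prod unfolding R by (simp only: image_mset_add_mset prod_mset.add_mset)
  qed
  then show ?thesis unfolding R by (simp only: image_mset_add_mset prod_mset.add_mset)
qed

lemma two_valued_multiset:
  assumes "\<forall>s\<in>#M. s = q \<or> s = r" "q \<noteq> r"
  shows "M = replicate_mset (count M q) q + replicate_mset (count M r) r"
proof (rule multiset_eqI)
  fix s show "count M s = count (replicate_mset (count M q) q + replicate_mset (count M r) r) s"
    using assms by (cases "s \<in># M") (auto simp: not_in_iff)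
qed

text \<open>As long as a size differs from \<open>q\<close> and \<open>r\<close>, so does a second one, because the sum of the sizes is
  fixed.  Moving the smaller one down and the larger one up decreases the sum of \<open>(r - s) (s - q)\<close> over
  the sizes \<open>s\<close>.  The numbers \<open>x\<close> and \<open>c\<close> are determined by the number of factors and the sum of the sizes.\<close>

lemma spread:
  fixes I :: "'k::field_char_0 mpoly set"
  assumes inv: "invariant_ideal r n I" and qr: "q < r" "r \<le> n"
    and N: "\<forall>s\<in>#N. s \<le> r"
  shows "\<forall>s\<in>#M. q \<le> s \<and> s \<le> r \<Longrightarrow> size M = x + c \<Longrightarrow> sum_mset M = q * x + r * c \<Longrightarrow>
    leading_product (M + N) \<in> almost_integral r n I k \<Longrightarrow>
    leading_minor q ^ x * leading_minor r ^ c * leading_product N \<in> almost_integral r n I k"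
proof (induction "\<Sum>s\<in>#M. (r - s) * (s - q)" arbitrary: M rule: less_induct)
  case less
  show ?case
  proof (cases "\<forall>s\<in>#M. s = q \<or> s = r")
    case True
    define x' c' where "x' = count M q" and "c' = count M r"
    have M: "M = replicate_mset x' q + replicate_mset c' r"
      unfolding x'_def c'_def by (rule two_valued_multiset[OF True]) (use qr in simp)
    have "size M = x' + c'" "sum_mset M = x' * q + c' * r"
      by (subst M, simp)+
    then have eqs: "x' + c' = x + c" "q * x' + r * c' = q * x + r * c"
      using less.prems by (simp_all add: mult.commute)
    obtain d where d: "r = q + Suc d" using qr less_imp_Suc_add by auto
    have "q * (x' + c') + Suc d * c' = q * (x + c) + Suc d * c"
      using eqs(2) unfolding d by (simp add: algebra_simps)
    then have "Suc d * c' = Suc d * c" unfolding eqs(1) by (rule add_left_imp_eq)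
    then have "c' = c" by (simp only: mult_cancel1) simp
    then have "x' = x" using eqs(1) by simp
    then show ?thesis using less.prems(4) \<open>c' = c\<close> unfolding M
      by (simp only: image_mset_union prod_mset_Un image_replicate_mset prod_mset_replicate_mset mult.assoc)
  next
    case False
    then obtain s where s: "s \<in># M" "s \<noteq> q" "s \<noteq> r" by auto
    then have s_in: "q < s" "s < r" using less.prems(1) by (auto simp: less_le)
    define M' where "M' = M - {#s#}"
    have M: "M = add_mset s M'" using s(1) by (simp add: M'_def)
    have "\<exists>s'\<in>#M'. s' \<noteq> q \<and> s' \<noteq> r"
    proof (rule ccontr)
      assume no: "\<not> ?thesis"
      define x' c' where "x' = count M' q" and "c' = count M' r"
      have M': "M' = replicate_mset x' q + replicate_mset c' r"
        unfolding x'_def c'_def by (rule two_valued_multiset) (use no qr in auto)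
      have "size M = Suc (x' + c')" "sum_mset M = s + (x' * q + c' * r)"
        unfolding M by (subst M', simp)+
      then have eqs: "Suc (x' + c') = x + c" "s + q * x' + r * c' = q * x + r * c"
        using less.prems by (simp_all add: mult.commute)
      obtain d where d: "r = q + d" using qr less_imp_add_positive by blast
      obtain e where e: "s = q + e" "0 < e" "e < d" using s_in d less_imp_add_positive by (metis nat_add_left_cancel_less)
      have "q * Suc (x' + c') + (e + d * c') = q * (x + c) + d * c"
        using eqs(2) unfolding d e by (simp add: algebra_simps)
      then have "e + d * c' = d * c" using eqs(1) by simp
      \<comment> \<open>Modulo \<open>r - q\<close> a single intermediate size would be visible in the sum of the sizes.\<close>
      then have "d dvd e + d * c'" by simp
      then have "d dvd e" using dvd_add_left_iff[of d "d * c'" e] by simp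
      then show False using e by (auto dest: dvd_imp_le)
    qed
    then obtain s' where s': "s' \<in># M'" "s' \<noteq> q" "s' \<noteq> r" by auto
    then have s'_in: "q < s'" "s' < r" using less.prems(1) M by (auto simp: less_le)
    define M'' where "M'' = M' - {#s'#}"
    have M': "M' = add_mset s' M''" using s'(1) by (simp add: M''_def)
    define lo hi where "lo = min s s'" and "hi = max s s'"
    have M_eq: "M = add_mset lo (add_mset hi M'')"
      unfolding M M' lo_def hi_def by (cases "s \<le> s'") (simp_all add: add_mset_commute)
    have bounds: "q < lo" "lo \<le> hi" "hi < r" using s_in s'_in by (auto simp: lo_def hi_def)
    obtain a where a: "lo = Suc a" "q \<le> a" using bounds by (cases lo) auto
    define M1 where "M1 = add_mset a (add_mset (Suc hi) M'')"
    have step: "leading_product (M1 + N) \<in> almost_integral r n I k"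
    proof -
      have "leading_product (add_mset (Suc a) (add_mset hi (M'' + N))) \<in> almost_integral r n I k"
        using less.prems(4) by (simp only: M_eq a(1) union_mset_add_mset_left)
      then have "leading_product (add_mset a (add_mset (Suc hi) (M'' + N))) \<in> almost_integral r n I k"
        by (intro spread_step[OF inv]) (use bounds a qr N less.prems(1) M_eq in auto)
      then show ?thesis by (simp only: M1_def union_mset_add_mset_left)
    qed
    obtain u v u' v' where uv: "lo = q + Suc u" "hi = q + Suc u'" "r = lo + Suc v" "r = hi + Suc v'"
      using bounds less_imp_Suc_add[of q lo] less_imp_Suc_add[of q hi] less_imp_Suc_add[of lo r] less_imp_Suc_add[of hi r]
      by (metis add_Suc_right le_less_trans less_le_trans)
    have "(r - a) * (a - q) + (r - Suc hi) * (Suc hi - q) < (r - lo) * (lo - q) + (r - hi) * (hi - q)"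
    proof -
      have e: "r - a = Suc (Suc v)" "a - q = u" "r - Suc hi = v'" "Suc hi - q = Suc (Suc u')"
        "r - lo = Suc v" "lo - q = Suc u" "r - hi = Suc v'" "hi - q = Suc u'"
        using uv a by auto
      have "v' + u' = v + u" "u \<le> u'" using uv bounds by auto
      then show ?thesis unfolding e by simp
    qed
    then have smaller: "(\<Sum>s\<in>#M1. (r - s) * (s - q)) < (\<Sum>s\<in>#M. (r - s) * (s - q))"
      by (simp add: M1_def M_eq)
    show ?thesis
    proof (rule less.hyps[OF smaller])
      show "\<forall>s\<in>#M1. q \<le> s \<and> s \<le> r" using less.prems(1) bounds a by (auto simp: M1_def M_eq)
      show "size M1 = x + c" using less.prems(2) by (simp add: M1_def M_eq)
      show "sum_mset M1 = q * x + r * c" using less.prems(3) a by (simp add: M1_def M_eq)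
    qed (rule step)
  qed
qed

section \<open>Small elements of the symbolic powers\<close>

text \<open>An arc that ends in rank \<open>q\<close> is an arc that ends in rank \<open>q'\<close> whose entries \<open>d\<^sub>i\<close> with
  \<open>q \<le> i < q'\<close> are themselves divisible by \<open>t\<close>.\<close>

lemma vanishes_antimono_rank:
  fixes f :: "'k::field_char_0 mpoly"
  assumes "q \<le> q'" "vanishes r q' N f"
  shows "vanishes r q N f"
proof -
  let ?d = "\<lambda>i. if i < q' then tail_scale q [:0, 1:] (\<lambda>i. [:gend i :: 'k mpoly:]) i else [:gend i:]"
  have "tail_scale q' [:0, 1:] ?d = tail_scale q [:0, 1:] (\<lambda>i. [:gend i:])"
    using assms(1) by (auto simp: fun_eq_iff tail_scale_def)
  then show ?thesis
    using vanishes_specialize[OF comm_ring_hom_const_const assms(2), of "[:0, 1:]"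
        "\<lambda>a i. [:genU a i:]" ?d "\<lambda>i b. [:genW i b:]"]
    by (simp add: vanishes_def degenerate_def)
qed

lemma not_vanishes_power:
  "\<not> vanishes r q 1 f \<Longrightarrow> \<not> vanishes r q 1 (f ^ m)"
  by (induction m) (simp_all only: power_0 power_Suc not_vanishes_1_one vanishes_1_mult simp_thms)

text \<open>Start from the power of \<open>K\<^sub>\<sigma>\<close> with exponent \<open>r - q\<close> and spread the sizes greater than \<open>q\<close> to \<open>q\<close> and \<open>r\<close>.
  They contain \<open>(r - q) c\<close> boxes to the right of column \<open>q\<close>, counted from 1, and a factor of size \<open>r\<close> has
  \<open>r - q\<close> of them, so \<open>c\<close> factors of size \<open>r\<close> result.  The remaining factors have size at most \<open>q\<close>, hence
  order zero, and are collected in \<open>u\<close>.\<close>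

lemma witness_exists:
  assumes \<sigma>: "\<sigma> \<in> H r" and rn: "r \<le> n" and q: "q < r"
  defines "c \<equiv> gamma_diagram (Suc q) \<sigma>"
  shows "\<exists>a\<in>homog_nonzero r n. \<exists>u\<in>RR r n. \<not> vanishes r q 1 u \<and>
    (\<forall>l. a * (leading_minor r ^ c * u) ^ l \<in>
       ideal_power r n (I_diagram r n \<sigma> :: 'k::field_char_0 mpoly set) ((r - q) * l))"
proof -
  let ?I = "I_diagram r n \<sigma> :: 'k mpoly set"
  define k where "k = r - q"
  define M0 where "M0 = filter_mset (\<lambda>s. q < s) (mset \<sigma>)"
  define N0 where "N0 = filter_mset (\<lambda>s. \<not> q < s) (mset \<sigma>)"
  have \<sigma>r: "\<forall>s\<in>#mset \<sigma>. s \<le> r" using \<sigma> by (auto simp: H_def)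
  have MN: "mset \<sigma> = M0 + N0" unfolding M0_def N0_def by (rule multiset_partition)
  have inv: "invariant_ideal r n ?I" by (rule invariant_I_diagram[OF \<sigma> rn])
  have id: "ideal ?I (coord_ring r n)" by (rule ideal_I_diagram[OF \<sigma> rn])
  have K: "K_poly r n \<sigma> = (leading_product (mset \<sigma>) :: 'k mpoly)"
    unfolding K_poly_eq[OF \<sigma> rn] by (simp only: mset_map[symmetric] prod_mset_prod_list)
  have rep: "leading_product (repeat_mset m M) = (leading_product M :: 'k mpoly) ^ m" for m M
    by (induction m) (simp_all only: repeat_mset_0 repeat_mset_Suc image_mset_union prod_mset_Un image_mset_empty
        prod_mset.empty power_0 power_Suc)
  have "K_poly r n \<sigma> ^ k \<in> ideal_power r n ?I (1 * k)"
    by (rule ideal_power_elem[OF id ideal_power_1[OF id K_poly_in_I_diagram[OF \<sigma> rn]]])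
  then have "K_poly r n \<sigma> ^ k \<in> almost_integral r n ?I k"
    by (intro ideal_power_almost_integral[OF id]) simp
  then have start: "leading_product (repeat_mset k M0 + repeat_mset k N0) \<in> almost_integral r n ?I k"
    unfolding K rep[symmetric] MN by (simp only: repeat_mset_distrib2)
  have c: "c = (\<Sum>s\<in>#M0. s - q)"
  proof -
    have "c = (\<Sum>s\<in>#mset \<sigma>. s - q)"
      unfolding c_def using gamma_diagram_eq[of \<sigma> r r "Suc q"] \<sigma> by (simp add: sum_mset_sum_list[symmetric])
    also have "\<dots> = (\<Sum>s\<in>#M0. s - q) + (\<Sum>s\<in>#N0. s - q)" unfolding MN by simp
    also have "(\<Sum>s\<in>#N0. s - q) = 0" by (auto simp: N0_def)
    finally show ?thesis by simp
  qed
  have M0: "\<forall>s\<in>#M0. q < s \<and> s \<le> r" using \<sigma>r by (auto simp: M0_def)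
  then have cle: "c \<le> k * size M0" and csum: "sum_mset M0 = c + q * size M0"
  proof -
    have "(\<Sum>s\<in>#M. s - q) \<le> k * size M \<and> sum_mset M = (\<Sum>s\<in>#M. s - q) + q * size M"
      if "\<forall>s\<in>#M. q < s \<and> s \<le> r" for M
      using that by (induction M) (auto simp: k_def)
    then show "c \<le> k * size M0" "sum_mset M0 = c + q * size M0" using M0 c by auto
  qed
  have rep_in: "s \<in># M" if "s \<in># repeat_mset k M" for s :: nat and M
    using that by (simp add: count_greater_zero_iff[symmetric] del: count_greater_zero_iff)
  have N0q: "\<forall>s\<in>#repeat_mset k N0. s \<le> q" using rep_in by (fastforce simp: N0_def)
  define x where "x = k * size M0 - c"
  define u where "u = leading_minor q ^ x * (leading_product (repeat_mset k N0) :: 'k mpoly)"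
  have "leading_minor q ^ x * leading_minor r ^ c * leading_product (repeat_mset k N0) \<in> almost_integral r n ?I k"
  proof (rule spread[OF inv q rn])
    show "\<forall>s\<in>#repeat_mset k N0. s \<le> r" using N0q q by fastforce
    show "\<forall>s\<in>#repeat_mset k M0. q \<le> s \<and> s \<le> r" using M0 rep_in by fastforce
    show "size (repeat_mset k M0) = x + c" using cle by (simp add: x_def)
    have sr: "sum_mset (repeat_mset k M) = k * sum_mset M" for M :: "nat multiset"
      by (induction k) (simp_all only: repeat_mset_0 repeat_mset_Suc sum_mset.union sum_mset.empty mult_0 mult_Suc)
    obtain y where y: "k * size M0 = c + y" using cle le_Suc_ex by blast
    have "k * (c + q * size M0) = k * c + q * (c + y)" by (simp add: y[symmetric] algebra_simps)
    also have "\<dots> = q * y + (k + q) * c" by (simp add: algebra_simps)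
    also have "k + q = r" using q by (simp add: k_def)
    finally show "sum_mset (repeat_mset k M0) = q * x + r * c" unfolding sr csum x_def y by simp
  qed (rule start)
  then have "leading_minor r ^ c * u \<in> almost_integral r n ?I k" by (simp only: u_def mult_ac)
  then obtain a where a: "a \<in> homog_nonzero r n"
    "\<forall>l. a * (leading_minor r ^ c * u) ^ l \<in> ideal_power r n ?I (k * l)"
    by (auto simp: almost_integral_def)
  have "(leading_product M :: 'k mpoly) \<in> RR r n \<and> \<not> vanishes r q 1 (leading_product M :: 'k mpoly)"
    if "\<forall>s\<in>#M. s \<le> q" for M
    using that
  proof (induction M)
    case empty
    show ?case using not_vanishes_1_one by simp
  next
    case (add s M)
    then have "s \<le> q" by simp
    then have "leading_minor s \<in> (RR r n :: 'k mpoly set)" "\<not> vanishes r q 1 (leading_minor s :: 'k mpoly)"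
      using leading_minor_RR[of s r n] leading_minor_not_vanishing[of s q r] q rn by auto
    moreover have "(leading_product M :: 'k mpoly) \<in> RR r n \<and> \<not> vanishes r q 1 (leading_product M :: 'k mpoly)"
      by (rule add.IH) (use add.prems in simp)
    ultimately show ?case
      by (simp only: image_mset_add_mset prod_mset.add_mset vanishes_1_mult RR_mult simp_thms)
  qed
  note lp = this
  have "u \<in> RR r n" "\<not> vanishes r q 1 u"
    unfolding u_def vanishes_1_mult
    using lp[OF N0q] leading_minor_RR[of q r n] leading_minor_not_vanishing[of q q r, where ?'k = 'k] q rn
    by (auto intro!: RR_mult RR_power simp: not_vanishes_power simp del: One_nat_def)
  then show ?thesis using a unfolding k_def by blast
qed

section \<open>The limits\<close>

lemma linear_growth_limit:
  fixes g :: "nat \<Rightarrow> nat" and L A :: real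
  assumes "\<And>m. L * real m \<le> real (g m)" "\<And>m. real (g m) \<le> L * real m + A"
  shows "(\<lambda>m. real (g m) / real m) \<longlonglongrightarrow> L"
proof (rule tendsto_sandwich)
  show "\<forall>\<^sub>F m in sequentially. L \<le> real (g m) / real m"
    using eventually_gt_at_top[of 0] by eventually_elim (use assms in \<open>simp add: field_simps\<close>)
  show "\<forall>\<^sub>F m in sequentially. real (g m) / real m \<le> L + A / real m"
    using eventually_gt_at_top[of 0] by eventually_elim (use assms in \<open>simp add: field_simps\<close>)
  show "(\<lambda>m. L + A / real m) \<longlonglongrightarrow> L"
    using tendsto_add[OF tendsto_const lim_const_over_n[of A]] by simp
qed simp

theorem theorem4p2:
  fixes r n p :: nat and \<Sigma> :: "nat list set" and I :: "'k::field_char_0 mpoly set"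
  assumes "r \<le> n" and "1 \<le> p" and "p \<le> r"
    and "\<Sigma> \<subseteq> H r" and "finite \<Sigma>" and "\<Sigma> \<noteq> {}" and "diagram_antichain \<Sigma>"
    and "I = I_diagrams r n \<Sigma>"
  shows "(\<forall>j\<in>{1..r}.
            (\<lambda>m. real (gamma_ideal r n j (gen_symbolic_power r n p I m)) / real m)
              \<longlonglongrightarrow> (if j \<le> p
                    then (real r - real j + 1) * real (gamma_diagrams p \<Sigma>) / (real r - real p + 1)
                    else real (gamma_diagrams j \<Sigma>))) \<and>
         (\<lambda>m. real (initial_degree (gen_symbolic_power r n p I m)) / real m)
           \<longlonglongrightarrow> real r * real (gamma_diagrams p \<Sigma>) / (real r - real p + 1)"
proof -
  define S where "S m = gen_symbolic_power r n p I m" for m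
  define q where "q = p - 1"
  have p: "p = Suc q" and q: "q < r" using assms(2,3) by (auto simp: q_def)
  have I: "ideal I (coord_ring r n)" unfolding assms(8) by (rule ideal_I_diagrams[OF assms(4,5,1)])
  have S_iff: "f \<in> S m \<longleftrightarrow> f \<in> RR r n \<and> (\<exists>s\<in>RR r n. \<not> vanishes r q 1 s \<and> s * f \<in> ideal_power r n I m)" for f m
    unfolding S_def gen_symbolic_power_iff[OF assms(2,3) I] q_def ..
  have S_RR: "f \<in> RR r n" if "f \<in> S m" for f m using that by (simp add: S_iff)
  have power_S: "f \<in> S m" if "f \<in> ideal_power r n I m" for f m
    unfolding S_iff using that ideal_power_RR[OF I that] not_vanishes_1_one by (auto intro!: bexI[of _ 1])
  have order_S: "m * gamma_diagrams j \<Sigma> \<le> locus_order r (j - 1) f"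
    if f: "f \<in> S m" "f \<noteq> 0" and j: "p \<le> j" "j \<le> r" for f m j
  proof -
    obtain s where s: "s \<in> RR r n" "\<not> vanishes r q 1 s" "s * f \<in> ideal_power r n I m"
      using f(1) by (auto simp: S_iff)
    have "vanishes r (j - 1) (gamma_diagrams j \<Sigma>) x" if "x \<in> I" for x
      by (rule I_diagrams_vanishes[OF assms(4,5,1)]) (use that j assms in auto)
    from ideal_power_vanishes[OF this s(3)]
    have "vanishes r (j - 1) (m * gamma_diagrams j \<Sigma>) (s * f)" .
    moreover have "\<not> vanishes r (j - 1) 1 s"
    proof
      assume "vanishes r (j - 1) 1 s"
      moreover have "q \<le> j - 1" using j(1) unfolding p by linarith
      ultimately have "vanishes r q 1 s" using vanishes_antimono_rank[of q "j - 1" r 1 s] by blast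
      then show False using s(2) by contradiction
    qed
    ultimately have "vanishes r (j - 1) (m * gamma_diagrams j \<Sigma>) f"
      using vanishes_cancel[OF s(1) S_RR[OF f(1)]] by blast
    then show ?thesis using vanishes_iff_le_order[OF S_RR[OF f(1)] f(2)] by simp
  qed
  have gamma_eq: "gamma_poly r n j f = locus_order r (j - 1) f" if "f \<in> S m" "f \<noteq> 0" "1 \<le> j" "j \<le> r" for f m j
    by (rule gamma_poly_eq_locus_order[OF that(3,4) assms(1) S_RR[OF that(1)] that(2)])
  have diagram: "\<exists>\<sigma>\<in>\<Sigma>. gamma_diagram j \<sigma> = gamma_diagrams j \<Sigma>" for j
  proof -
    have "gamma_diagrams j \<Sigma> \<in> gamma_diagram j ` \<Sigma>"
      unfolding gamma_diagrams_def by (rule Min_in) (use assms in auto)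
    then show ?thesis by auto
  qed
  have \<sigma>I: "I_diagram r n \<sigma> \<subseteq> I" if "\<sigma> \<in> \<Sigma>" for \<sigma>
    unfolding assms(8) by (rule I_diagram_subset[OF assms(4,5,1) that])
  have K_in: "K_poly r n \<sigma> ^ m \<in> S m" "(K_poly r n \<sigma> ^ m :: 'k mpoly) \<noteq> 0" if "\<sigma> \<in> \<Sigma>" for \<sigma> m
  proof -
    have "K_poly r n \<sigma> \<in> I" using \<sigma>I[OF that] K_poly_in_I_diagram[of \<sigma> r n] assms(1,4) that by blast
    then have "K_poly r n \<sigma> ^ m \<in> ideal_power r n I (1 * m)"
      by (intro ideal_power_elem[OF I] ideal_power_1[OF I])
    then show "K_poly r n \<sigma> ^ m \<in> S m" by (intro power_S) simp
    show "(K_poly r n \<sigma> ^ m :: 'k mpoly) \<noteq> 0"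
      using K_poly_power_order(1)[of \<sigma> r n 1] assms(1-4) that by auto
  qed
  have gamma_le: "gamma_ideal r n j (S m) \<le> locus_order r (j - 1) f"
    if "f \<in> S m" "f \<noteq> 0" "1 \<le> j" "j \<le> r" for f m j
    unfolding gamma_ideal_def gamma_eq[OF that, symmetric]
    by (rule cInf_lower) (use that in auto)
  have gamma_attained: "\<exists>f\<in>S m. f \<noteq> 0 \<and> gamma_ideal r n j (S m) = locus_order r (j - 1) f"
    if j: "1 \<le> j" "j \<le> r" for m j
  proof -
    obtain \<sigma> where "\<sigma> \<in> \<Sigma>" using assms(6) by auto
    then have "gamma_poly r n j ` (S m - {0}) \<noteq> {}" using K_in[of \<sigma> m] by auto
    then have "gamma_ideal r n j (S m) \<in> gamma_poly r n j ` (S m - {0})"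
      unfolding gamma_ideal_def by (rule Inf_nat_def1)
    then show ?thesis using gamma_eq[OF _ _ j] by auto
  qed
  define c where "c = gamma_diagrams p \<Sigma>"
  obtain \<sigma> where \<sigma>: "\<sigma> \<in> \<Sigma>" "gamma_diagram p \<sigma> = c" using diagram[of p] by (auto simp: c_def)
  have \<sigma>H: "\<sigma> \<in> H r" using \<sigma>(1) assms(4) by auto
  obtain a u where au: "a \<in> homog_nonzero r n" "u \<in> RR r n" "\<not> vanishes r q 1 u"
    "\<And>l. a * (leading_minor r ^ c * u) ^ l \<in> ideal_power r n (I_diagram r n \<sigma> :: 'k mpoly set) ((r - q) * l)"
    using witness_exists[OF \<sigma>H assms(1) q, where ?'k = 'k] \<sigma>(2) unfolding p by auto
  have aR: "a \<in> RR r n" and a0: "a \<noteq> 0" using au(1) by (auto simp: homog_nonzero_def)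
  obtain da where da: "homogeneous_of_degree da a" using au(1) by (auto simp: homog_nonzero_def)
  define \<Delta> :: "'k mpoly" where "\<Delta> = leading_minor r"
  have \<Delta>R: "\<Delta> \<in> RR r n" unfolding \<Delta>_def by (rule leading_minor_RR) (use assms in auto)
  have \<Delta>0: "\<Delta> \<noteq> 0"
    using leading_minor_not_vanishing[of r r r, where ?'k = 'k] by (auto simp: \<Delta>_def simp del: One_nat_def)
  \<comment> \<open>The exponent \<open>l = m div (r - q) + 1\<close> is large enough for \<open>(r - q) l\<close> to exceed \<open>m\<close>.\<close>
  define w where "w m = a * \<Delta> ^ (c * Suc (m div (r - q)))" for m
  have w_S: "w m \<in> S m" and w0: "w m \<noteq> 0" for m
  proof -
    let ?l = "Suc (m div (r - q))"
    have "u ^ ?l * w m = a * (leading_minor r ^ c * u) ^ ?l"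
      by (simp only: w_def \<Delta>_def power_mult power_mult_distrib mult_ac)
    also have "\<dots> \<in> ideal_power r n (I_diagram r n \<sigma>) ((r - q) * ?l)" by (rule au(4))
    also have "\<dots> \<subseteq> ideal_power r n I ((r - q) * ?l)" by (rule ideal_power_mono[OF I \<sigma>I[OF \<sigma>(1)]])
    finally have "u ^ ?l * w m \<in> ideal_power r n I ((r - q) * ?l)" .
    moreover have "m \<le> (r - q) * ?l"
      using q by (metis dividend_less_times_div less_imp_le mult_Suc_right zero_less_diff)
    ultimately have "u ^ ?l * w m \<in> ideal_power r n I m" using ideal_power_antimono[OF I, of m "(r - q) * ?l" "u ^ ?l * w m"] by blast
    moreover have "w m \<in> RR r n" unfolding w_def by (intro RR_mult RR_power aR \<Delta>R)
    ultimately show "w m \<in> S m"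
      unfolding S_iff using RR_power[OF au(2)] not_vanishes_power[OF au(3)] by blast
    show "w m \<noteq> 0" using a0 \<Delta>0 by (simp add: w_def)
  qed
  have l_le: "real (Suc (m div (r - q))) \<le> real m / real (r - q) + 1" for m
    using of_nat_div_le_of_nat[of m "r - q", where ?'a = real] by simp
  have rq: "real r - real p + 1 = real (r - q)" using q by (simp add: p)
  \<comment> \<open>The witnesses \<open>w m\<close> bound the valuation from above, the comparison of orders from below.\<close>
  have limit_low: "(\<lambda>m. real (gamma_ideal r n j (S m)) / real m)
      \<longlonglongrightarrow> (real r - real j + 1) * real c / (real r - real p + 1)" if j: "1 \<le> j" "j \<le> p" for j
  proof -
    define e where "e = r - (j - 1)"
    have jr: "j \<le> r" using j assms(3) by simp
    have e: "real r - real j + 1 = real e" using j jr by (simp add: e_def)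
    have "locus_order r (j - 1) \<Delta> = e"
    proof -
      have "vanishes r (j - 1) N \<Delta> \<longleftrightarrow> N \<le> e" for N
        unfolding \<Delta>_def e_def by (rule vanishes_leading_minor_iff) (use jr in auto)
      then have "N \<le> locus_order r (j - 1) \<Delta> \<longleftrightarrow> N \<le> e" for N
        using vanishes_iff_le_order[OF \<Delta>R \<Delta>0] by simp
      then show ?thesis by (meson le_refl le_antisym)
    qed
    then have w_order: "locus_order r (j - 1) (w m) = locus_order r (j - 1) a + c * Suc (m div (r - q)) * e" for m
      unfolding w_def using locus_order_mult[OF aR RR_power[OF \<Delta>R] a0] locus_order_power[OF \<Delta>R \<Delta>0] \<Delta>0 by simp
    show ?thesis
      unfolding rq e
    proof (rule linear_growth_limit)
      fix m
      obtain f where f: "f \<in> S m" "f \<noteq> 0" "gamma_ideal r n j (S m) = locus_order r (j - 1) f"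
        using gamma_attained[OF j(1) jr] by blast
      have "vanishes r q (m * c) f"
        using order_S[OF f(1,2) le_refl assms(3)] vanishes_iff_le_order[OF S_RR[OF f(1)] f(2)]
        by (simp add: q_def c_def)
      then have "e * (m * c) \<le> (r - q) * locus_order r (j - 1) f"
        unfolding e_def by (rule locus_order_lower_bound[OF S_RR[OF f(1)] f(2)]) (use j q in \<open>auto simp: p\<close>)
      then have "real e * (real m * real c) \<le> real (r - q) * real (gamma_ideal r n j (S m))"
        unfolding f(3) by (simp only: of_nat_mult[symmetric] of_nat_le_iff)
      then show "real e * real c / real (r - q) * real m \<le> real (gamma_ideal r n j (S m))"
        using q by (simp add: field_simps)
    next
      fix m
      have "real (gamma_ideal r n j (S m)) \<le> real (locus_order r (j - 1) a + c * Suc (m div (r - q)) * e)"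
        using gamma_le[OF w_S w0 j(1) jr, of m] w_order[of m] by (simp only: of_nat_le_iff)
      also have "\<dots> = real (locus_order r (j - 1) a) + (real c * real e) * real (Suc (m div (r - q)))"
        by (simp only: of_nat_add of_nat_mult mult_ac)
      also have "\<dots> \<le> real (locus_order r (j - 1) a) + (real c * real e) * (real m / real (r - q) + 1)"
        by (intro add_left_mono mult_left_mono l_le) simp
      also have "\<dots> = real e * real c / real (r - q) * real m + (real (locus_order r (j - 1) a) + real c * real e)"
        by (simp add: algebra_simps)
      finally show "real (gamma_ideal r n j (S m))
         \<le> real e * real c / real (r - q) * real m + (real (locus_order r (j - 1) a) + real c * real e)" .
    qed
  qed
  \<comment> \<open>Here the powers of \<open>K\<^sub>\<tau>\<close> for a diagram \<open>\<tau>\<close> that attains the minimum suffice.\<close>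
  have limit_high: "(\<lambda>m. real (gamma_ideal r n j (S m)) / real m) \<longlonglongrightarrow> real (gamma_diagrams j \<Sigma>)"
    if j: "p \<le> j" "j \<le> r" for j
  proof (rule linear_growth_limit)
    have j1: "1 \<le> j" using j assms(2) by simp
    fix m
    obtain f where f: "f \<in> S m" "f \<noteq> 0" "gamma_ideal r n j (S m) = locus_order r (j - 1) f"
      using gamma_attained[OF j1 j(2)] by blast
    have "m * gamma_diagrams j \<Sigma> \<le> gamma_ideal r n j (S m)"
      using order_S[OF f(1,2) j] f(3) by simp
    then show "real (gamma_diagrams j \<Sigma>) * real m \<le> real (gamma_ideal r n j (S m))"
      by (simp only: of_nat_mult[symmetric] of_nat_le_iff mult.commute)
  next
    have j1: "1 \<le> j" using j assms(2) by simp
    fix m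
    obtain \<tau> where \<tau>: "\<tau> \<in> \<Sigma>" "gamma_diagram j \<tau> = gamma_diagrams j \<Sigma>" using diagram[of j] by auto
    have "gamma_ideal r n j (S m) \<le> m * gamma_diagrams j \<Sigma>"
      using gamma_le[OF K_in[OF \<tau>(1)] j1 j(2), of m] K_poly_power_order(2)[of \<tau> r n j m, where ?'k = 'k] \<tau> assms(1,4) j1 j(2)
      by auto
    then have "gamma_ideal r n j (S m) \<le> gamma_diagrams j \<Sigma> * m" by (simp only: mult.commute)
    then show "real (gamma_ideal r n j (S m)) \<le> real (gamma_diagrams j \<Sigma>) * real m + 0"
      by (simp only: of_nat_mult[symmetric] of_nat_le_iff add_0_right)
  qed
  \<comment> \<open>The witnesses are homogeneous, and the order at rank 0 bounds degrees from below.\<close>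
  have "(\<lambda>m. real (initial_degree (S m)) / real m) \<longlonglongrightarrow> real r * real c / real (r - q)"
  proof (rule linear_growth_limit)
    fix m
    let ?D = "{d. \<exists>f\<in>S m. f \<noteq> 0 \<and> homogeneous_of_degree d f}"
    have hom: "homogeneous_of_degree (da + c * Suc (m div (r - q)) * r) (w m)"
      unfolding w_def \<Delta>_def
      by (intro homogeneous_mult da homogeneous_power homogeneous_gen_minor)
    then have in_D: "da + c * Suc (m div (r - q)) * r \<in> ?D" using w_S w0 by blast
    then have "Inf ?D \<in> ?D" by (intro Inf_nat_def1) blast
    then obtain f where f: "f \<in> S m" "f \<noteq> 0" "homogeneous_of_degree (initial_degree (S m)) f"
      by (auto simp: initial_degree_def)
    have "vanishes r q (m * c) f"
      using order_S[OF f(1,2) le_refl assms(3)] vanishes_iff_le_order[OF S_RR[OF f(1)] f(2)]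
      by (simp add: q_def c_def)
    then have "(r - 0) * (m * c) \<le> (r - q) * locus_order r 0 f"
      by (rule locus_order_lower_bound[OF S_RR[OF f(1)] f(2)]) (use q in auto)
    also have "\<dots> \<le> (r - q) * initial_degree (S m)"
      by (intro mult_le_mono2 locus_order_0_le_degree[OF S_RR[OF f(1)] f(2,3)])
    finally have "r * (m * c) \<le> (r - q) * initial_degree (S m)" by simp
    then have "real r * (real m * real c) \<le> real (r - q) * real (initial_degree (S m))"
      by (simp only: of_nat_mult[symmetric] of_nat_le_iff)
    then show "real r * real c / real (r - q) * real m \<le> real (initial_degree (S m))"
      using q by (simp add: field_simps)
    have "initial_degree (S m) \<le> da + c * Suc (m div (r - q)) * r"
      unfolding initial_degree_def by (rule cInf_lower[OF in_D]) simp
    then have "real (initial_degree (S m)) \<le> real (da + c * Suc (m div (r - q)) * r)"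
      by (simp only: of_nat_le_iff)
    also have "\<dots> = real da + (real c * real r) * real (Suc (m div (r - q)))"
      by (simp only: of_nat_add of_nat_mult mult_ac)
    also have "\<dots> \<le> real da + (real c * real r) * (real m / real (r - q) + 1)"
      by (intro add_left_mono mult_left_mono l_le) simp
    also have "\<dots> = real r * real c / real (r - q) * real m + (real da + real c * real r)"
      by (simp add: algebra_simps)
    finally show "real (initial_degree (S m)) \<le> real r * real c / real (r - q) * real m + (real da + real c * real r)" .
  qed
  then show ?thesis
    using limit_low limit_high unfolding S_def rq c_def by auto
qed

end
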